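(* Let $G=N\rtimes\mathbf{Z}$ be a finitely generated group, where $N$ is an infinite locally finite subgroup. If $G$ satisfies a law, then $G$ is densely related. In particular, $G$ has no simply connected asymptotic cone.
   Context: A group $G$ satisfies a law if there exists a non-trivial element $w(x_1,\dots,x_k)$ of a free group on $x_1,\dots,x_k$ such that $w(g_1,\dots,g_k)=1$ for all $g_1,\dots,g_k\in G$. For a group $G$ with a generating subset $S$, let $F_S$ be the free group on $S$ with its word length, let $N_S$ be the kernel of the natural map $F_S\to G$, and for $n\ge 0$ let $N_{S,n}$ be the normal subgroup of $F_S$ generated (as a normal subgroup) by the elements of $N_S$ of length at most $n$ ($N_{S,-1}$ is trivial). The relation range $\mathcal{R}_S(G)$ is the set of integers $n\ge 0$ such that $N_{S,n}$ properly contains $N_{S,n-1}$. A finitely generated group $G$ is densely related if, for a finite generating subset $S$, there exists $c>0$ such that for all integers $n\ge 1$ we have $\mathcal{R}_S(G)\cap[n,cn]\neq\emptyset$ (this does not depend on $S$). Asymptotic cones: for a non-principal ultrafilter $\omega$ on $\mathbf{N}$, a sequence $(x_n)$ of points of $G$ and a sequence of positive numbers $(s_n)$ with $\lim_\omega s_n=+\infty$, the asymptotic cone $\mathrm{Cone}^\omega(G,(x_n),(s_n))$ is the $\omega$-ultralimit of the pointed metric spaces $(G,\tfrac{1}{s_n}d_S,x_n)$, where $d_S$ is the word metric for a finite generating subset $S$. *)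

theory Defs
  imports "HOL-Analysis.Analysis" "HOL-Algebra.Elementary_Groups"
begin

section \<open>Free groups\<close>

text \<open>
  The letter \<open>(a, True)\<close> stands for the generator \<open>a\<close> and \<open>(a, False)\<close> for its inverse.
  Elements of the free group are the freely reduced words, so that the word length of an element
  is the length of the list.
\<close>

type_synonym 'a word = "('a \<times> bool) list"

definition inv_letter :: "'a \<times> bool \<Rightarrow> 'a \<times> bool" where
  "inv_letter x = (fst x, \<not> snd x)"

fun reduced :: "'a word \<Rightarrow> bool" where
  "reduced [] \<longleftrightarrow> True"
| "reduced [x] \<longleftrightarrow> True"
| "reduced (x # y # w) \<longleftrightarrow> y \<noteq> inv_letter x \<and> reduced (y # w)"

fun push :: "'a \<times> bool \<Rightarrow> 'a word \<Rightarrow> 'a word" where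
  "push x [] = [x]"
| "push x (y # w) = (if y = inv_letter x then w else x # y # w)"

definition reduce :: "'a word \<Rightarrow> 'a word" where
  "reduce w = foldr push w []"

definition free_group :: "'a set \<Rightarrow> 'a word monoid" where
  "free_group S =
     \<lparr>carrier = {w. set w \<subseteq> S \<times> UNIV \<and> reduced w},
      monoid.mult = (\<lambda>u v. reduce (u @ v)), one = []\<rparr>"

definition word_eval :: "('a, 'b) monoid_scheme \<Rightarrow> ('i \<Rightarrow> 'a) \<Rightarrow> 'i word \<Rightarrow> 'a" where
  "word_eval G f w =
     foldr (\<lambda>x g. (if snd x then f (fst x) else inv\<^bsub>G\<^esub> f (fst x)) \<otimes>\<^bsub>G\<^esub> g) w \<one>\<^bsub>G\<^esub>"

lemma inv_letter_inv_letter [simp]: "inv_letter (inv_letter x) = x"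
  by (simp add: inv_letter_def)

lemma fst_inv_letter [simp]: "fst (inv_letter x) = fst x"
  by (simp add: inv_letter_def)

lemma reduced_tl: "reduced (x # w) \<Longrightarrow> reduced w"
  by (cases w) auto

lemma reduced_push: "reduced w \<Longrightarrow> reduced (push x w)"
  by (cases w) (auto intro: reduced_tl)

lemma set_push: "set (push x w) \<subseteq> insert x (set w)"
  by (cases w) auto

lemma push_inv_letter: "reduced w \<Longrightarrow> push x (push (inv_letter x) w) = w"
proof (cases w)
  case (Cons y v)
  assume "reduced w"
  with Cons show ?thesis
    by (cases v) auto
qed simp

lemma push_reduced: "reduced (x # w) \<Longrightarrow> push x w = x # w"
  by (cases w) auto

lemma reduced_foldr_push: "reduced v \<Longrightarrow> reduced (foldr push u v)"
  by (induction u) (auto intro: reduced_push)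

lemma set_foldr_push: "set (foldr push u v) \<subseteq> set u \<union> set v"
  by (induction u) (use set_push in fastforce)+

lemma reduce_reduced: "reduced w \<Longrightarrow> reduce w = w"
  unfolding reduce_def  by (induction w) (use reduced_tl push_reduced in fastforce)+

lemma reduce_append: "reduced v \<Longrightarrow> reduce (u @ v) = foldr push u v"
  using reduce_reduced[of v] by (simp add: reduce_def)

lemma foldr_push_push:
  "reduced w \<Longrightarrow> foldr push (push x a) w = push x (foldr push a w)"
  by (cases a) (auto simp: push_inv_letter reduced_foldr_push)

lemma foldr_push_assoc:
  "reduced w \<Longrightarrow> foldr push (foldr push u v) w = foldr push u (foldr push v w)"
  by (induction u) (auto simp: foldr_push_push)

definition inv_word :: "'a word \<Rightarrow> 'a word" where
  "inv_word w = rev (map inv_letter w)"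

lemma foldr_push_inv_word:
  "reduced v \<Longrightarrow> foldr push (inv_word u) (foldr push u v) = v"
proof (induction u arbitrary: v)
  case (Cons x u)
  have "push (inv_letter x) (push x (foldr push u v)) = foldr push u v"
    using push_inv_letter[of "foldr push u v" "inv_letter x"] Cons.prems
    by (simp add: reduced_foldr_push)
  then show ?case
    using Cons by (simp add: inv_word_def)
qed (simp add: inv_word_def)

lemma group_free_group: "group (free_group S)"
proof (rule groupI)
  fix u v assume "u \<in> carrier (free_group S)" "v \<in> carrier (free_group S)"
  then show "u \<otimes>\<^bsub>free_group S\<^esub> v \<in> carrier (free_group S)"
    using set_foldr_push[of u v]
    by (auto simp: free_group_def reduce_append reduced_foldr_push)
next
  fix u v w
  assume "u \<in> carrier (free_group S)" "v \<in> carrier (free_group S)" "w \<in> carrier (free_group S)"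
  then show "u \<otimes>\<^bsub>free_group S\<^esub> v \<otimes>\<^bsub>free_group S\<^esub> w =
             u \<otimes>\<^bsub>free_group S\<^esub> (v \<otimes>\<^bsub>free_group S\<^esub> w)"
    by (simp add: free_group_def reduce_append reduced_foldr_push foldr_push_assoc)
next
  fix u assume u: "u \<in> carrier (free_group S)"
  then have ru: "reduced u" and su: "set u \<subseteq> S \<times> UNIV"
    by (auto simp: free_group_def)
  let ?v = "reduce (inv_word u)"
  have "set ?v \<subseteq> S \<times> UNIV"
    using set_foldr_push[of "inv_word u" "[]"] su
    by (fastforce simp: reduce_def inv_word_def inv_letter_def)
  then have "?v \<in> carrier (free_group S)"
    by (simp add: free_group_def reduce_def reduced_foldr_push)
  moreover have "foldr push ?v u = []"
    using foldr_push_inv_word[of "[]" u] foldr_push_assoc[OF ru, of "inv_word u" "[]"]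
      reduce_reduced[OF ru] by (simp add: reduce_def)
  then have "?v \<otimes>\<^bsub>free_group S\<^esub> u = \<one>\<^bsub>free_group S\<^esub>"
    using ru by (simp add: free_group_def reduce_append)
  ultimately show "\<exists>v\<in>carrier (free_group S). v \<otimes>\<^bsub>free_group S\<^esub> u = \<one>\<^bsub>free_group S\<^esub>"
    by blast
qed (auto simp: free_group_def reduce_reduced)

context group
begin

lemma word_eval_closed:
  assumes "f \<in> S \<rightarrow> carrier G" "set w \<subseteq> S \<times> UNIV"
  shows "word_eval G f w \<in> carrier G"
  using assms(2)
proof (induction w)
  case (Cons x w)
  then have "f (fst x) \<in> carrier G"
    using assms(1) by auto
  then show ?case
    using Cons by (simp add: word_eval_def)
qed (simp add: word_eval_def)

lemma word_eval_push:
  assumes f: "f \<in> S \<rightarrow> carrier G" and "fst x \<in> S" "set w \<subseteq> S \<times> UNIV"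
  shows "word_eval G f (push x w) =
    (if snd x then f (fst x) else inv f (fst x)) \<otimes> word_eval G f w"
proof (cases w)
  case (Cons y v)
  have "f (fst x) \<in> carrier G" "word_eval G f v \<in> carrier G"
    using assms Cons by (auto intro: word_eval_closed)
  then show ?thesis
    using Cons by (auto simp: word_eval_def inv_letter_def m_assoc[symmetric])
qed (simp add: word_eval_def)

lemma word_eval_hom:
  assumes f: "f \<in> S \<rightarrow> carrier G"
  shows "word_eval G f \<in> hom (free_group S) G"
proof (rule homI)
  fix u v assume "u \<in> carrier (free_group S)" "v \<in> carrier (free_group S)"
  then have u: "set u \<subseteq> S \<times> UNIV" and v: "set v \<subseteq> S \<times> UNIV" "reduced v"
    by (auto simp: free_group_def)
  have "word_eval G f (foldr push u v) = word_eval G f u \<otimes> word_eval G f v"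
    using u
  proof (induction u)
    case Nil
    then show ?case
      using word_eval_closed[OF f v(1)] by (simp add: word_eval_def)
  next
    case (Cons x u)
    have "f (fst x) \<in> carrier G" "word_eval G f u \<in> carrier G" "word_eval G f v \<in> carrier G"
      using Cons.prems f v by (auto intro: word_eval_closed)
    moreover have "set (foldr push u v) \<subseteq> S \<times> UNIV"
      using set_foldr_push[of u v] Cons.prems v by auto
    then have "word_eval G f (push x (foldr push u v)) =
        (if snd x then f (fst x) else inv f (fst x)) \<otimes> word_eval G f (foldr push u v)"
      using Cons.prems by (intro word_eval_push[OF f]) auto
    ultimately show ?case
      using Cons by (auto simp: word_eval_def m_assoc)
  qed
  then show "word_eval G f (u \<otimes>\<^bsub>free_group S\<^esub> v) = word_eval G f u \<otimes> word_eval G f v"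
    using v by (simp add: free_group_def reduce_append)
qed (use word_eval_closed[OF f] in \<open>auto simp: free_group_def\<close>)

end

section \<open>Laws, locally finite groups, semidirect products\<close>

definition satisfies_law :: "('a, 'b) monoid_scheme \<Rightarrow> bool" where
  "satisfies_law G \<longleftrightarrow>
     (\<exists>(k::nat). \<exists>w\<in>carrier (free_group {..<k}). w \<noteq> \<one>\<^bsub>free_group {..<k}\<^esub> \<and>
        (\<forall>g \<in> {..<k} \<rightarrow> carrier G. word_eval G g w = \<one>\<^bsub>G\<^esub>))"

definition finite_generating_set :: "('a, 'b) monoid_scheme \<Rightarrow> 'a set \<Rightarrow> bool" where
  "finite_generating_set G S \<longleftrightarrow> finite S \<and> S \<subseteq> carrier G \<and> generate G S = carrier G"

definition finitely_generated :: "('a, 'b) monoid_scheme \<Rightarrow> bool" where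
  "finitely_generated G \<longleftrightarrow> (\<exists>S. finite_generating_set G S)"

definition locally_finite_subgroup :: "('a, 'b) monoid_scheme \<Rightarrow> 'a set \<Rightarrow> bool" where
  "locally_finite_subgroup G N \<longleftrightarrow>
     subgroup N G \<and> (\<forall>F. finite F \<and> F \<subseteq> N \<longrightarrow> finite (generate G F))"

definition semidirect_product :: "('a, 'b) monoid_scheme \<Rightarrow> 'a set \<Rightarrow> 'a set \<Rightarrow> bool" where
  "semidirect_product G N Q \<longleftrightarrow>
     N \<lhd> G \<and> subgroup Q G \<and> N \<inter> Q = {\<one>\<^bsub>G\<^esub>} \<and> N <#>\<^bsub>G\<^esub> Q = carrier G"

section \<open>Relation range\<close>

definition relation_subgroup :: "('a, 'b) monoid_scheme \<Rightarrow> 'a set \<Rightarrow> 'a word set" where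
  "relation_subgroup G S = kernel (free_group S) G (word_eval G (\<lambda>s. s))"

text \<open>The index is an integer so that index \<open>-1\<close> gives the trivial subgroup.\<close>

definition relation_subgroup_upto ::
    "('a, 'b) monoid_scheme \<Rightarrow> 'a set \<Rightarrow> int \<Rightarrow> 'a word set" where
  "relation_subgroup_upto G S n =
     (\<lambda>K. K \<lhd> free_group S) hull {w \<in> relation_subgroup G S. int (length w) \<le> n}"

definition relation_range :: "('a, 'b) monoid_scheme \<Rightarrow> 'a set \<Rightarrow> int set" where
  "relation_range G S =
     {n. 0 \<le> n \<and> relation_subgroup_upto G S (n - 1) \<subset> relation_subgroup_upto G S n}"

definition densely_related :: "('a, 'b) monoid_scheme \<Rightarrow> bool" where
  "densely_related G \<longleftrightarrow>
     (\<exists>S. finite_generating_set G S \<and>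
        (\<exists>c::real. c > 0 \<and>
           (\<forall>n\<ge>1. \<exists>r\<in>relation_range G S. n \<le> r \<and> real_of_int r \<le> c * real_of_int n)))"

section \<open>Asymptotic cones\<close>

definition word_norm :: "('a, 'b) monoid_scheme \<Rightarrow> 'a set \<Rightarrow> 'a \<Rightarrow> nat" where
  "word_norm G S g =
     (LEAST n. \<exists>w\<in>carrier (free_group S). length w = n \<and> word_eval G (\<lambda>s. s) w = g)"

definition word_metric :: "('a, 'b) monoid_scheme \<Rightarrow> 'a set \<Rightarrow> 'a \<Rightarrow> 'a \<Rightarrow> real" where
  "word_metric G S g h = real (word_norm G S (inv\<^bsub>G\<^esub> g \<otimes>\<^bsub>G\<^esub> h))"

definition nonprincipal_ultrafilter :: "nat filter \<Rightarrow> bool" where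
  "nonprincipal_ultrafilter \<omega> \<longleftrightarrow>
     \<omega> \<noteq> bot \<and>
     (\<forall>P. eventually P \<omega> \<or> eventually (\<lambda>n. \<not> P n) \<omega>) \<and>
     (\<forall>m. \<not> eventually (\<lambda>n. n = m) \<omega>)"

text \<open>
  The ultralimit along \<open>\<omega>\<close> of the pointed metric spaces \<open>(M n, d n, p n)\<close>: sequences at bounded
  distance from the base points, modulo vanishing of the limit distance.
\<close>

definition ultralimit_seqs ::
    "nat filter \<Rightarrow> (nat \<Rightarrow> 'a set) \<Rightarrow> (nat \<Rightarrow> 'a \<Rightarrow> 'a \<Rightarrow> real) \<Rightarrow> (nat \<Rightarrow> 'a) \<Rightarrow> (nat \<Rightarrow> 'a) set"
  where
  "ultralimit_seqs \<omega> M d p =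
     {y. (\<forall>n. y n \<in> M n) \<and> (\<exists>C. \<forall>\<^sub>F n in \<omega>. d n (p n) (y n) \<le> C)}"

definition ultralimit_predist ::
    "nat filter \<Rightarrow> (nat \<Rightarrow> 'a \<Rightarrow> 'a \<Rightarrow> real) \<Rightarrow> (nat \<Rightarrow> 'a) \<Rightarrow> (nat \<Rightarrow> 'a) \<Rightarrow> real" where
  "ultralimit_predist \<omega> d y z = Lim \<omega> (\<lambda>n. d n (y n) (z n))"

definition ultralimit_points ::
    "nat filter \<Rightarrow> (nat \<Rightarrow> 'a set) \<Rightarrow> (nat \<Rightarrow> 'a \<Rightarrow> 'a \<Rightarrow> real) \<Rightarrow> (nat \<Rightarrow> 'a) \<Rightarrow> (nat \<Rightarrow> 'a) set set"
  where
  "ultralimit_points \<omega> M d p =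
     ultralimit_seqs \<omega> M d p //
       {(y, z). y \<in> ultralimit_seqs \<omega> M d p \<and> z \<in> ultralimit_seqs \<omega> M d p \<and>
                ultralimit_predist \<omega> d y z = 0}"

text \<open>
  The distance of two classes is the common value at all representatives.  The value \<open>0\<close> off
  the carrier is needed because \<^const>\<open>Metric_space\<close> asks for nonnegativity and symmetry on the
  whole type.
\<close>

definition ultralimit_dist ::
    "nat filter \<Rightarrow> (nat \<Rightarrow> 'a set) \<Rightarrow> (nat \<Rightarrow> 'a \<Rightarrow> 'a \<Rightarrow> real) \<Rightarrow> (nat \<Rightarrow> 'a) \<Rightarrow>
      (nat \<Rightarrow> 'a) set \<Rightarrow> (nat \<Rightarrow> 'a) set \<Rightarrow> real" where
  "ultralimit_dist \<omega> M d p A B =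
     (if A \<in> ultralimit_points \<omega> M d p \<and> B \<in> ultralimit_points \<omega> M d p
      then THE r. \<exists>y\<in>A. \<exists>z\<in>B. r = ultralimit_predist \<omega> d y z else 0)"

definition rescaled_word_metric ::
    "('a, 'b) monoid_scheme \<Rightarrow> 'a set \<Rightarrow> (nat \<Rightarrow> real) \<Rightarrow> nat \<Rightarrow> 'a \<Rightarrow> 'a \<Rightarrow> real" where
  "rescaled_word_metric G S s n g h = 1 / s n * word_metric G S g h"

definition asymptotic_cone ::
    "('a, 'b) monoid_scheme \<Rightarrow> 'a set \<Rightarrow> nat filter \<Rightarrow> (nat \<Rightarrow> 'a) \<Rightarrow> (nat \<Rightarrow> real) \<Rightarrow>
      (nat \<Rightarrow> 'a) set topology" where
  "asymptotic_cone G S \<omega> x s =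
     Metric_space.mtopology
       (ultralimit_points \<omega> (\<lambda>n. carrier G) (rescaled_word_metric G S s) x)
       (ultralimit_dist \<omega> (\<lambda>n. carrier G) (rescaled_word_metric G S s) x)"

lemma ultrafilter_bounded_convergent:
  fixes f :: "nat \<Rightarrow> real"
  assumes \<omega>: "nonprincipal_ultrafilter \<omega>" and f: "\<forall>\<^sub>F n in \<omega>. \<bar>f n\<bar> \<le> C"
  shows "(f \<longlongrightarrow> Lim \<omega> f) \<omega>"
proof -
  have nb: "\<omega> \<noteq> bot"
    using \<omega> by (simp add: nonprincipal_ultrafilter_def)
  have "eventually (\<lambda>x. x \<in> {-C..C}) (filtermap f \<omega>)"
    using f by (auto simp: eventually_filtermap elim!: eventually_mono)
  then obtain l where l: "inf (nhds l) (filtermap f \<omega>) \<noteq> bot"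
    using compact_Icc[of "-C" C] nb unfolding compact_filter by (metis filtermap_bot_iff)
  have "eventually P (filtermap f \<omega>)" if P: "eventually P (nhds l)" for P
  proof (rule ccontr)
    assume "\<not> eventually P (filtermap f \<omega>)"
    then have "eventually (\<lambda>x. \<not> P x) (filtermap f \<omega>)"
      using \<omega> unfolding nonprincipal_ultrafilter_def eventually_filtermap by blast
    with P have "eventually (\<lambda>x. False) (inf (nhds l) (filtermap f \<omega>))"
      unfolding eventually_inf by blast
    with l show False
      by (simp add: trivial_limit_def)
  qed
  then have "(f \<longlongrightarrow> l) \<omega>"
    by (auto simp: filterlim_def le_filter_def)
  then show ?thesis
    using tendsto_Lim[OF nb] by metis
qed

lemma Metric_space_ultralimit:
  assumes \<omega>: "nonprincipal_ultrafilter \<omega>"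
    and nonneg: "\<And>n y z. y \<in> M n \<Longrightarrow> z \<in> M n \<Longrightarrow> 0 \<le> d n y z"
    and refl: "\<And>n y. y \<in> M n \<Longrightarrow> d n y y = 0"
    and sym: "\<And>n y z. y \<in> M n \<Longrightarrow> z \<in> M n \<Longrightarrow> d n y z = d n z y"
    and tri: "\<And>n y z w. y \<in> M n \<Longrightarrow> z \<in> M n \<Longrightarrow> w \<in> M n \<Longrightarrow> d n y w \<le> d n y z + d n z w"
    and p: "\<And>n. p n \<in> M n"
  shows "Metric_space (ultralimit_points \<omega> M d p) (ultralimit_dist \<omega> M d p)"
proof -
  let ?X = "ultralimit_seqs \<omega> M d p"
  let ?D = "ultralimit_predist \<omega> d"
  let ?r = "{(y, z). y \<in> ?X \<and> z \<in> ?X \<and> ?D y z = 0}"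
  have nb: "\<omega> \<noteq> bot"
    using \<omega> by (simp add: nonprincipal_ultrafilter_def)
  have inM: "y n \<in> M n" if "y \<in> ?X" for y n
    using that by (simp add: ultralimit_seqs_def)
  have lim: "((\<lambda>n. d n (y n) (z n)) \<longlongrightarrow> ?D y z) \<omega>" if y: "y \<in> ?X" and z: "z \<in> ?X" for y z
  proof -
    obtain C C' where "\<forall>\<^sub>F n in \<omega>. d n (p n) (y n) \<le> C" "\<forall>\<^sub>F n in \<omega>. d n (p n) (z n) \<le> C'"
      using y z by (auto simp: ultralimit_seqs_def)
    then have "\<forall>\<^sub>F n in \<omega>. \<bar>d n (y n) (z n)\<bar> \<le> C + C'"
    proof eventually_elim
      case (elim n)
      then show ?case
        using nonneg[of "y n" n "z n"] tri[of "y n" n "p n" "z n"] sym[of "y n" n "p n"]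
          inM[OF y] inM[OF z] p by fastforce
    qed
    then show ?thesis
      unfolding ultralimit_predist_def by (rule ultrafilter_bounded_convergent[OF \<omega>])
  qed
  have D_nonneg: "0 \<le> ?D y z" if "y \<in> ?X" "z \<in> ?X" for y z
    by (rule tendsto_lowerbound[OF lim[OF that]]) (use that inM nonneg nb in auto)
  have D_refl: "?D y y = 0" if "y \<in> ?X" for y
    using that inM refl tendsto_Lim[OF nb tendsto_const[of 0]] by (simp add: ultralimit_predist_def)
  have D_sym: "?D y z = ?D z y" if "y \<in> ?X" "z \<in> ?X" for y z
    using that inM sym by (simp add: ultralimit_predist_def)
  have D_tri: "?D y w \<le> ?D y z + ?D z w" if "y \<in> ?X" "z \<in> ?X" "w \<in> ?X" for y z w
    by (rule tendsto_le[OF nb tendsto_add[OF lim lim] lim]) (use that inM tri in auto)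
  have eq: "equiv ?X ?r"
  proof (rule equivI)
    show "refl_on ?X ?r" "sym ?r"
      using D_refl D_sym by (auto simp: refl_on_def sym_def)
    show "trans ?r"
    proof (rule transI, clarsimp)
      fix y z w assume "y \<in> ?X" "z \<in> ?X" "w \<in> ?X" "?D y z = 0" "?D z w = 0"
      then show "?D y w = 0"
        using D_tri[of y z w] D_nonneg[of y w] by simp
    qed
  qed auto
  have D_cong: "?D y z = ?D y' z'" if "(y, y') \<in> ?r" "(z, z') \<in> ?r" for y y' z z'
    using that D_tri[of y y' z] D_tri[of y' z' z] D_tri[of y' y z'] D_tri[of y z z']
      D_sym[of y y'] D_sym[of z z'] by auto
  have pts: "ultralimit_points \<omega> M d p = ?X // ?r"
    by (simp add: ultralimit_points_def)
  have dist: "ultralimit_dist \<omega> M d p (?r `` {y}) (?r `` {z}) = ?D y z"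
    if "y \<in> ?X" "z \<in> ?X" for y z
  proof -
    have "y \<in> ?r `` {y}" "z \<in> ?r `` {z}"
      using that D_refl by auto
    moreover have "r = ?D y z" if "r = ?D y' z'" "y' \<in> ?r `` {y}" "z' \<in> ?r `` {z}" for r y' z'
      using that D_cong[of y y' z z'] by auto
    ultimately have "(THE r. \<exists>y'\<in>?r `` {y}. \<exists>z'\<in>?r `` {z}. r = ?D y' z') = ?D y z"
      by (intro the_equality) blast+
    moreover have "?r `` {y} \<in> ultralimit_points \<omega> M d p" "?r `` {z} \<in> ultralimit_points \<omega> M d p"
      unfolding pts using that by (blast intro: quotientI)+
    ultimately show ?thesis
      unfolding ultralimit_dist_def by (simp only: simp_thms if_True)
  qed
  have rep: "\<exists>y\<in>?X. A = ?r `` {y}" if "A \<in> ultralimit_points \<omega> M d p" for A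
    using that unfolding pts by (blast elim: quotientE)
  show ?thesis
  proof
    fix A B
    show "0 \<le> ultralimit_dist \<omega> M d p A B"
    proof (cases "A \<in> ultralimit_points \<omega> M d p \<and> B \<in> ultralimit_points \<omega> M d p")
      case True
      then obtain y z where yz: "y \<in> ?X" "z \<in> ?X" and "A = ?r `` {y}" "B = ?r `` {z}"
        using rep[of A] rep[of B] by (elim conjE) (auto simp only: Bex_def)
      then show ?thesis
        using dist[OF yz] dist[OF yz(2,1)] D_nonneg[OF yz] by (simp only:)
    qed (auto simp: ultralimit_dist_def)
    show "ultralimit_dist \<omega> M d p A B = ultralimit_dist \<omega> M d p B A"
    proof (cases "A \<in> ultralimit_points \<omega> M d p \<and> B \<in> ultralimit_points \<omega> M d p")
      case True
      then obtain y z where yz: "y \<in> ?X" "z \<in> ?X" and "A = ?r `` {y}" "B = ?r `` {z}"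
        using rep[of A] rep[of B] by (elim conjE) (auto simp only: Bex_def)
      then show ?thesis
        using dist[OF yz] dist[OF yz(2,1)] D_sym[OF yz] by (simp only:)
    qed (auto simp: ultralimit_dist_def)
  next
    fix A B assume "A \<in> ultralimit_points \<omega> M d p" "B \<in> ultralimit_points \<omega> M d p"
    then obtain y z where yz: "y \<in> ?X" "z \<in> ?X" "A = ?r `` {y}" "B = ?r `` {z}"
      using rep[of A] rep[of B] by (auto simp only: Bex_def)
    have "?r `` {y} = ?r `` {z} \<longleftrightarrow> (y, z) \<in> ?r"
      by (rule eq_equiv_class_iff[OF eq yz(1,2)])
    then show "ultralimit_dist \<omega> M d p A B = 0 \<longleftrightarrow> A = B"
      using yz dist[OF yz(1,2)] by simp
  next
    fix A B C assume "A \<in> ultralimit_points \<omega> M d p" "B \<in> ultralimit_points \<omega> M d p"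
      "C \<in> ultralimit_points \<omega> M d p"
    then obtain y z w where "y \<in> ?X" "z \<in> ?X" "w \<in> ?X"
      and "A = ?r `` {y}" "B = ?r `` {z}" "C = ?r `` {w}"
      using rep[of A] rep[of B] rep[of C] by (auto simp only: Bex_def)
    then show "ultralimit_dist \<omega> M d p A C \<le> ultralimit_dist \<omega> M d p A B + ultralimit_dist \<omega> M d p B C"
      using D_tri dist by simp
  qed
qed

lemma length_push: "length (push x w) \<le> Suc (length w)"
  by (cases w) auto

lemma length_foldr_push: "length (foldr push u v) \<le> length u + length v"
proof (induction u)
  case (Cons x u)
  then show ?case
    using length_push[of x "foldr push u v"] by simp
qed simp

context group
begin

lemma ex_word:
  assumes S: "S \<subseteq> carrier G" "generate G S = carrier G" and g: "g \<in> carrier G"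
  shows "\<exists>w\<in>carrier (free_group S). word_eval G (\<lambda>s. s) w = g"
proof -
  interpret F: group "free_group S" by (rule group_free_group)
  have "(\<lambda>s. s) \<in> S \<rightarrow> carrier G"
    using S by auto
  then interpret h: group_hom "free_group S" G "word_eval G (\<lambda>s. s)"
    by unfold_locales (rule word_eval_hom)
  have "subgroup (word_eval G (\<lambda>s. s) ` carrier (free_group S)) G"
    by (rule h.img_is_subgroup)
  moreover have "S \<subseteq> word_eval G (\<lambda>s. s) ` carrier (free_group S)"
  proof
    fix s assume "s \<in> S"
    then have "[(s, True)] \<in> carrier (free_group S)" "word_eval G (\<lambda>s. s) [(s, True)] = s"
      using S by (auto simp: free_group_def word_eval_def)
    then show "s \<in> word_eval G (\<lambda>s. s) ` carrier (free_group S)"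
      by force
  qed
  ultimately have "generate G S \<subseteq> word_eval G (\<lambda>s. s) ` carrier (free_group S)"
    by (rule generate_subgroup_incl[rotated])
  then show ?thesis
    using S g by auto
qed

lemma word_norm_le:
  "w \<in> carrier (free_group S) \<Longrightarrow> word_norm G S (word_eval G (\<lambda>s. s) w) \<le> length w"
  unfolding word_norm_def by (rule Least_le) blast

lemma word_norm_attained:
  assumes "S \<subseteq> carrier G" "generate G S = carrier G" "g \<in> carrier G"
  obtains w where "w \<in> carrier (free_group S)" "word_eval G (\<lambda>s. s) w = g"
    "length w = word_norm G S g"
proof -
  have "\<exists>n. \<exists>w\<in>carrier (free_group S). length w = n \<and> word_eval G (\<lambda>s. s) w = g"
    using ex_word[OF assms] by blast
  from LeastI_ex[OF this] show ?thesis
    using that unfolding word_norm_def by blast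
qed

lemma word_norm_one: "word_norm G S \<one> = 0"
  using word_norm_le[of "[]" S] by (simp add: free_group_def word_eval_def)

lemma word_norm_mult:
  assumes S: "S \<subseteq> carrier G" "generate G S = carrier G" and g: "g \<in> carrier G" "h \<in> carrier G"
  shows "word_norm G S (g \<otimes> h) \<le> word_norm G S g + word_norm G S h"
proof -
  interpret F: group "free_group S" by (rule group_free_group)
  obtain u where u: "u \<in> carrier (free_group S)" "word_eval G (\<lambda>s. s) u = g"
    "length u = word_norm G S g" using word_norm_attained[OF S g(1)] .
  obtain v where v: "v \<in> carrier (free_group S)" "word_eval G (\<lambda>s. s) v = h"
    "length v = word_norm G S h" using word_norm_attained[OF S g(2)] .
  have "(\<lambda>s. s) \<in> S \<rightarrow> carrier G"
    using S by auto
  then have "word_eval G (\<lambda>s. s) (u \<otimes>\<^bsub>free_group S\<^esub> v) = g \<otimes> h"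
    using hom_mult[OF word_eval_hom u(1) v(1)] u v by simp
  moreover have "length (u \<otimes>\<^bsub>free_group S\<^esub> v) \<le> length u + length v"
    using v length_foldr_push[of u v] by (auto simp: free_group_def reduce_append)
  ultimately show ?thesis
    using word_norm_le[OF F.m_closed[OF u(1) v(1)]] u v by simp
qed

lemma word_norm_inv_le:
  assumes S: "S \<subseteq> carrier G" "generate G S = carrier G" and g: "g \<in> carrier G"
  shows "word_norm G S (inv g) \<le> word_norm G S g"
proof -
  interpret F: group "free_group S" by (rule group_free_group)
  obtain u where u: "u \<in> carrier (free_group S)" "word_eval G (\<lambda>s. s) u = g"
    "length u = word_norm G S g" using word_norm_attained[OF S g] .
  have "(\<lambda>s. s) \<in> S \<rightarrow> carrier G"
    using S by auto
  then interpret h: group_hom "free_group S" G "word_eval G (\<lambda>s. s)"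
    by unfold_locales (rule word_eval_hom)
  let ?v = "reduce (inv_word u)"
  have "set ?v \<subseteq> S \<times> UNIV"
    using set_foldr_push[of "inv_word u" "[]"] u(1)
    by (fastforce simp: reduce_def inv_word_def inv_letter_def free_group_def)
  then have v: "?v \<in> carrier (free_group S)"
    by (simp add: free_group_def reduce_def reduced_foldr_push)
  have ru: "reduced u"
    using u by (simp add: free_group_def)
  have "foldr push ?v u = []"
    using foldr_push_inv_word[of "[]" u] foldr_push_assoc[OF ru, of "inv_word u" "[]"]
      reduce_reduced[OF ru] by (simp add: reduce_def)
  then have "?v \<otimes>\<^bsub>free_group S\<^esub> u = \<one>\<^bsub>free_group S\<^esub>"
    using ru by (simp add: free_group_def reduce_append)
  then have "word_eval G (\<lambda>s. s) ?v = inv g"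
    using F.inv_equality[OF _ u(1) v] h.hom_inv[OF u(1)] u(2) by simp
  then show ?thesis
    using word_norm_le[OF v] length_foldr_push[of "inv_word u" "[]"] u(3)
    by (simp add: reduce_def inv_word_def)
qed

lemma Metric_space_asymptotic_cone:
  assumes S: "finite_generating_set G S" and \<omega>: "nonprincipal_ultrafilter \<omega>"
    and x: "range x \<subseteq> carrier G" and s: "\<And>n. 0 < s n"
  shows "Metric_space
    (ultralimit_points \<omega> (\<lambda>n. carrier G) (rescaled_word_metric G S s) x)
    (ultralimit_dist \<omega> (\<lambda>n. carrier G) (rescaled_word_metric G S s) x)"
proof (rule Metric_space_ultralimit[OF \<omega>])
  have S': "S \<subseteq> carrier G" "generate G S = carrier G"
    using S by (auto simp: finite_generating_set_def)
  fix n y z assume y: "y \<in> carrier G" and z: "z \<in> carrier G"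
  show "0 \<le> rescaled_word_metric G S s n y z"
    using s[of n] by (simp add: rescaled_word_metric_def word_metric_def)
  have "word_norm G S (inv y \<otimes> z) = word_norm G S (inv z \<otimes> y)"
    using word_norm_inv_le[OF S', of "inv y \<otimes> z"] word_norm_inv_le[OF S', of "inv z \<otimes> y"] y z
    by (simp add: inv_mult_group)
  then show "rescaled_word_metric G S s n y z = rescaled_word_metric G S s n z y"
    by (simp add: rescaled_word_metric_def word_metric_def)
  fix w assume w: "w \<in> carrier G"
  have "inv y \<otimes> z \<otimes> (inv z \<otimes> w) = inv y \<otimes> w"
    using y z w by (metis inv_closed inv_solve_left m_assoc m_closed)
  then have "word_norm G S (inv y \<otimes> w) \<le> word_norm G S (inv y \<otimes> z) + word_norm G S (inv z \<otimes> w)"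
    using word_norm_mult[OF S', of "inv y \<otimes> z" "inv z \<otimes> w"] y z w by simp
  then show "rescaled_word_metric G S s n y w \<le>
      rescaled_word_metric G S s n y z + rescaled_word_metric G S s n z w"
    using s[of n] by (simp add: rescaled_word_metric_def word_metric_def field_simps)
qed (use x word_norm_one in \<open>auto simp: rescaled_word_metric_def word_metric_def\<close>)

end

text \<open>The analogue for abstract topologies of \<^const>\<open>simply_connected\<close>; it entails
  path-connectedness, since \<open>p\<close> and \<open>q\<close> may be constant loops.\<close>

definition simply_connected_space :: "'a topology \<Rightarrow> bool" where
  "simply_connected_space X \<longleftrightarrow>
     (\<forall>p q. pathin X p \<and> p 1 = p 0 \<and> pathin X q \<and> q 1 = q 0 \<longrightarrow>
        homotopic_with (\<lambda>r. r 1 = r 0) (top_of_set {0..1}) X p q)"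

end

theory Submission
  imports Defs
begin

text \<open>
  Write \<open>G = N \<rtimes> \<langle>t\<rangle>\<close> and let \<open>F\<close> be the finite set of \<open>N\<close>-components of the generators.
  For each \<open>M\<close> the window \<open>A\<close> generated by the \<open>t\<^sup>i f t\<^sup>-\<^sup>i\<close> with \<open>\<bar>i\<bar> \<le> M\<close> is finite, and
  conjugation by \<open>t\<close> maps the proper subgroup \<open>C\<close> of the window \<open>[-M, M - 1]\<close> onto the proper
  subgroup \<open>D\<close> of the window \<open>[-M + 1, M]\<close>; properness holds because otherwise \<open>N = A\<close> would be
  finite. Relators of length \<open>O(M)\<close> already hold in the HNN extension of \<open>A\<close> along \<open>C \<cong> D\<close>. That
  group contains, by ping-pong, free subgroups generated by the images of words of length \<open>O(M)\<close>, so
  the law of \<open>G\<close> evaluated at these words is a relator of length \<open>O(M)\<close> that does not follow from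
  the relators of length at most \<open>M\<close>. Hence the relation range meets every \<open>[n, cn]\<close>.

  If a cone were simply connected, a sequence of such relators whose lengths are comparable to the
  scaling would converge to a Lipschitz loop. A null-homotopy of this loop, subdivided into small
  squares and pulled back to \<open>G\<close>, would express one of the relators by much shorter ones.
\<close>

section \<open>Ping-pong and a permutation model of HNN extensions\<close>

text \<open>Linearity comes from comparing two lengths. A word of length n moves the window index by
  at most E n, where E bounds the t-exponents of the generators, so M of order n suffices to kill
  all relators of length n. In the other direction the ping-pong needs one element b of A outside
  both C and D; b can be taken as an extreme generator t^M f t^-M or t^-M f' t^M, or as a product of
  the two, so it also lifts to a word of length O(M). No normal form theorem for HNN extensions
  enters, and the extension itself is never formed. All that is needed is a homomorphism from the
  free group on S to some group in which the short relators die and the chosen value of the law does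
  not; a permutation group built from free orbits of A provides this. Finiteness of A is used twice:
  it turns the bijection of C onto D into the statement that neither subgroup is all of A, and it
  splits countably infinite sets with free C-action into infinitely many orbits, so that any two of
  them are isomorphic. Both conclusions rest on one statement about gaps: for all n at least 1 some
  relator of length at most C n lies outside \<open>relation_subgroup_upto G S n\<close>.\<close>

definition perm_group :: "('x \<Rightarrow> 'x) monoid" where
  "perm_group = \<lparr>carrier = {f. bij f}, monoid.mult = (\<circ>), one = id\<rparr>"

lemma perm_group_simps [simp]:
  "carrier perm_group = {f. bij f}" "f \<otimes>\<^bsub>perm_group\<^esub> g = f \<circ> g" "\<one>\<^bsub>perm_group\<^esub> = id"
  by (simp_all add: perm_group_def)

lemma group_perm_group: "group perm_group"
proof (rule groupI)
  fix f :: "'x \<Rightarrow> 'x" assume "f \<in> carrier perm_group"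
  then show "\<exists>g\<in>carrier perm_group. g \<otimes>\<^bsub>perm_group\<^esub> f = \<one>\<^bsub>perm_group\<^esub>"
    by (intro bexI[of _ "inv_into UNIV f"]) (auto simp: bij_imp_bij_inv bij_is_inj)
qed (auto simp: o_assoc bij_comp)

lemma inv_perm_group [simp]: "bij f \<Longrightarrow> inv\<^bsub>perm_group\<^esub> f = inv_into UNIV f"
  by (rule group.inv_equality[OF group_perm_group])
    (auto simp: bij_imp_bij_inv bij_is_inj)

text \<open>Putting the same power of \<open>\<tau>\<close> on both sides of \<open>\<beta>\<close>
  makes the inverse letter have the same shape with the negated exponent. In a reduced word the
  powers that meet between two neighbouring letters therefore add up to a nonzero exponent. Nonzero
  powers of \<open>\<tau>\<close> send R into P or P', and \<open>\<beta>\<close> and its inverse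
  send these back to R, so a point of R ends up outside R.\<close>

lemma ping_pong:
  fixes \<tau> \<beta> :: "'x \<Rightarrow> 'x"
  assumes bij: "bij \<tau>" "bij \<beta>"
    and pos: "\<tau> ` (R \<union> P) \<subseteq> P" and neg: "inv_into UNIV \<tau> ` (R \<union> P') \<subseteq> P'"
    and \<beta>: "\<beta> ` (P \<union> P') \<subseteq> R" "inv_into UNIV \<beta> ` (P \<union> P') \<subseteq> R"
    and R: "R \<noteq> {}" "R \<inter> (P \<union> P') = {}"
    and w: "reduced w" "w \<noteq> []"
  shows "word_eval perm_group
           (\<lambda>i. \<tau> [^]\<^bsub>perm_group\<^esub> Suc i \<otimes>\<^bsub>perm_group\<^esub> \<beta> \<otimes>\<^bsub>perm_group\<^esub> \<tau> [^]\<^bsub>perm_group\<^esub> Suc i) w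
         \<noteq> \<one>\<^bsub>perm_group\<^esub>"
proof -
  interpret K: group "perm_group :: ('x \<Rightarrow> 'x) monoid" by (rule group_perm_group)
  let ?p = "\<lambda>e::int. \<tau> [^]\<^bsub>perm_group\<^esub> e"
  define sg where "sg x = (if snd x then int (Suc (fst x)) else - int (Suc (fst x)))" for x :: "nat \<times> bool"
  define \<xi> where "\<xi> i = \<tau> [^]\<^bsub>perm_group\<^esub> Suc i \<otimes>\<^bsub>perm_group\<^esub> \<beta> \<otimes>\<^bsub>perm_group\<^esub> \<tau> [^]\<^bsub>perm_group\<^esub> Suc i" for i
  have \<tau>K: "\<tau> \<in> carrier perm_group" and \<beta>K: "\<beta> \<in> carrier perm_group"
    using bij by auto
  have pc: "bij (?p e)" for e
    using K.int_pow_closed[OF \<tau>K] by simp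
  have p_nat: "?p (int (Suc n)) z \<in> P" if "z \<in> R \<union> P" for n z
    using that pos unfolding int_pow_int
    by (induction n arbitrary: z) auto
  have n_nat: "?p (- int (Suc n)) z \<in> P'" if "z \<in> R \<union> P'" for n z
  proof -
    have "?p (- int (Suc n)) = inv_into UNIV \<tau> [^]\<^bsub>perm_group\<^esub> Suc n"
      using K.int_pow_neg_int[OF \<tau>K, of "Suc n"] K.nat_pow_inv[OF \<tau>K, of "Suc n"] bij by simp
    moreover have "(inv_into UNIV \<tau> [^]\<^bsub>perm_group\<^esub> Suc n) z \<in> P'"
      using that neg by (induction n arbitrary: z) auto
    ultimately show ?thesis by simp
  qed
  have pR: "?p e z \<in> P \<union> P'" if "z \<in> R" "e \<noteq> 0" for e z
    using that p_nat n_nat by (cases e rule: int_cases2) (metis UnCI not0_implies_Suc of_nat_0 minus_zero)+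
  have padd: "?p e (?p e' z) = ?p (e + e') z" for e e' z
    using K.int_pow_mult[OF \<tau>K, of e e'] by (metis comp_apply perm_group_simps(2))
  have \<xi>: "\<xi> i \<in> carrier perm_group" for i
    unfolding \<xi>_def using \<tau>K \<beta>K by (intro K.m_closed K.nat_pow_closed)
  have letter: "(if snd x then \<xi> (fst x) else inv\<^bsub>perm_group\<^esub> (\<xi> (fst x))) z
      = ?p (sg x) ((if snd x then \<beta> else inv_into UNIV \<beta>) (?p (sg x) z))" for x z
  proof (cases "snd x")
    case True
    then show ?thesis by (simp add: \<xi>_def sg_def int_pow_int[symmetric] del: of_nat_Suc nat_pow_Suc)
  next
    case False
    let ?t = "\<tau> [^]\<^bsub>perm_group\<^esub> Suc (fst x)"
    have t: "?t \<in> carrier perm_group" using \<tau>K by (rule K.nat_pow_closed)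
    have "inv\<^bsub>perm_group\<^esub> (\<xi> (fst x)) =
       inv\<^bsub>perm_group\<^esub> ?t \<otimes>\<^bsub>perm_group\<^esub> (inv\<^bsub>perm_group\<^esub> \<beta> \<otimes>\<^bsub>perm_group\<^esub> inv\<^bsub>perm_group\<^esub> ?t)"
      unfolding \<xi>_def using t \<beta>K by (simp only: K.inv_mult_group K.m_closed)
    moreover have "?p (sg x) = inv\<^bsub>perm_group\<^esub> ?t"
      using False K.int_pow_neg_int[OF \<tau>K, of "Suc (fst x)"] by (simp add: sg_def del: of_nat_Suc nat_pow_Suc)
    ultimately show ?thesis using False bij by (simp del: nat_pow_Suc)
  qed
  obtain z where z: "z \<in> R" using R by auto
  \<comment> \<open>The leftmost power of \<open>\<tau>\<close> is kept in front of R instead of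
    being applied, because the next letter on the left merges with it.\<close>
  have main: "word_eval perm_group \<xi> (x # v) z \<in> ?p (sg x) ` R" if "reduced (x # v)" for x v
    using that
  proof (induction v arbitrary: x)
    case Nil
    have "sg x \<noteq> 0" by (simp add: sg_def)
    then have "(if snd x then \<beta> else inv_into UNIV \<beta>) (?p (sg x) z) \<in> R"
      using pR[OF z, of "sg x"] \<beta> by (auto simp: image_subset_iff)
    moreover have "word_eval perm_group \<xi> [x] z = ?p (sg x) ((if snd x then \<beta> else inv_into UNIV \<beta>) (?p (sg x) z))"
      unfolding letter[symmetric] by (simp add: word_eval_def)
    ultimately show ?case by blast
  next
    case (Cons y v)
    then have "word_eval perm_group \<xi> (y # v) z \<in> ?p (sg y) ` R" by simp
    then obtain u where u: "u \<in> R" "word_eval perm_group \<xi> (y # v) z = ?p (sg y) u"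
      by blast
    have "y \<noteq> inv_letter x" using Cons.prems by simp
    \<comment> \<open>Exponents are \<open>Suc i\<close> up to sign, so they are nonzero, and two of
      them cancel only for a letter and its inverse.\<close>
    then have "sg x + sg y \<noteq> 0"
      by (auto simp: sg_def inv_letter_def prod_eq_iff split: if_splits)
    then have "(if snd x then \<beta> else inv_into UNIV \<beta>) (?p (sg x + sg y) u) \<in> R"
      using pR[OF u(1)] \<beta> by (auto simp: image_subset_iff)
    moreover have "word_eval perm_group \<xi> (x # y # v) z
      = (if snd x then \<xi> (fst x) else inv\<^bsub>perm_group\<^esub> (\<xi> (fst x))) (word_eval perm_group \<xi> (y # v) z)"
      by (simp add: word_eval_def)
    then have "word_eval perm_group \<xi> (x # y # v) z
      = ?p (sg x) ((if snd x then \<beta> else inv_into UNIV \<beta>) (?p (sg x + sg y) u))"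
      unfolding letter u(2) padd .
    ultimately show ?case by blast
  qed
  obtain x v where xv: "w = x # v" using w by (cases w) auto
  then have "word_eval perm_group \<xi> w z \<in> ?p (sg x) ` R"
    using main w by simp
  then obtain u where u: "u \<in> R" "word_eval perm_group \<xi> w z = ?p (sg x) u"
    by blast
  have "?p (sg x) u \<in> P \<union> P'" by (rule pR[OF u(1)]) (simp add: sg_def)
  then have "word_eval perm_group \<xi> w z \<noteq> z" using u z R by auto
  then show ?thesis unfolding \<xi>_def[abs_def] by auto
qed

section \<open>Free actions of finite groups on countable sets\<close>

text \<open>Orbits of a finite group are finite, so a countably infinite set contains countably
  infinitely many. A transversal enumerated by the naturals identifies Y with copies of the left
  regular action.\<close>

lemma free_action_trivialization:
  fixes act :: "'c \<Rightarrow> 'x \<Rightarrow> 'x"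
  assumes H: "group H" "finite (carrier H)" and Y: "countable Y" "infinite Y"
    and closed: "\<And>c y. c \<in> carrier H \<Longrightarrow> y \<in> Y \<Longrightarrow> act c y \<in> Y"
    and one: "\<And>y. y \<in> Y \<Longrightarrow> act \<one>\<^bsub>H\<^esub> y = y"
    and mult: "\<And>c c' y. c \<in> carrier H \<Longrightarrow> c' \<in> carrier H \<Longrightarrow> y \<in> Y \<Longrightarrow>
                 act (c \<otimes>\<^bsub>H\<^esub> c') y = act c (act c' y)"
    and free: "\<And>c y. c \<in> carrier H \<Longrightarrow> y \<in> Y \<Longrightarrow> act c y = y \<Longrightarrow> c = \<one>\<^bsub>H\<^esub>"
  obtains \<eta> :: "'c \<times> nat \<Rightarrow> 'x" where "bij_betw \<eta> (carrier H \<times> UNIV) Y"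
    "\<And>c c' n. c \<in> carrier H \<Longrightarrow> c' \<in> carrier H \<Longrightarrow> \<eta> (c \<otimes>\<^bsub>H\<^esub> c', n) = act c (\<eta> (c', n))"
proof -
  interpret H: group H by fact
  define orb where "orb y = (\<lambda>c. act c y) ` carrier H" for y
  \<comment> \<open>The choice depends on y only through its orbit, so \<open>rep\<close> is
    constant on orbits.\<close>
  define rep where "rep y = (SOME z. z \<in> orb y)" for y
  have orb_self: "y \<in> orb y" if "y \<in> Y" for y
    using one[OF that] unfolding orb_def by force
  have orb_act: "orb (act c y) = orb y" if c: "c \<in> carrier H" and y: "y \<in> Y" for c y
  proof
    show "orb (act c y) \<subseteq> orb y"
    proof
      fix z assume "z \<in> orb (act c y)"
      then obtain d where d: "d \<in> carrier H" "z = act d (act c y)" by (auto simp: orb_def)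
      then have "z = act (d \<otimes>\<^bsub>H\<^esub> c) y"
        using c y by (simp add: mult)
      then show "z \<in> orb y" using c d by (auto simp: orb_def)
    qed
    show "orb y \<subseteq> orb (act c y)"
    proof
      fix z assume "z \<in> orb y"
      then obtain d where d: "d \<in> carrier H" "z = act d y" by (auto simp: orb_def)
      then have "z = act (d \<otimes>\<^bsub>H\<^esub> inv\<^bsub>H\<^esub> c) (act c y)"
        using c y by (simp flip: mult add: H.m_assoc)
      then show "z \<in> orb (act c y)" using c d by (auto simp: orb_def)
    qed
  qed
  have rep_orb: "rep y \<in> orb y" if "y \<in> Y" for y
    unfolding rep_def using orb_self[OF that] by (rule someI)
  have repY: "rep y \<in> Y" if "y \<in> Y" for y
    using rep_orb[OF that] closed[OF _ that] by (auto simp: orb_def)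
  have orb_rep: "orb (rep y) = orb y" if y: "y \<in> Y" for y
  proof -
    obtain c where "c \<in> carrier H" "rep y = act c y"
      using rep_orb[OF y] by (auto simp: orb_def)
    then show ?thesis using orb_act[OF _ y] by simp
  qed
  have rep_act: "rep (act c y) = rep y" if "c \<in> carrier H" "y \<in> Y" for c y
    unfolding rep_def orb_act[OF that] ..
  define T where "T = rep ` Y"
  have "Y \<subseteq> (\<Union>z\<in>T. orb z)"
    using orb_self orb_rep unfolding T_def by blast
  moreover have "finite (orb z)" for z using H by (simp add: orb_def)
  ultimately have "infinite T" using Y finite_subset by blast
  moreover have "countable T" using Y by (simp add: T_def)
  ultimately obtain g :: "nat \<Rightarrow> 'x" where g: "bij_betw g UNIV T"
    using countable_infiniteE' by blast
  have TY: "T \<subseteq> Y" using repY by (auto simp: T_def)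
  have gY: "g n \<in> Y" for n using g TY by (auto simp: bij_betw_def)
  have rep_g: "rep (g n) = g n" for n
  proof -
    obtain y where "y \<in> Y" "g n = rep y" using g by (auto simp: bij_betw_def T_def)
    then show ?thesis unfolding rep_def using orb_rep[of y] by (simp add: rep_def)
  qed
  define \<eta> where "\<eta> = (\<lambda>(c, n). act c (g n))"
  have "inj_on \<eta> (carrier H \<times> UNIV)"
  proof (rule inj_onI, clarsimp simp: \<eta>_def)
    fix c n c' n' assume c: "c \<in> carrier H" "c' \<in> carrier H" and eq: "act c (g n) = act c' (g n')"
    then have "g n = g n'" using rep_act[of _ "g n"] rep_act[of _ "g n'"] gY rep_g by metis
    then have n: "n = n'" using g by (auto simp: bij_betw_def inj_on_def)
    have "act (inv\<^bsub>H\<^esub> c' \<otimes>\<^bsub>H\<^esub> c) (g n) = act (inv\<^bsub>H\<^esub> c') (act c' (g n))"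
      using c eq gY n by (simp add: mult)
    also have "\<dots> = act (inv\<^bsub>H\<^esub> c' \<otimes>\<^bsub>H\<^esub> c') (g n)"
      using c gY mult[of "inv\<^bsub>H\<^esub> c'" c' "g n"] by simp
    also have "\<dots> = g n" using c gY one by simp
    finally have "inv\<^bsub>H\<^esub> c' \<otimes>\<^bsub>H\<^esub> c = \<one>\<^bsub>H\<^esub>" by (rule free[rotated 2]) (use gY c in auto)
    then have "c = c'" using c by (metis H.inv_closed H.inv_equality H.inv_inv)
    with n show "c = c' \<and> n = n'" by simp
  qed
  moreover have "\<eta> ` (carrier H \<times> UNIV) = Y"
  proof
    show "\<eta> ` (carrier H \<times> UNIV) \<subseteq> Y" using closed gY by (auto simp: \<eta>_def)
    show "Y \<subseteq> \<eta> ` (carrier H \<times> UNIV)"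
    proof
      fix y assume y: "y \<in> Y"
      then have "rep y \<in> T" by (simp add: T_def)
      then obtain n where n: "g n = rep y" using g by (auto simp: bij_betw_def)
      have "y \<in> orb (g n)" using y orb_rep orb_self n by simp
      then show "y \<in> \<eta> ` (carrier H \<times> UNIV)" unfolding orb_def \<eta>_def by force
    qed
  qed
  ultimately have "bij_betw \<eta> (carrier H \<times> UNIV) Y" by (simp add: bij_betw_def)
  moreover have "\<eta> (c \<otimes>\<^bsub>H\<^esub> c', n) = act c (\<eta> (c', n))" if "c \<in> carrier H" "c' \<in> carrier H" for c c' n
    using that gY mult by (simp add: \<eta>_def)
  ultimately show ?thesis using that by blast
qed

text \<open>Both sets become the group times the naturals after trivialization, and there
  \<open>\<phi>\<close> times the identity is equivariant.\<close>

lemma free_equivariant_bij: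
  fixes act :: "'c \<Rightarrow> 'x \<Rightarrow> 'x" and act' :: "'d \<Rightarrow> 'y \<Rightarrow> 'y"
  assumes H: "group H" "finite (carrier H)" and \<phi>: "\<phi> \<in> iso H H'" and H': "group H'"
    and Y: "countable Y" "infinite Y" and Z: "countable Z" "infinite Z"
    and act: "\<And>c y. c \<in> carrier H \<Longrightarrow> y \<in> Y \<Longrightarrow> act c y \<in> Y"
      "\<And>y. y \<in> Y \<Longrightarrow> act \<one>\<^bsub>H\<^esub> y = y"
      "\<And>c c' y. c \<in> carrier H \<Longrightarrow> c' \<in> carrier H \<Longrightarrow> y \<in> Y \<Longrightarrow>
                 act (c \<otimes>\<^bsub>H\<^esub> c') y = act c (act c' y)"
      "\<And>c y. c \<in> carrier H \<Longrightarrow> y \<in> Y \<Longrightarrow> act c y = y \<Longrightarrow> c = \<one>\<^bsub>H\<^esub>"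
    and act': "\<And>c y. c \<in> carrier H' \<Longrightarrow> y \<in> Z \<Longrightarrow> act' c y \<in> Z"
      "\<And>y. y \<in> Z \<Longrightarrow> act' \<one>\<^bsub>H'\<^esub> y = y"
      "\<And>c c' y. c \<in> carrier H' \<Longrightarrow> c' \<in> carrier H' \<Longrightarrow> y \<in> Z \<Longrightarrow>
                 act' (c \<otimes>\<^bsub>H'\<^esub> c') y = act' c (act' c' y)"
      "\<And>c y. c \<in> carrier H' \<Longrightarrow> y \<in> Z \<Longrightarrow> act' c y = y \<Longrightarrow> c = \<one>\<^bsub>H'\<^esub>"
  obtains \<tau> where "bij_betw \<tau> Y Z"
    "\<And>c y. c \<in> carrier H \<Longrightarrow> y \<in> Y \<Longrightarrow> \<tau> (act c y) = act' (\<phi> c) (\<tau> y)"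
proof -
  interpret H: group H by fact
  have \<phi>b: "bij_betw \<phi> (carrier H) (carrier H')" and \<phi>m: "\<phi> \<in> hom H H'"
    using \<phi> by (auto simp: iso_def)
  have "finite (carrier H')" using \<phi>b H bij_betw_finite by blast
  obtain \<eta> where \<eta>: "bij_betw \<eta> (carrier H \<times> (UNIV :: nat set)) Y"
    "\<And>c c' n. c \<in> carrier H \<Longrightarrow> c' \<in> carrier H \<Longrightarrow> \<eta> (c \<otimes>\<^bsub>H\<^esub> c', n) = act c (\<eta> (c', n))"
    by (rule free_action_trivialization[of H Y act, OF H Y]) (use act in blast)+
  obtain \<eta>' where \<eta>': "bij_betw \<eta>' (carrier H' \<times> (UNIV :: nat set)) Z"
    "\<And>c c' n. c \<in> carrier H' \<Longrightarrow> c' \<in> carrier H' \<Longrightarrow> \<eta>' (c \<otimes>\<^bsub>H'\<^esub> c', n) = act' c (\<eta>' (c', n))"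
    by (rule free_action_trivialization[of H' Z act', OF H' \<open>finite (carrier H')\<close> Z]) (use act' in blast)+
  define \<tau> where "\<tau> = \<eta>' \<circ> map_prod \<phi> id \<circ> inv_into (carrier H \<times> UNIV) \<eta>"
  have "bij_betw (map_prod \<phi> id) (carrier H \<times> (UNIV :: nat set)) (carrier H' \<times> UNIV)"
    using bij_betw_map_prod[OF \<phi>b bij_id] .
  then have "bij_betw \<tau> Y Z"
    unfolding \<tau>_def using \<eta> \<eta>' by (intro bij_betw_trans[OF bij_betw_inv_into] bij_betw_trans) auto
  moreover have "\<tau> (act c y) = act' (\<phi> c) (\<tau> y)" if c: "c \<in> carrier H" and y: "y \<in> Y" for c y
  proof -
    obtain d n where d: "d \<in> carrier H" "y = \<eta> (d, n)"
      using y \<eta>(1) by (auto simp: bij_betw_def)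
    have "act c y = \<eta> (c \<otimes>\<^bsub>H\<^esub> d, n)" using d c \<eta>(2) by simp
    moreover have "inv_into (carrier H \<times> UNIV) \<eta> (\<eta> (e, n)) = (e, n)" if "e \<in> carrier H" for e
      using that \<eta>(1) by (intro inv_into_f_f) (auto simp: bij_betw_def)
    ultimately have "\<tau> (act c y) = \<eta>' (\<phi> (c \<otimes>\<^bsub>H\<^esub> d), n)" "\<tau> y = \<eta>' (\<phi> d, n)"
      using c d by (auto simp: \<tau>_def)
    then show ?thesis
      using \<eta>'(2)[of "\<phi> c" "\<phi> d" n] hom_mult[OF \<phi>m c d(1)] hom_in_carrier[OF \<phi>m] c d by simp
  qed
  ultimately show ?thesis using that by blast
qed

text \<open>The identity off \<open>A\<close>, so that it permutes the whole type.\<close>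

definition left_mult :: "('a, 'b) monoid_scheme \<Rightarrow> 'a set \<Rightarrow> 'a \<Rightarrow> 'a \<times> 'v \<Rightarrow> 'a \<times> 'v" where
  "left_mult G A a z = (if fst z \<in> A then (a \<otimes>\<^bsub>G\<^esub> fst z, snd z) else z)"

context group
begin

lemma left_mult_mult:
  assumes "subgroup A G" "a \<in> A" "a' \<in> A"
  shows "left_mult G A (a \<otimes> a') z = left_mult G A a (left_mult G A a' z)"
  using assms subgroup.mem_carrier[OF assms(1)]
  by (auto simp: left_mult_def m_assoc subgroup.m_closed)

lemma left_mult_one: "subgroup A G \<Longrightarrow> left_mult G A \<one> z = z"
  by (auto simp: left_mult_def subgroup.mem_carrier)

lemma left_mult_inv:
  assumes A: "subgroup A G" and a: "a \<in> A"
  shows "left_mult G A a \<circ> left_mult G A (inv a) = id" "left_mult G A (inv a) \<circ> left_mult G A a = id"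
  using A a left_mult_one[OF A] subgroup.mem_carrier[OF A] subgroup.m_inv_closed[OF A]
  by (auto simp: fun_eq_iff simp flip: left_mult_mult)

lemma left_mult_hom:
  assumes A: "subgroup A G"
  shows "left_mult G A \<in> hom (G\<lparr>carrier := A\<rparr>) perm_group"
proof (rule homI)
  fix a a' assume a: "a \<in> carrier (G\<lparr>carrier := A\<rparr>)" "a' \<in> carrier (G\<lparr>carrier := A\<rparr>)"
  show "left_mult G A a \<in> carrier perm_group"
    using o_bij[OF left_mult_inv(2,1)[OF A]] a by simp
  show "left_mult G A (a \<otimes>\<^bsub>G\<lparr>carrier := A\<rparr>\<^esub> a') = left_mult G A a \<otimes>\<^bsub>perm_group\<^esub> left_mult G A a'"
    using a left_mult_mult[OF A] by (auto simp: fun_eq_iff)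
qed

text \<open>
  A permutation model of the HNN extension of \<open>A\<close> with stable letter conjugating \<open>C\<close> to \<open>D\<close>.
  On countably many free orbits of \<open>A\<close> of each of two kinds, let \<open>P\<close> be the union of the copies of
  \<open>D\<close> in the orbits of the first kind and \<open>P'\<close> that of the copies of \<open>C\<close> in the orbits of the
  second kind. The stable letter maps the complement of \<open>P'\<close> onto \<open>P\<close>, and \<open>P'\<close> onto the
  complement of \<open>P\<close>: all four sets consist of countably infinitely many free orbits.
\<close>

lemma hnn_permutation_model:
  assumes A: "subgroup A G" "finite A" and C: "subgroup C G" "C \<subseteq> A" and D: "subgroup D G" "D \<subseteq> A"
    and \<phi>: "\<phi> \<in> iso (G\<lparr>carrier := C\<rparr>) (G\<lparr>carrier := D\<rparr>)"
    and b: "b \<in> A" "b \<notin> C" "b \<notin> D"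
  obtains \<alpha> :: "'a \<Rightarrow> 'a \<times> nat \<times> bool \<Rightarrow> 'a \<times> nat \<times> bool" and \<tau>
  where "\<alpha> \<in> hom (G\<lparr>carrier := A\<rparr>) perm_group" "\<tau> \<in> carrier perm_group"
    "\<And>c. c \<in> C \<Longrightarrow> \<tau> \<otimes>\<^bsub>perm_group\<^esub> \<alpha> c = \<alpha> (\<phi> c) \<otimes>\<^bsub>perm_group\<^esub> \<tau>"
    "\<And>w. reduced w \<Longrightarrow> w \<noteq> [] \<Longrightarrow> word_eval perm_group (\<lambda>i. \<tau> [^]\<^bsub>perm_group\<^esub> Suc i
       \<otimes>\<^bsub>perm_group\<^esub> \<alpha> b \<otimes>\<^bsub>perm_group\<^esub> \<tau> [^]\<^bsub>perm_group\<^esub> Suc i) w \<noteq> \<one>\<^bsub>perm_group\<^esub>"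
proof -
  let ?m = "left_mult G A :: 'a \<Rightarrow> 'a \<times> nat \<times> bool \<Rightarrow> _"
  define X P P' where "X = A \<times> (UNIV :: (nat \<times> bool) set)"
    and "P = D \<times> (UNIV :: nat set) \<times> {True}" and "P' = C \<times> (UNIV :: nat set) \<times> {False}"
  note XP = X_def P_def P'_def
  have carr: "A \<subseteq> carrier G" using A subgroup.subset by blast
  have inf: "infinite ({a} \<times> (UNIV :: nat set) \<times> {v :: bool})" for a :: 'a and v
    by (simp add: finite_cartesian_product_iff)
  have one: "\<one> \<in> A" "\<one> \<in> C" "\<one> \<in> D" using A C D by (auto intro: subgroup.one_closed)
  have cnt: "countable X" using A by (auto simp: X_def countable_finite)
  have sub: "P \<subseteq> X" "P' \<subseteq> X" "P \<inter> P' = {}" using C D by (auto simp: XP)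
  have mX: "?m a z \<in> X" if "a \<in> A" "z \<in> X" for a z
    using that A by (auto simp: XP left_mult_def subgroup.m_closed)
  have free: "a = \<one>" if "a \<in> A" "z \<in> X" "?m a z = z" for a z
  proof -
    have "fst z \<in> carrier G" "a \<otimes> fst z = fst z" "a \<in> carrier G"
      using that carr by (auto simp: X_def left_mult_def)
    then show ?thesis using r_cancel_one by metis
  qed
  have mP: "?m d z \<in> P \<longleftrightarrow> z \<in> P" if "d \<in> D" "z \<in> X" for d z
  proof -
    have "?m d z \<in> P" if "d \<in> D" "z \<in> P" for d z
      using that D by (auto simp: XP left_mult_def subgroup.m_closed)
    from this[of d z] this[of "inv d" "?m d z"] show ?thesis
      using that D subgroup.m_inv_closed[OF D(1)] carr left_mult_one[OF A(1), of z]
      by (metis left_mult_mult[OF A(1)] l_inv subsetD)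
  qed
  have mP': "?m d z \<in> P' \<longleftrightarrow> z \<in> P'" if "d \<in> C" "z \<in> X" for d z
  proof -
    have "?m d z \<in> P'" if "d \<in> C" "z \<in> P'" for d z
      using that C by (auto simp: XP left_mult_def subgroup.m_closed)
    from this[of d z] this[of "inv d" "?m d z"] show ?thesis
      using that C subgroup.m_inv_closed[OF C(1)] carr left_mult_one[OF A(1), of z]
      by (metis left_mult_mult[OF A(1)] l_inv subsetD)
  qed
  have gC: "group (G\<lparr>carrier := C\<rparr>)" and gD: "group (G\<lparr>carrier := D\<rparr>)"
    using C D by (auto intro: subgroup_imp_group)
  have fC: "finite (carrier (G\<lparr>carrier := C\<rparr>))" using A C finite_subset by auto
  \<comment> \<open>P and P' each meet orbits of one kind only, so each complement contains all
    orbits of the other kind and is infinite as well.\<close>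
  have "{\<one>} \<times> UNIV \<times> {True} \<subseteq> P" "{\<one>} \<times> UNIV \<times> {False} \<subseteq> P'"
    "{\<one>} \<times> UNIV \<times> {False} \<subseteq> X - P" "{\<one>} \<times> UNIV \<times> {True} \<subseteq> X - P'"
    using one by (auto simp: XP)
  note infs = this[THEN infinite_super, OF inf]
  have "countable P" "countable P'" "countable (X - P)" "countable (X - P')"
    using cnt sub by (auto intro: countable_subset)
  note cnts = this
  have mult: "?m (a \<otimes> a') z = ?m a (?m a' z)" if "a \<in> A" "a' \<in> A" for a a' z
    by (rule left_mult_mult[OF A(1) that])
  obtain \<tau>1 where \<tau>1: "bij_betw \<tau>1 (X - P') P"
    "\<And>c y. c \<in> C \<Longrightarrow> y \<in> X - P' \<Longrightarrow> \<tau>1 (?m c y) = ?m (\<phi> c) (\<tau>1 y)"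
  proof (rule free_equivariant_bij[OF gC fC \<phi> gD cnts(4) infs(4) cnts(1) infs(1), of ?m ?m])
    show "?m c y \<in> X - P'" if "c \<in> carrier (G\<lparr>carrier := C\<rparr>)" "y \<in> X - P'" for c y
      using that C(2) sub mX[of c y] mP'[of c y] by auto
    show "?m \<one>\<^bsub>G\<lparr>carrier := C\<rparr>\<^esub> y = y" for y
      using left_mult_one[OF A(1)] by simp
    show "?m (c \<otimes>\<^bsub>G\<lparr>carrier := C\<rparr>\<^esub> c') y = ?m c (?m c' y)"
      if "c \<in> carrier (G\<lparr>carrier := C\<rparr>)" "c' \<in> carrier (G\<lparr>carrier := C\<rparr>)" for c c' y
      using that C(2) by (simp add: mult subset_iff)
    show "c = \<one>\<^bsub>G\<lparr>carrier := C\<rparr>\<^esub>"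
      if "c \<in> carrier (G\<lparr>carrier := C\<rparr>)" "y \<in> X - P'" "?m c y = y" for c y
      using that free[of c y] C(2) sub by auto
    show "?m c y \<in> P" if "c \<in> carrier (G\<lparr>carrier := D\<rparr>)" "y \<in> P" for c y
      using that D(2) sub mX[of c y] mP[of c y] by auto
    show "?m \<one>\<^bsub>G\<lparr>carrier := D\<rparr>\<^esub> y = y" for y
      using left_mult_one[OF A(1)] by simp
    show "?m (c \<otimes>\<^bsub>G\<lparr>carrier := D\<rparr>\<^esub> c') y = ?m c (?m c' y)"
      if "c \<in> carrier (G\<lparr>carrier := D\<rparr>)" "c' \<in> carrier (G\<lparr>carrier := D\<rparr>)" for c c' y
      using that D(2) by (simp add: mult subset_iff)
    show "c = \<one>\<^bsub>G\<lparr>carrier := D\<rparr>\<^esub>"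
      if "c \<in> carrier (G\<lparr>carrier := D\<rparr>)" "y \<in> P" "?m c y = y" for c y
      using that free[of c y] D(2) sub by auto
  qed auto
  obtain \<tau>2 where \<tau>2: "bij_betw \<tau>2 P' (X - P)"
    "\<And>c y. c \<in> C \<Longrightarrow> y \<in> P' \<Longrightarrow> \<tau>2 (?m c y) = ?m (\<phi> c) (\<tau>2 y)"
  proof (rule free_equivariant_bij[OF gC fC \<phi> gD cnts(2) infs(2) cnts(3) infs(3), of ?m ?m])
    show "?m c y \<in> P'" if "c \<in> carrier (G\<lparr>carrier := C\<rparr>)" "y \<in> P'" for c y
      using that C(2) sub mX[of c y] mP'[of c y] by auto
    show "?m \<one>\<^bsub>G\<lparr>carrier := C\<rparr>\<^esub> y = y" for y
      using left_mult_one[OF A(1)] by simp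
    show "?m (c \<otimes>\<^bsub>G\<lparr>carrier := C\<rparr>\<^esub> c') y = ?m c (?m c' y)"
      if "c \<in> carrier (G\<lparr>carrier := C\<rparr>)" "c' \<in> carrier (G\<lparr>carrier := C\<rparr>)" for c c' y
      using that C(2) by (simp add: mult subset_iff)
    show "c = \<one>\<^bsub>G\<lparr>carrier := C\<rparr>\<^esub>"
      if "c \<in> carrier (G\<lparr>carrier := C\<rparr>)" "y \<in> P'" "?m c y = y" for c y
      using that free[of c y] C(2) sub by auto
    show "?m c y \<in> X - P" if "c \<in> carrier (G\<lparr>carrier := D\<rparr>)" "y \<in> X - P" for c y
      using that D(2) sub mX[of c y] mP[of c y] by auto
    show "?m \<one>\<^bsub>G\<lparr>carrier := D\<rparr>\<^esub> y = y" for y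
      using left_mult_one[OF A(1)] by simp
    show "?m (c \<otimes>\<^bsub>G\<lparr>carrier := D\<rparr>\<^esub> c') y = ?m c (?m c' y)"
      if "c \<in> carrier (G\<lparr>carrier := D\<rparr>)" "c' \<in> carrier (G\<lparr>carrier := D\<rparr>)" for c c' y
      using that D(2) by (simp add: mult subset_iff)
    show "c = \<one>\<^bsub>G\<lparr>carrier := D\<rparr>\<^esub>"
      if "c \<in> carrier (G\<lparr>carrier := D\<rparr>)" "y \<in> X - P" "?m c y = y" for c y
      using that free[of c y] D(2) sub by auto
  qed auto
  \<comment> \<open>The identity off X makes \<open>\<tau>\<close> a permutation of the whole type;
    it commutes there with \<open>left_mult\<close>, which is trivial off X.\<close>
  define \<tau> where "\<tau> z = (if z \<in> P' then \<tau>2 z else if z \<in> X then \<tau>1 z else z)" for z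
  have "bij_betw \<tau> P' (X - P)" "bij_betw \<tau> (X - P') P" "bij_betw \<tau> (- X) (- X)"
    using \<tau>1(1) \<tau>2(1) sub by (auto simp: \<tau>_def bij_betw_def inj_on_def image_def) 
  then have "bij_betw \<tau> (P' \<union> (X - P') \<union> - X) ((X - P) \<union> P \<union> - X)"
    using sub by (intro bij_betw_combine) auto
  then have bij: "bij \<tau>"
    using sub by (metis Compl_partition Un_Diff_cancel Un_Diff_cancel2 sup.absorb1 sup.absorb2)
  let ?R = "X - P - P'"
  have im: "\<tau> ` (?R \<union> P) \<subseteq> P" "\<tau> ` P' = X - P"
  proof -
    \<comment> \<open>This uses that P and P' are disjoint, which is what the two kinds of orbits
      ensure.\<close>
    have "?R \<union> P = X - P'" using sub by auto
    then show "\<tau> ` (?R \<union> P) \<subseteq> P" "\<tau> ` P' = X - P"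
      using \<open>bij_betw \<tau> (X - P') P\<close> \<open>bij_betw \<tau> P' (X - P)\<close> by (simp_all add: bij_betw_def)
  qed
  then have im': "inv_into UNIV \<tau> ` (?R \<union> P') \<subseteq> P'"
  proof -
    have "?R \<union> P' = X - P" using sub by auto
    then have "?R \<union> P' = \<tau> ` P'" using im by simp
    then show ?thesis using bij by (simp add: image_comp bij_is_inj)
  qed
  \<comment> \<open>Left multiplication preserves the kind of an orbit, so only the first coordinate
    matters: an element outside a subgroup translates that subgroup off itself.\<close>
  have bR: "?m a ` (P \<union> P') \<subseteq> ?R" if a: "a \<in> A" "a \<notin> C" "a \<notin> D" for a
  proof -
    have "a \<otimes> d \<notin> H" if "subgroup H G" "a \<notin> H" "d \<in> H" for d H
      using that a carr subgroup.m_closed[OF that(1) _ subgroup.m_inv_closed[OF that(1,3)], of "a \<otimes> d"]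
        subgroup.mem_carrier[OF that(1,3)]
      by (auto simp: m_assoc)
    from this[OF C(1) a(2)] this[OF D(1) a(3)] show ?thesis
      using a C(2) D(2) A(1) by (auto simp: XP left_mult_def subgroup.m_closed)
  qed
  show ?thesis
  proof (rule that[of ?m \<tau>])
    show "?m \<in> hom (G\<lparr>carrier := A\<rparr>) perm_group" by (rule left_mult_hom[OF A(1)])
    show "\<tau> \<in> carrier perm_group" using bij by simp
    show "\<tau> \<otimes>\<^bsub>perm_group\<^esub> ?m c = ?m (\<phi> c) \<otimes>\<^bsub>perm_group\<^esub> \<tau>" if c: "c \<in> C" for c
    proof -
      have "\<phi> c \<in> D" using \<phi> c by (auto simp: iso_def hom_def)
      have "\<tau> (?m c z) = ?m (\<phi> c) (\<tau> z)" for z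
      proof (cases "z \<in> X")
        case True
        then have "?m c z \<in> X" "?m c z \<in> P' \<longleftrightarrow> z \<in> P'"
          using c C mX[of c z] mP'[of c z] by auto
        then show ?thesis
          using True \<tau>1(2)[OF c] \<tau>2(2)[OF c] by (auto simp: \<tau>_def)
      next
        case False
        then have "fst z \<notin> A" by (cases z) (auto simp: X_def)
        then show ?thesis using False sub by (auto simp: \<tau>_def left_mult_def)
      qed
      then show ?thesis by (auto simp: fun_eq_iff)
    qed
    fix w :: "nat word" assume w: "reduced w" "w \<noteq> []"
    have m: "bij (?m b)" and mi: "inv_into UNIV (?m b) = ?m (inv b)"
      using o_bij[OF left_mult_inv(2,1)[OF A(1) b(1)]] inv_unique_comp[OF left_mult_inv(1,2)[OF A(1) b(1)]]
      by auto
    show "word_eval perm_group (\<lambda>i. \<tau> [^]\<^bsub>perm_group\<^esub> Suc i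
       \<otimes>\<^bsub>perm_group\<^esub> ?m b \<otimes>\<^bsub>perm_group\<^esub> \<tau> [^]\<^bsub>perm_group\<^esub> Suc i) w \<noteq> \<one>\<^bsub>perm_group\<^esub>"
    proof (rule ping_pong[where R = ?R and P = P and P' = P', OF bij m im(1) im' _ _ _ _ w])
      show "?m b ` (P \<union> P') \<subseteq> ?R" by (rule bR[OF b])
      have "inv b \<in> A" "inv b \<notin> C" "inv b \<notin> D"
        using A C D b carr by (metis inv_inv subgroup.m_inv_closed subsetD)+
      then show "inv_into UNIV (?m b) ` (P \<union> P') \<subseteq> ?R"
        unfolding mi by (rule bR)
      have "(b, 0, True) \<in> ?R" using b by (auto simp: XP)
      then show "?R \<noteq> {}" by blast
    qed auto
  qed
qed

end

section \<open>Words, normal closures and windows\<close>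

lemma word_eval_Nil [simp]: "word_eval G f [] = \<one>\<^bsub>G\<^esub>"
  by (simp add: word_eval_def)

lemma word_eval_Cons:
  "word_eval G f (x # w) =
     (if snd x then f (fst x) else inv\<^bsub>G\<^esub> f (fst x)) \<otimes>\<^bsub>G\<^esub> word_eval G f w"
  by (simp add: word_eval_def)

lemma (in group_hom) hom_word_eval:
  assumes f: "f \<in> S \<rightarrow> carrier G" and "set w \<subseteq> S \<times> UNIV"
  shows "h (word_eval G f w) = word_eval H (h \<circ> f) w"
  using assms(2)
proof (induction w)
  case (Cons x w)
  then have "word_eval G f w \<in> carrier G" "f (fst x) \<in> carrier G"
    using G.word_eval_closed[OF f] f by auto
  then show ?case using Cons by (auto simp: word_eval_Cons)
qed auto

lemma free_group_carrier: "w \<in> carrier (free_group S) \<longleftrightarrow> set w \<subseteq> S \<times> UNIV \<and> reduced w"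
  by (simp add: free_group_def)

lemma free_group_one [simp]: "\<one>\<^bsub>free_group S\<^esub> = []"
  by (simp add: free_group_def)

lemma length_mult_free_group:
  assumes "v \<in> carrier (free_group S)"
  shows "length (u \<otimes>\<^bsub>free_group S\<^esub> v) \<le> length u + length v"
  using assms length_foldr_push[of u v] by (auto simp: free_group_def reduce_append)

lemma inv_free_group:
  assumes "u \<in> carrier (free_group S)"
  shows "inv\<^bsub>free_group S\<^esub> u = reduce (inv_word u)"
proof -
  interpret F: group "free_group S" by (rule group_free_group)
  let ?v = "reduce (inv_word u)"
  have ru: "reduced u" using assms by (simp add: free_group_carrier)
  have "set ?v \<subseteq> S \<times> UNIV"
    using set_foldr_push[of "inv_word u" "[]"] assms
    by (fastforce simp: reduce_def inv_word_def inv_letter_def free_group_carrier)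
  then have "?v \<in> carrier (free_group S)"
    by (simp add: free_group_carrier reduce_def reduced_foldr_push)
  moreover have "foldr push ?v u = []"
    using foldr_push_inv_word[of "[]" u] foldr_push_assoc[OF ru, of "inv_word u" "[]"]
      reduce_reduced[OF ru] by (simp add: reduce_def)
  then have "?v \<otimes>\<^bsub>free_group S\<^esub> u = \<one>\<^bsub>free_group S\<^esub>"
    using ru by (simp add: free_group_def reduce_append)
  ultimately show ?thesis using F.inv_equality assms by blast
qed

lemma length_inv_free_group:
  assumes "u \<in> carrier (free_group S)"
  shows "length (inv\<^bsub>free_group S\<^esub> u) \<le> length u"
  using length_foldr_push[of "inv_word u" "[]"]
  by (simp add: inv_free_group[OF assms] reduce_def inv_word_def)

lemma length_pow_free_group:
  assumes "u \<in> carrier (free_group S)"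
  shows "length (u [^]\<^bsub>free_group S\<^esub> (n::nat)) \<le> n * length u"
proof -
  interpret F: group "free_group S" by (rule group_free_group)
  show ?thesis
  proof (induction n)
    case (Suc n)
    then show ?case
      using length_mult_free_group[OF assms, of "u [^]\<^bsub>free_group S\<^esub> n"] by simp
  qed simp
qed

lemma length_word_eval_free_group:
  assumes "f \<in> I \<rightarrow> carrier (free_group S)" "set w \<subseteq> I \<times> UNIV" "\<And>i. i \<in> I \<Longrightarrow> length (f i) \<le> L"
  shows "length (word_eval (free_group S) f w) \<le> length w * L"
  using assms(2)
proof (induction w)
  case (Cons x w)
  interpret F: group "free_group S" by (rule group_free_group)
  have "f (fst x) \<in> carrier (free_group S)" "length (f (fst x)) \<le> L"
    using assms Cons.prems by auto
  then have "length (if snd x then f (fst x) else inv\<^bsub>free_group S\<^esub> f (fst x)) \<le> L"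
    using length_inv_free_group[of "f (fst x)" S] by auto
  moreover have "word_eval (free_group S) f w \<in> carrier (free_group S)"
    using Cons.prems by (intro F.word_eval_closed[OF assms(1)]) auto
  note length_mult_free_group[OF this]
  ultimately have "length (word_eval (free_group S) f (x # w)) \<le> L + length (word_eval (free_group S) f w)"
    unfolding word_eval_Cons by (meson add_mono order.refl order.trans)
  then show ?case using Cons by simp
qed simp

lemma (in group) normal_Inter:
  assumes "\<T> \<noteq> {}" "\<And>K. K \<in> \<T> \<Longrightarrow> K \<lhd> G"
  shows "\<Inter>\<T> \<lhd> G"
proof (rule normal_invI)
  show "subgroup (\<Inter>\<T>) G"
    using assms by (intro subgroups_Inter) (auto dest: normal_imp_subgroup)
  fix x h assume "x \<in> carrier G" "h \<in> \<Inter>\<T>"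
  then show "x \<otimes> h \<otimes> inv x \<in> \<Inter>\<T>"
    using assms by (auto simp: normal_inv_iff)
qed

text \<open>The hull is an intersection over all normal subgroups containing X; the family is
  nonempty because it contains the whole group.\<close>

lemma (in group) normal_hull:
  assumes "X \<subseteq> carrier G"
  shows "((\<lambda>K. K \<lhd> G) hull X) \<lhd> G"
  unfolding hull_def
proof (rule normal_Inter)
  have "carrier G \<lhd> G"
    by (rule normal_invI) (auto intro: subgroup_self)
  then show "{t. t \<lhd> G \<and> X \<subseteq> t} \<noteq> {}" using assms by blast
qed simp

context group
begin

lemma group_hom_word_eval:
  assumes "f \<in> S \<rightarrow> carrier G"
  shows "group_hom (free_group S) G (word_eval G f)"
  by (rule group_hom.intro[OF group_free_group group_axioms])
    (simp add: group_hom_axioms_def word_eval_hom[OF assms])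

lemma relation_subgroup_subset: "relation_subgroup G S \<subseteq> carrier (free_group S)"
  by (auto simp: relation_subgroup_def kernel_def)

lemma relation_subgroup_iff:
  "w \<in> relation_subgroup G S \<longleftrightarrow>
     w \<in> carrier (free_group S) \<and> word_eval G (\<lambda>s. s) w = \<one>"
  by (auto simp: relation_subgroup_def kernel_def)

lemma relation_subgroup_upto_normal: "relation_subgroup_upto G S n \<lhd> free_group S"
  unfolding relation_subgroup_upto_def
  using relation_subgroup_subset by (intro group.normal_hull group_free_group) auto

lemma relation_subgroup_uptoI:
  "w \<in> relation_subgroup G S \<Longrightarrow> int (length w) \<le> n \<Longrightarrow> w \<in> relation_subgroup_upto G S n"
  unfolding relation_subgroup_upto_def by (rule hull_inc) simp

lemma relation_subgroup_upto_mono: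
  "m \<le> n \<Longrightarrow> relation_subgroup_upto G S m \<subseteq> relation_subgroup_upto G S n"
  unfolding relation_subgroup_upto_def by (rule hull_mono) auto

lemma relation_subgroup_upto_least:
  assumes "K \<lhd> free_group S"
    "\<And>w. w \<in> relation_subgroup G S \<Longrightarrow> int (length w) \<le> n \<Longrightarrow> w \<in> K"
  shows "relation_subgroup_upto G S n \<subseteq> K"
  unfolding relation_subgroup_upto_def using assms by (intro hull_minimal) auto

section \<open>Conjugation by powers of the stable letter, and windows\<close>

definition conj_pow :: "'a \<Rightarrow> int \<Rightarrow> 'a \<Rightarrow> 'a" where
  "conj_pow t e x = t [^] e \<otimes> x \<otimes> t [^] (- e)"

context
  fixes t assumes t [simp]: "t \<in> carrier G"
begin

lemma conj_pow_closed [simp]: "x \<in> carrier G \<Longrightarrow> conj_pow t e x \<in> carrier G"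
  by (simp add: conj_pow_def)

lemma conj_pow_0 [simp]: "x \<in> carrier G \<Longrightarrow> conj_pow t 0 x = x"
  by (simp add: conj_pow_def)

lemma conj_pow_mult_pow:
  assumes "x \<in> carrier G"
  shows "conj_pow t e x \<otimes> t [^] e = t [^] e \<otimes> x"
  using assms by (simp add: conj_pow_def m_assoc int_pow_mult[symmetric])

lemma conj_pow_conj_pow:
  assumes "x \<in> carrier G"
  shows "conj_pow t e (conj_pow t e' x) = conj_pow t (e + e') x"
proof -
  have "t [^] (- (e + e')) = t [^] (- e') \<otimes> t [^] (- e)"
    using int_pow_mult[OF t, of "- e'" "- e"] by (simp only: minus_add_distrib add.commute)
  then show ?thesis
    using assms unfolding conj_pow_def by (simp add: m_assoc int_pow_mult)
qed

lemma conj_pow_hom: "conj_pow t e \<in> hom G G"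
proof (rule homI)
  fix x y assume x: "x \<in> carrier G" and y: "y \<in> carrier G"
  have "t [^] (- e) \<otimes> (t [^] e \<otimes> z) = z" if "z \<in> carrier G" for z
    using that by (simp add: m_assoc[symmetric] int_pow_mult[symmetric])
  then show "conj_pow t e (x \<otimes> y) = conj_pow t e x \<otimes> conj_pow t e y"
    using x y by (simp add: conj_pow_def m_assoc)
qed simp

lemma conj_pow_inj: "inj_on (conj_pow t e) (carrier G)"
  by (rule inj_on_inverseI[where g = "conj_pow t (- e)"]) (simp add: conj_pow_conj_pow)

definition window :: "'a set \<Rightarrow> int \<Rightarrow> int \<Rightarrow> 'a set" where
  "window F l u = generate G (\<Union>i\<in>{l..u}. conj_pow t i ` F)"

context
  fixes F assumes F: "F \<subseteq> carrier G"
begin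

lemma window_gens: "(\<Union>i\<in>{l..u}. conj_pow t i ` F) \<subseteq> carrier G"
  using F by auto

lemma window_subgroup: "subgroup (window F l u) G"
  unfolding window_def by (rule generate_is_subgroup[OF window_gens])

lemma window_mono: "l' \<le> l \<Longrightarrow> u \<le> u' \<Longrightarrow> window F l u \<subseteq> window F l' u'"
  unfolding window_def by (intro mono_generate UN_mono) auto

lemma window_incl: "f \<in> F \<Longrightarrow> l \<le> i \<Longrightarrow> i \<le> u \<Longrightarrow> conj_pow t i f \<in> window F l u"
  unfolding window_def by (rule generate.incl) auto

lemma window_conj_pow: "conj_pow t e ` window F l u = window F (l + e) (u + e)"
proof -
  interpret h: group_hom G G "conj_pow t e"
    using conj_pow_hom by unfold_locales
  have "conj_pow t e ` (\<Union>i\<in>{l..u}. conj_pow t i ` F) = (\<Union>i\<in>{l..u}. conj_pow t (i + e) ` F)"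
    using F by (auto simp: image_UN image_image conj_pow_conj_pow add.commute subset_iff)
  also have "\<dots> = (\<Union>i\<in>(\<lambda>i. i + e) ` {l..u}. conj_pow t i ` F)" by (simp only: image_image)
  also have "(\<lambda>i. i + e) ` {l..u} = {l + e..u + e}" by simp
  finally show ?thesis
    unfolding window_def using h.generate_img[OF window_gens] by metis
qed

lemma window_conj_powI:
  "a \<in> window F l u \<Longrightarrow> l' \<le> l + e \<Longrightarrow> u + e \<le> u' \<Longrightarrow> conj_pow t e a \<in> window F l' u'"
  using window_mono[of l' "l + e" "u + e" u'] by (auto simp flip: window_conj_pow)

text \<open>The hypothesis \<open>rel\<close> covers a single conjugation and only the window ending
  at u' - 1. It can be iterated as long as the shifted windows stay within l' and u', which the four
  inequalities guarantee. Negative exponents reduce to positive ones by starting from the conjugated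
  element.\<close>

lemma window_conj_local_hom:
  assumes K: "group K" and \<tau>: "\<tau> \<in> carrier K"
    and \<alpha>: "\<alpha> \<in> hom (G\<lparr>carrier := window F l' u'\<rparr>) K"
    and rel: "\<And>c. c \<in> window F l' (u' - 1) \<Longrightarrow>
      \<tau> \<otimes>\<^bsub>K\<^esub> \<alpha> c = \<alpha> (conj_pow t 1 c) \<otimes>\<^bsub>K\<^esub> \<tau>"
    and a: "a \<in> window F l u" "l' \<le> l" "l' \<le> l + e" "u \<le> u'" "u + e \<le> u'"
  shows "\<tau> [^]\<^bsub>K\<^esub> e \<otimes>\<^bsub>K\<^esub> \<alpha> a = \<alpha> (conj_pow t e a) \<otimes>\<^bsub>K\<^esub> \<tau> [^]\<^bsub>K\<^esub> e"
proof -
  interpret K: group K by fact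
  have carr: "x \<in> carrier G" if "x \<in> window F i j" for x i j
    using that by (rule subgroup.mem_carrier[OF window_subgroup])
  have \<alpha>c: "\<alpha> x \<in> carrier K" if "x \<in> window F i j" "l' \<le> i" "j \<le> u'" for x i j
    using that(1) window_mono[OF that(2,3)] hom_in_carrier[OF \<alpha>, of x] by auto
  have nat: "\<tau> [^]\<^bsub>K\<^esub> int n \<otimes>\<^bsub>K\<^esub> \<alpha> a = \<alpha> (conj_pow t (int n) a) \<otimes>\<^bsub>K\<^esub> \<tau> [^]\<^bsub>K\<^esub> int n"
    if "a \<in> window F l u" "l' \<le> l" "u + int n \<le> u'" for a l u n
    using that(3)
  proof (induction n)
    case 0
    then show ?case using that carr \<alpha>c[OF that(1,2)] by simp
  next
    case (Suc n)
    let ?c = "conj_pow t (int n) a"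
    \<comment> \<open>After n shifts the upper end is u + n, and one more shift is still allowed, so
      it is at most u' - 1.\<close>
    have c: "?c \<in> window F l' (u' - 1)"
      using that(1,2) Suc.prems by (intro window_conj_powI[of _ l u]) auto
    have in1: "\<alpha> ?c \<in> carrier K" "\<alpha> a \<in> carrier K" 
      using \<alpha>c[OF c] \<alpha>c[OF that(1,2)] Suc.prems by auto
    have in2: "\<alpha> (conj_pow t 1 ?c) \<in> carrier K"
      using window_conj_powI[OF c, of l' 1 u'] \<alpha>c[of _ l' u'] by simp
    have p: "\<tau> [^]\<^bsub>K\<^esub> int (Suc n) = \<tau> \<otimes>\<^bsub>K\<^esub> \<tau> [^]\<^bsub>K\<^esub> int n"
      using K.int_pow_mult[OF \<tau>, of 1 "int n"] \<tau> by simp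
    have "\<tau> [^]\<^bsub>K\<^esub> int (Suc n) \<otimes>\<^bsub>K\<^esub> \<alpha> a = \<tau> \<otimes>\<^bsub>K\<^esub> (\<tau> [^]\<^bsub>K\<^esub> int n \<otimes>\<^bsub>K\<^esub> \<alpha> a)"
      unfolding p using \<tau> in1 by (intro K.m_assoc) auto
    also have "\<dots> = \<tau> \<otimes>\<^bsub>K\<^esub> (\<alpha> ?c \<otimes>\<^bsub>K\<^esub> \<tau> [^]\<^bsub>K\<^esub> int n)"
      using Suc by simp
    also have "\<dots> = (\<tau> \<otimes>\<^bsub>K\<^esub> \<alpha> ?c) \<otimes>\<^bsub>K\<^esub> \<tau> [^]\<^bsub>K\<^esub> int n"
      using \<tau> in1 by (intro K.m_assoc[symmetric]) auto
    also have "\<dots> = \<alpha> (conj_pow t 1 ?c) \<otimes>\<^bsub>K\<^esub> \<tau> [^]\<^bsub>K\<^esub> int (Suc n)"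
      unfolding p rel[OF c] using \<tau> in2 by (intro K.m_assoc) auto
    also have "conj_pow t 1 ?c = conj_pow t (int (Suc n)) a"
      using carr[OF that(1)] by (simp add: conj_pow_conj_pow)
    finally show ?case .
  qed
  show ?thesis
  proof (cases e rule: int_cases2)
    case (nonneg n)
    then show ?thesis using nat[OF a(1,2), of n] a(5) by simp
  next
    case (nonpos n)
    let ?c = "conj_pow t e a"
    have c: "?c \<in> window F (l + e) (u + e)" using window_conj_powI[OF a(1)] by simp
    have "conj_pow t (int n) ?c = a"
      using carr[OF a(1)] nonpos by (simp add: conj_pow_conj_pow)
    then have eq: "\<tau> [^]\<^bsub>K\<^esub> int n \<otimes>\<^bsub>K\<^esub> \<alpha> ?c = \<alpha> a \<otimes>\<^bsub>K\<^esub> \<tau> [^]\<^bsub>K\<^esub> int n"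
      using nat[OF c a(3), of n] nonpos a(4) by simp
    have in1: "\<alpha> ?c \<in> carrier K" "\<alpha> a \<in> carrier K"
      using \<alpha>c[OF c a(3) a(5)] \<alpha>c[OF a(1,2,4)] by auto
    have pc: "\<tau> [^]\<^bsub>K\<^esub> i \<in> carrier K" for i :: int using \<tau> by simp
    have pp: "\<tau> [^]\<^bsub>K\<^esub> e \<otimes>\<^bsub>K\<^esub> \<tau> [^]\<^bsub>K\<^esub> int n = \<one>\<^bsub>K\<^esub>" "\<tau> [^]\<^bsub>K\<^esub> int n \<otimes>\<^bsub>K\<^esub> \<tau> [^]\<^bsub>K\<^esub> e = \<one>\<^bsub>K\<^esub>"
      using nonpos \<tau> by (simp_all add: K.int_pow_mult[symmetric] del: int_pow_int)
    have "\<tau> [^]\<^bsub>K\<^esub> e \<otimes>\<^bsub>K\<^esub> \<alpha> a = \<tau> [^]\<^bsub>K\<^esub> e \<otimes>\<^bsub>K\<^esub> (\<alpha> a \<otimes>\<^bsub>K\<^esub> \<tau> [^]\<^bsub>K\<^esub> int n) \<otimes>\<^bsub>K\<^esub> \<tau> [^]\<^bsub>K\<^esub> e"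
      using in1 pc by (simp only: K.m_assoc K.m_closed pp K.r_one)
    also have "\<dots> = (\<tau> [^]\<^bsub>K\<^esub> e \<otimes>\<^bsub>K\<^esub> \<tau> [^]\<^bsub>K\<^esub> int n) \<otimes>\<^bsub>K\<^esub> \<alpha> ?c \<otimes>\<^bsub>K\<^esub> \<tau> [^]\<^bsub>K\<^esub> e"
      unfolding eq[symmetric] using in1 pc by (simp only: K.m_assoc K.m_closed)
    finally show ?thesis using in1 pp by (simp only: K.l_one)
  qed
qed

text \<open>Reading a word from the right, each letter conjugates by a power of t of exponent at
  most E in absolute value and so widens the window by at most E. While the window stays within M
  the rewriting to the form x t^h uses only relations that also hold in K, so both evaluations yield
  the same x and h.\<close>

lemma word_eval_local_hom:
  assumes K: "group K" and \<tau>: "\<tau> \<in> carrier K"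
    and \<alpha>: "\<alpha> \<in> hom (G\<lparr>carrier := window F (- int M) (int M)\<rparr>) K"
    and rel: "\<And>c. c \<in> window F (- int M) (int M - 1) \<Longrightarrow>
      \<tau> \<otimes>\<^bsub>K\<^esub> \<alpha> c = \<alpha> (conj_pow t 1 c) \<otimes>\<^bsub>K\<^esub> \<tau>"
    and S: "\<And>s. s \<in> S \<Longrightarrow> a s \<in> F" "\<And>s. s \<in> S \<Longrightarrow> \<bar>e s\<bar> \<le> int E"
    and w: "set w \<subseteq> S \<times> UNIV" "E * length w \<le> M"
  shows "\<exists>x\<in>window F (- int (E * length w)) (int (E * length w)). \<exists>h::int.
    word_eval G (\<lambda>s. a s \<otimes> t [^] e s) w = x \<otimes> t [^] h \<and>
    word_eval K (\<lambda>s. \<alpha> (a s) \<otimes>\<^bsub>K\<^esub> \<tau> [^]\<^bsub>K\<^esub> e s) w = \<alpha> x \<otimes>\<^bsub>K\<^esub> \<tau> [^]\<^bsub>K\<^esub> h"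
  using w
proof (induction w)
  case Nil
  interpret A: subgroup "window F l u" G for l u by (rule window_subgroup)
  interpret \<alpha>: group_hom "G\<lparr>carrier := window F (- int M) (int M)\<rparr>" K \<alpha>
    using K \<alpha> window_subgroup subgroup_imp_group by (intro group_hom.intro group_hom_axioms.intro) auto
  have "\<alpha> \<one> = \<one>\<^bsub>K\<^esub>" using \<alpha>.hom_one by simp
  then show ?case using \<alpha>.H.one_closed by (intro bexI[of _ \<one>] exI[of _ 0]) auto
next
  case (Cons y w)
  interpret K: group K by fact
  define j where "j = int (E * length w)"
  have jM: "j + int E \<le> int M" "0 \<le> j" "int (E * length (y # w)) = j + int E"
    using Cons.prems by (simp_all add: j_def flip: of_nat_add of_nat_mult)
  obtain x h where x: "x \<in> window F (- j) j"
    and eqG: "word_eval G (\<lambda>s. a s \<otimes> t [^] e s) w = x \<otimes> t [^] (h::int)"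
    and eqK: "word_eval K (\<lambda>s. \<alpha> (a s) \<otimes>\<^bsub>K\<^esub> \<tau> [^]\<^bsub>K\<^esub> e s) w = \<alpha> x \<otimes>\<^bsub>K\<^esub> \<tau> [^]\<^bsub>K\<^esub> h"
    using Cons.IH Cons.prems unfolding j_def by auto
  have yS: "fst y \<in> S" using Cons.prems by auto
  let ?s = "fst y"
  let ?A = "window F (- int M) (int M)"
  have carr: "z \<in> carrier G" if "z \<in> window F l u" for z l u
    using that by (rule subgroup.mem_carrier[OF window_subgroup])
  have \<alpha>c: "\<alpha> z \<in> carrier K" if "z \<in> ?A" for z
    using that hom_in_carrier[OF \<alpha>, of z] by auto
  have \<alpha>m: "\<alpha> (z \<otimes> z') = \<alpha> z \<otimes>\<^bsub>K\<^esub> \<alpha> z'" if "z \<in> ?A" "z' \<in> ?A" for z z'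
    using that hom_mult[OF \<alpha>, of z z'] by simp
  have as: "a ?s \<in> window F l u" if "l \<le> 0" "0 \<le> u" for l u
    using window_incl[OF S(1)[OF yS] that] F S(1)[OF yS] by auto
  have es: "\<bar>e ?s\<bar> \<le> int E" by (rule S(2)[OF yS])
  have pc: "\<tau> [^]\<^bsub>K\<^esub> i \<in> carrier K" for i :: int using \<tau> by simp
  have mc: "z \<otimes> z' \<in> window F l u" if "z \<in> window F l u" "z' \<in> window F l u" for z z' l u
    using window_subgroup that by (rule subgroup.m_closed)
  have inA: "z \<in> ?A" if "z \<in> window F (- (j + int E)) (j + int E)" for z
    using that window_mono[of "- int M" "- (j + int E)" "j + int E" "int M"] jM by auto
  note local_hom = window_conj_local_hom[OF K \<tau> \<alpha> rel]
  show ?case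
  proof (cases "snd y")
    case True
    define x' where "x' = conj_pow t (e ?s) x"
    have x': "x' \<in> window F (- (j + int E)) (j + int E)"
      unfolding x'_def using es by (intro window_conj_powI[OF x]) auto
    have "a ?s \<otimes> x' \<in> window F (- (j + int E)) (j + int E)"
      using as x' jM by (intro mc) auto
    moreover have "word_eval G (\<lambda>s. a s \<otimes> t [^] e s) (y # w) = (a ?s \<otimes> x') \<otimes> t [^] (e ?s + h)"
    proof -
      have "word_eval G (\<lambda>s. a s \<otimes> t [^] e s) (y # w) = a ?s \<otimes> (t [^] e ?s \<otimes> x) \<otimes> t [^] h"
        using True carr[OF x] carr[OF as, of 0 0] by (simp add: word_eval_Cons eqG m_assoc)
      also have "t [^] e ?s \<otimes> x = x' \<otimes> t [^] e ?s"
        unfolding x'_def using conj_pow_mult_pow carr[OF x] by simp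
      finally show ?thesis
        using carr[OF x'] carr[OF as, of 0 0] by (simp add: m_assoc int_pow_mult)
    qed
    moreover have "word_eval K (\<lambda>s. \<alpha> (a s) \<otimes>\<^bsub>K\<^esub> \<tau> [^]\<^bsub>K\<^esub> e s) (y # w)
        = \<alpha> (a ?s \<otimes> x') \<otimes>\<^bsub>K\<^esub> \<tau> [^]\<^bsub>K\<^esub> (e ?s + h)"
    proof -
      have c: "\<alpha> (a ?s) \<in> carrier K" "\<alpha> x' \<in> carrier K" "\<alpha> x \<in> carrier K"
        using \<alpha>c as[of "- int M" "int M"] inA[OF x'] x jM window_mono[of "- int M" "- j" j "int M"] by auto
      have "word_eval K (\<lambda>s. \<alpha> (a s) \<otimes>\<^bsub>K\<^esub> \<tau> [^]\<^bsub>K\<^esub> e s) (y # w)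
        = \<alpha> (a ?s) \<otimes>\<^bsub>K\<^esub> (\<tau> [^]\<^bsub>K\<^esub> e ?s \<otimes>\<^bsub>K\<^esub> \<alpha> x) \<otimes>\<^bsub>K\<^esub> \<tau> [^]\<^bsub>K\<^esub> h"
        using True c pc by (simp add: word_eval_Cons eqK K.m_assoc)
      also have "\<tau> [^]\<^bsub>K\<^esub> e ?s \<otimes>\<^bsub>K\<^esub> \<alpha> x = \<alpha> x' \<otimes>\<^bsub>K\<^esub> \<tau> [^]\<^bsub>K\<^esub> e ?s"
        unfolding x'_def using es jM by (intro local_hom[OF _ x]) auto
      finally show ?thesis
        using c pc inA[OF x'] as[of "- int M" "int M"] \<tau> by (simp add: \<alpha>m K.m_assoc K.int_pow_mult)
    qed
    ultimately show ?thesis unfolding jM(3) by blast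
  next
    case False
    \<comment> \<open>For an inverse letter the order is reversed: the N-part is multiplied on
      first, and the product is then conjugated.\<close>
    define z where "z = inv (a ?s) \<otimes> x"
    have ai: "inv (a ?s) \<in> window F l u" if "l \<le> 0" "0 \<le> u" for l u
      using as[OF that] by (rule subgroup.m_inv_closed[OF window_subgroup])
    have z: "z \<in> window F (- j) j" unfolding z_def using ai x jM by (intro mc) auto
    define x' where "x' = conj_pow t (- e ?s) z"
    have x': "x' \<in> window F (- (j + int E)) (j + int E)"
      unfolding x'_def using es by (intro window_conj_powI[OF z]) auto
    moreover have "word_eval G (\<lambda>s. a s \<otimes> t [^] e s) (y # w) = x' \<otimes> t [^] (- e ?s + h)"
    proof -
      have "word_eval G (\<lambda>s. a s \<otimes> t [^] e s) (y # w) = (t [^] (- e ?s) \<otimes> z) \<otimes> t [^] h"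
        using False carr[OF x] carr[OF as, of 0 0]
        by (simp add: word_eval_Cons eqG m_assoc inv_mult_group int_pow_neg z_def)
      also have "t [^] (- e ?s) \<otimes> z = x' \<otimes> t [^] (- e ?s)"
        unfolding x'_def using conj_pow_mult_pow carr[OF z] by simp
      finally show ?thesis
        using carr[OF x'] by (simp add: m_assoc int_pow_mult[OF t, symmetric])
    qed
    moreover have "word_eval K (\<lambda>s. \<alpha> (a s) \<otimes>\<^bsub>K\<^esub> \<tau> [^]\<^bsub>K\<^esub> e s) (y # w)
        = \<alpha> x' \<otimes>\<^bsub>K\<^esub> \<tau> [^]\<^bsub>K\<^esub> (- e ?s + h)"
    proof -
      have sub: "window F (- j) j \<subseteq> ?A" using window_mono jM by simp
      interpret \<alpha>: group_hom "G\<lparr>carrier := ?A\<rparr>" K \<alpha>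
        using K \<alpha> window_subgroup subgroup_imp_group by (intro group_hom.intro group_hom_axioms.intro) auto
      have c: "\<alpha> (a ?s) \<in> carrier K" "\<alpha> x' \<in> carrier K" "\<alpha> x \<in> carrier K" "\<alpha> z \<in> carrier K"
        using \<alpha>c as[of "- int M" "int M"] inA[OF x'] x z sub by auto
      have "\<alpha> (inv (a ?s)) = inv\<^bsub>K\<^esub> \<alpha> (a ?s)"
        using \<alpha>.hom_inv[of "a ?s"] as[of "- int M" "int M"] m_inv_consistent[OF window_subgroup] by simp
      then have "\<alpha> z = inv\<^bsub>K\<^esub> \<alpha> (a ?s) \<otimes>\<^bsub>K\<^esub> \<alpha> x"
        unfolding z_def using ai[of "- int M" "int M"] x sub by (simp add: \<alpha>m subset_iff)
      then have "word_eval K (\<lambda>s. \<alpha> (a s) \<otimes>\<^bsub>K\<^esub> \<tau> [^]\<^bsub>K\<^esub> e s) (y # w)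
        = (\<tau> [^]\<^bsub>K\<^esub> (- e ?s) \<otimes>\<^bsub>K\<^esub> \<alpha> z) \<otimes>\<^bsub>K\<^esub> \<tau> [^]\<^bsub>K\<^esub> h"
        using False c pc \<tau> by (simp add: word_eval_Cons eqK K.m_assoc K.inv_mult_group K.int_pow_neg)
      also have "\<tau> [^]\<^bsub>K\<^esub> (- e ?s) \<otimes>\<^bsub>K\<^esub> \<alpha> z = \<alpha> x' \<otimes>\<^bsub>K\<^esub> \<tau> [^]\<^bsub>K\<^esub> (- e ?s)"
        unfolding x'_def using es jM by (intro local_hom[OF _ z]) auto
      finally show ?thesis
        using c pc \<tau> by (simp add: K.m_assoc K.int_pow_mult[OF \<tau>, symmetric])
    qed
    ultimately show ?thesis unfolding jM(3) by blast
  qed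
qed

end
end
end

section \<open>Locally finite by infinite cyclic groups\<close>

lemma length_int_pow_free_group:
  assumes "u \<in> carrier (free_group S)"
  shows "length (u [^]\<^bsub>free_group S\<^esub> (i::int)) \<le> nat \<bar>i\<bar> * length u"
proof -
  interpret F: group "free_group S" by (rule group_free_group)
  note * = length_pow_free_group[OF assms] length_inv_free_group[OF F.nat_pow_closed[OF assms]]
  show ?thesis
    by (cases i rule: int_cases2) (auto simp: int_pow_int F.int_pow_neg_int[OF assms] intro: * order.trans)
qed

text \<open>The complement of N is represented by the element t alone. The condition
  \<open>pow_t_in_N\<close> says both that t has infinite order and that its powers meet N
  trivially; it makes the decomposition x t^h unique. The functions \<open>a\<close> and
  \<open>e\<close> record this decomposition on the generators.\<close>

locale locally_finite_by_cyclic = group +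
  fixes N t S F and a :: "'a \<Rightarrow> 'a" and e :: "'a \<Rightarrow> int"
  assumes N: "N \<lhd> G" and t [simp]: "t \<in> carrier G"
    and pow_t_in_N: "\<And>h::int. t [^] h \<in> N \<Longrightarrow> h = 0"
    and S: "finite_generating_set G S"
    and decomp: "\<And>s. s \<in> S \<Longrightarrow> s = a s \<otimes> t [^] e s"
    and aN: "\<And>s. s \<in> S \<Longrightarrow> a s \<in> N"
    and F_def: "F = a ` S"
    and infinite_N: "infinite N"
    and lf: "locally_finite_subgroup G N"
begin

lemma N_subgroup: "subgroup N G" using N by (rule normal_imp_subgroup)

lemma N_carrier: "x \<in> N \<Longrightarrow> x \<in> carrier G"
  by (rule subgroup.mem_carrier[OF N_subgroup])

lemma F_N: "F \<subseteq> N" using aN by (auto simp: F_def)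

lemma F_carrier: "F \<subseteq> carrier G" using F_N N_carrier by auto

lemma finite_F: "finite F" using S by (simp add: F_def finite_generating_set_def)

lemma decomp_unique:
  assumes "x \<in> N" "y \<in> N" "x \<otimes> t [^] (h::int) = y \<otimes> t [^] (k::int)"
  shows "x = y" "h = k"
proof -
  have c: "x \<in> carrier G" "y \<in> carrier G" using assms N_carrier by auto
  have "t [^] (h - k) = inv x \<otimes> y"
  proof -
    have "inv x \<otimes> (x \<otimes> t [^] h) = t [^] h" using c by (simp add: m_assoc[symmetric])
    then have "t [^] h = inv x \<otimes> y \<otimes> t [^] k" using assms(3) c by (simp add: m_assoc)
    then show ?thesis
      using c by (simp add: int_pow_diff m_assoc)
  qed
  moreover have "inv x \<otimes> y \<in> N"
    using assms N_subgroup by (simp add: subgroup.m_closed subgroup.m_inv_closed)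
  ultimately have "t [^] (h - k) \<in> N" by simp
  then show "h = k" using pow_t_in_N by force
  then show "x = y" using assms(3) c by simp
qed

lemma conj_pow_N: "x \<in> N \<Longrightarrow> conj_pow t i x \<in> N"
  using N N_carrier by (simp add: conj_pow_def int_pow_neg normal_inv_iff)

abbreviation W where "W \<equiv> window t F"

lemma W_N: "W l u \<subseteq> N"
  unfolding window_def[OF t]
  using F_N conj_pow_N by (intro generate_subgroup_incl[OF _ N_subgroup]) auto

lemma finite_W: "finite (W l u)"
proof -
  have "finite (\<Union>i\<in>{l..u}. conj_pow t i ` F)" "(\<Union>i\<in>{l..u}. conj_pow t i ` F) \<subseteq> N"
    using finite_F F_N conj_pow_N by auto
  then show ?thesis
    using lf unfolding window_def[OF t] locally_finite_subgroup_def by blast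
qed

text \<open>An invariant A lets all powers of t be moved to the right, so every element of G, being
  a product of generators, has the form x t^h with x in A. For elements of N uniqueness gives h = 0,
  hence N is contained in the finite set A.\<close>

lemma subgroup_not_conj_invariant:
  assumes A: "subgroup A G" "finite A" "F \<subseteq> A" "A \<subseteq> N" and inv: "conj_pow t 1 ` A = A"
  shows False
proof -
  have AG: "x \<in> carrier G" if "x \<in> A" for x using that by (rule subgroup.mem_carrier[OF A(1)])
  have up: "conj_pow t 1 x \<in> A" if "x \<in> A" for x using that inv by blast
  have down: "conj_pow t (- 1) x \<in> A" if "x \<in> A" for x
  proof -
    have "x \<in> conj_pow t 1 ` A" using inv that by simp
    then obtain y where "y \<in> A" "x = conj_pow t 1 y" by blast
    then show ?thesis using AG conj_pow_conj_pow[OF t, of y "- 1" 1] by simp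
  qed
  have all: "conj_pow t i x \<in> A" if x: "x \<in> A" for i x
  proof (induction i rule: int_induct[where k = 0])
    case base
    then show ?case using x AG by simp
  next
    case (step1 i)
    then show ?case using up[OF step1(2)] conj_pow_conj_pow[OF t AG[OF x], of 1 i] by (simp add: add.commute)
  next
    case (step2 i)
    then show ?case using down[OF step2(2)] conj_pow_conj_pow[OF t AG[OF x], of "- 1" i] by simp
  qed
  have gen: "\<exists>x\<in>A. \<exists>h::int. g = x \<otimes> t [^] h" if "g \<in> generate G S" for g
    using that
  proof (induction rule: generate.induct)
    case one
    then show ?case using subgroup.one_closed[OF A(1)] by (intro bexI[of _ \<one>] exI[of _ 0]) auto
  next
    case (incl s)
    then show ?case using decomp[OF incl] A(3) by (auto simp: F_def)
  next
    case (inv s)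
    have as: "a s \<in> A" using inv A(3) by (auto simp: F_def)
    then have "inv (a s) \<in> A" by (rule subgroup.m_inv_closed[OF A(1)])
    moreover have "inv s = t [^] (- e s) \<otimes> inv (a s)"
      using decomp[OF inv] as AG by (metis int_pow_closed int_pow_neg inv_mult_group t)
    ultimately show ?case
      using all AG conj_pow_mult_pow[OF t, of "inv (a s)" "- e s"] by metis
  next
    case (eng g1 g2)
    then obtain x y and h k :: int where x: "x \<in> A" "g1 = x \<otimes> t [^] h" and y: "y \<in> A" "g2 = y \<otimes> t [^] k"
      by blast
    have "g1 \<otimes> g2 = x \<otimes> (t [^] h \<otimes> y) \<otimes> t [^] k"
      using x y AG by (simp add: m_assoc)
    also have "t [^] h \<otimes> y = conj_pow t h y \<otimes> t [^] h"
      using conj_pow_mult_pow[OF t] AG[OF y(1)] by simp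
    finally have "g1 \<otimes> g2 = (x \<otimes> conj_pow t h y) \<otimes> t [^] (h + k)"
      using AG[OF x(1)] AG[OF y(1)] by (simp add: m_assoc int_pow_mult)
    moreover have "x \<otimes> conj_pow t h y \<in> A" using A(1) x all[OF y(1)] by (simp add: subgroup.m_closed)
    ultimately show ?case by blast
  qed
  have "N \<subseteq> A"
  proof
    fix y assume y: "y \<in> N"
    then have "y \<in> generate G S" using S N_carrier by (simp add: finite_generating_set_def)
    then obtain x and h :: int where x: "x \<in> A" "y = x \<otimes> t [^] h" using gen by blast
    have "0 = h" using decomp_unique(2)[of y x 0 h] x y A(4) N_carrier by auto
    then show "y \<in> A" using x AG by simp
  qed
  then show False using infinite_N A(2) finite_subset by blast
qed

lemma F_window:
  assumes "l \<le> 0" "0 \<le> u"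
  shows "F \<subseteq> W l u"
proof
  fix f assume f: "f \<in> F"
  then show "f \<in> W l u" using window_incl[OF t F_carrier f assms] F_carrier by (simp add: subset_iff)
qed

text \<open>Conjugation by t maps the first subwindow bijectively onto the second, so they have
  equal cardinality. If one of them were the whole finite window, so would be the other, and the
  window would be invariant.\<close>

lemma window_proper:
  shows "\<not> W (- int M) (int M) \<subseteq> W (- int M) (int M - 1)"
    and "\<not> W (- int M) (int M) \<subseteq> W (- int M + 1) (int M)"
proof -
  let ?A = "W (- int M) (int M)" and ?C = "W (- int M) (int M - 1)" and ?D = "W (- int M + 1) (int M)"
  note mono = window_mono[OF t F_carrier]
  have CA: "?C \<subseteq> ?A" and DA: "?D \<subseteq> ?A" by (rule mono; simp)+
  have D: "?D = conj_pow t 1 ` ?C" by (simp add: window_conj_pow[OF t F_carrier])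
  have "inj_on (conj_pow t 1) ?C"
    using W_N N_carrier by (intro inj_on_subset[OF conj_pow_inj[OF t]]) auto
  then have card: "card ?D = card ?C" unfolding D by (rule card_image)
  have False if "?A = ?C" "?A = ?D"
  proof (rule subgroup_not_conj_invariant[of ?A])
    show "F \<subseteq> ?A" by (rule F_window) auto
    show "conj_pow t 1 ` ?A = ?A" using D that by metis
  qed (use window_subgroup[OF t F_carrier] finite_W W_N in auto)
  moreover have "?A = ?C" if "?A = ?D" using card_subset_eq[OF finite_W CA] card that by simp
  moreover have "?A = ?D" if "?A = ?C" using card_subset_eq[OF finite_W DA] card that by simp
  ultimately show "\<not> ?A \<subseteq> ?C" "\<not> ?A \<subseteq> ?D" using CA DA by blast+
qed

text \<open>Two proper subgroups never cover a group, but an arbitrary element outside both would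
  have no controlled word length. The explicit list of candidates keeps b a product of at most two
  conjugates of generators of the window.\<close>

lemma ex_middle_generator:
  obtains b f f' where "f \<in> F" "f' \<in> F"
    "b \<in> {conj_pow t (int M) f, conj_pow t (- int M) f',
          conj_pow t (int M) f \<otimes> conj_pow t (- int M) f'}"
    "b \<in> W (- int M) (int M)" "b \<notin> W (- int M) (int M - 1)" "b \<notin> W (- int M + 1) (int M)"
proof -
  let ?A = "W (- int M) (int M)" and ?C = "W (- int M) (int M - 1)" and ?D = "W (- int M + 1) (int M)"
  note incl = window_incl[OF t F_carrier] and sub = window_subgroup[OF t F_carrier]
  have WG: "x \<in> carrier G" if "x \<in> W l u" for x l u
    using that W_N N_carrier by auto
  \<comment> \<open>If exactly one factor lies in H, the product does not. This is applied to both
    subwindows at once when each extreme generator lies in the wrong one of them.\<close>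
  have prod: "x \<otimes> y \<notin> H"
    if "subgroup H G" "x \<in> carrier G" "y \<in> carrier G" "x \<in> H \<longleftrightarrow> y \<notin> H" for H x y
  proof
    assume xy: "x \<otimes> y \<in> H"
    show False
    proof (cases "x \<in> H")
      case True
      then have "inv x \<otimes> (x \<otimes> y) \<in> H" using that(1) xy by (simp add: subgroup.m_closed subgroup.m_inv_closed)
      then show False using that True by (simp add: m_assoc[symmetric])
    next
      case False
      then have "(x \<otimes> y) \<otimes> inv y \<in> H" using that xy by (simp add: subgroup.m_closed subgroup.m_inv_closed)
      then show False using that False by (simp add: m_assoc)
    qed
  qed
  have "\<exists>f\<in>F. conj_pow t (int M) f \<notin> ?C"
  proof (rule ccontr)
    assume "\<not> ?thesis"
    then have *: "conj_pow t i f \<in> ?C" if "f \<in> F" "i \<in> {- int M..int M}" for i f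
      using that incl[OF that(1), of "- int M" i "int M - 1"] by (cases "i = int M") auto
    have "?A \<subseteq> ?C"
      unfolding window_def[OF t, of F "- int M" "int M"]
      by (rule generate_subgroup_incl[OF _ sub]) (use * in auto)
    then show False using window_proper(1) by blast
  qed
  then obtain f where f: "f \<in> F" "conj_pow t (int M) f \<notin> ?C" by blast
  have "\<exists>f\<in>F. conj_pow t (- int M) f \<notin> ?D"
  proof (rule ccontr)
    assume "\<not> ?thesis"
    then have *: "conj_pow t i f \<in> ?D" if "f \<in> F" "i \<in> {- int M..int M}" for i f
      using that incl[OF that(1), of "- int M + 1" i "int M"] by (cases "i = - int M") auto
    have "?A \<subseteq> ?D"
      unfolding window_def[OF t, of F "- int M" "int M"]
      by (rule generate_subgroup_incl[OF _ sub]) (use * in auto)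
    then show False using window_proper(2) by blast
  qed
  then obtain f' where f': "f' \<in> F" "conj_pow t (- int M) f' \<notin> ?D" by blast
  let ?b1 = "conj_pow t (int M) f" and ?b2 = "conj_pow t (- int M) f'"
  have A: "?b1 \<in> ?A" "?b2 \<in> ?A" using f f' by (auto intro!: incl)
  then have A': "?b1 \<otimes> ?b2 \<in> ?A" using sub by (simp add: subgroup.m_closed)
  show ?thesis
  proof (cases "?b1 \<in> ?D \<and> ?b2 \<in> ?C")
    case True
    then have "?b1 \<otimes> ?b2 \<notin> ?C" "?b1 \<otimes> ?b2 \<notin> ?D"
      using prod[OF sub WG[OF A(1)] WG[OF A(2)]] f f' by simp_all
    then show ?thesis using that[OF f(1) f'(1), of "?b1 \<otimes> ?b2"] A' by simp
  next
    case False
    then show ?thesis using that[OF f(1) f'(1), of ?b1] that[OF f(1) f'(1), of ?b2] f f' A by auto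
  qed
qed

text \<open>The relator is the law evaluated at lifts to the free group of the elements that play ping-pong
  in the permutation model of the window \<open>[-M, M]\<close>; it survives in that model, whereas
  all relators of length at most \<open>n\<close> die there.\<close>

lemma linear_gaps:
  assumes law: "satisfies_law G"
  shows "\<exists>C. \<forall>n\<ge>1. \<exists>w\<in>relation_subgroup G S.
    length w \<le> C * n \<and> w \<notin> relation_subgroup_upto G S (int n)"
proof -
  let ?F = "free_group S" and ?ev = "word_eval G (\<lambda>s. s)"
  have SG: "S \<subseteq> carrier G" "generate G S = carrier G" "finite S"
    using S by (auto simp: finite_generating_set_def)
  have idS: "(\<lambda>s. s) \<in> S \<rightarrow> carrier G" using SG by auto
  interpret F: group ?F by (rule group_free_group)
  interpret ev: group_hom ?F G ?ev by (rule group_hom_word_eval[OF idS])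
  obtain k v where v: "v \<in> carrier (free_group {..<k::nat})" "v \<noteq> []"
    and law: "\<And>g. g \<in> {..<k} \<rightarrow> carrier G \<Longrightarrow> word_eval G g v = \<one>"
    using assms by (auto simp: satisfies_law_def)
  have v': "set v \<subseteq> {..<k} \<times> UNIV" "reduced v" using v by (auto simp: free_group_carrier)
  obtain E where E: "\<And>s. s \<in> S \<Longrightarrow> \<bar>e s\<bar> \<le> int E"
  proof -
    have "\<bar>e s\<bar> \<le> int (\<Sum>s\<in>S. nat \<bar>e s\<bar>)" if "s \<in> S" for s
      using member_le_sum[of s S "\<lambda>s. \<bar>e s\<bar>"] that SG by simp
    then show ?thesis using that by blast
  qed
  obtain ut where ut: "ut \<in> carrier ?F" "?ev ut = t"
    using ex_word[OF SG(1,2) t] by blast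
  obtain uf where uf: "\<And>f. f \<in> F \<Longrightarrow> uf f \<in> carrier ?F" "\<And>f. f \<in> F \<Longrightarrow> ?ev (uf f) = f"
    using ex_word[OF SG(1,2)] F_carrier by (metis subsetD)
  define L where "L = length ut + (\<Sum>f\<in>F. length (uf f))"
  have L: "length ut \<le> L" "\<And>f. f \<in> F \<Longrightarrow> length (uf f) \<le> L"
    using member_le_sum[of _ F "\<lambda>f. length (uf f)"] finite_F by (auto simp: L_def intro: trans_le_add2)
  \<comment> \<open>Each of the \<open>length v\<close> letters of the law is replaced by a word
    made of two powers of \<open>ut\<close> with exponent at most k, of total length at most 2 k L,
    and a lift of b of length at most 4 M L + 2 L; the factor E + E L bounds M / n.\<close>
  have "\<exists>w\<in>relation_subgroup G S. length w \<le> (length v * (2 * k * L + 4 * (E + E * L) * L + 2 * L)) * n \<and>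
      w \<notin> relation_subgroup_upto G S (int n)" if n: "1 \<le> n" for n
  proof -
    \<comment> \<open>The first summand makes the local formula valid for words of length at most n,
      the second for the chosen lifts of t and of the elements of F.\<close>
    define M where "M = E * n + E * L"
    let ?A = "W (- int M) (int M)" and ?C = "W (- int M) (int M - 1)" and ?D = "W (- int M + 1) (int M)"
    note mono = window_mono[OF t F_carrier]
    have CA: "?C \<subseteq> ?A" and DA: "?D \<subseteq> ?A" by (rule mono; simp)+
    have D: "?D = conj_pow t 1 ` ?C" by (simp add: window_conj_pow[OF t F_carrier])
    note sub = window_subgroup[OF t F_carrier]
    have WG: "x \<in> carrier G" if "x \<in> W l u" for x l u
      using that W_N N_carrier by auto
    have \<phi>: "conj_pow t 1 \<in> iso (G\<lparr>carrier := ?C\<rparr>) (G\<lparr>carrier := ?D\<rparr>)"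
    proof -
      have "bij_betw (conj_pow t 1) ?C ?D"
        unfolding D using WG by (intro bij_betw_imageI inj_on_subset[OF conj_pow_inj[OF t]]) auto
      then show ?thesis
        using hom_mult[OF conj_pow_hom[OF t]] WG by (auto simp: iso_def hom_def bij_betw_def)
    qed
    obtain b f f' where b: "f \<in> F" "f' \<in> F"
       "b \<in> {conj_pow t (int M) f, conj_pow t (- int M) f', conj_pow t (int M) f \<otimes> conj_pow t (- int M) f'}"
       "b \<in> ?A" "b \<notin> ?C" "b \<notin> ?D"
      by (rule ex_middle_generator[of M])
    obtain \<alpha> :: "'a \<Rightarrow> 'a \<times> nat \<times> bool \<Rightarrow> 'a \<times> nat \<times> bool" and \<tau>
      where \<alpha>: "\<alpha> \<in> hom (G\<lparr>carrier := ?A\<rparr>) perm_group" and \<tau>: "\<tau> \<in> carrier perm_group"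
        and rel: "\<And>c. c \<in> ?C \<Longrightarrow> \<tau> \<otimes>\<^bsub>perm_group\<^esub> \<alpha> c = \<alpha> (conj_pow t 1 c) \<otimes>\<^bsub>perm_group\<^esub> \<tau>"
        and ping: "\<And>w. reduced w \<Longrightarrow> w \<noteq> [] \<Longrightarrow> word_eval perm_group (\<lambda>i. \<tau> [^]\<^bsub>perm_group\<^esub> Suc i
           \<otimes>\<^bsub>perm_group\<^esub> \<alpha> b \<otimes>\<^bsub>perm_group\<^esub> \<tau> [^]\<^bsub>perm_group\<^esub> Suc i) w \<noteq> \<one>\<^bsub>perm_group\<^esub>"
    proof (rule hnn_permutation_model[OF sub finite_W sub CA sub DA \<phi> b(4-6)])
    qed (rule that; assumption)
    let ?K = "perm_group :: ('a \<times> nat \<times> bool \<Rightarrow> 'a \<times> nat \<times> bool) monoid"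
    interpret K: group ?K by (rule group_perm_group)
    define \<rho> where "\<rho> = word_eval ?K (\<lambda>s. \<alpha> (a s) \<otimes>\<^bsub>?K\<^esub> \<tau> [^]\<^bsub>?K\<^esub> e s)"
    have FA: "f \<in> ?A" if "f \<in> F" for f
      using F_window[of "- int M" "int M"] that by auto
    have \<sigma>: "(\<lambda>s. \<alpha> (a s) \<otimes>\<^bsub>?K\<^esub> \<tau> [^]\<^bsub>?K\<^esub> e s) \<in> S \<rightarrow> carrier ?K"
    proof
      fix s assume "s \<in> S"
      then have "a s \<in> ?A" by (intro FA) (simp add: F_def)
      then show "\<alpha> (a s) \<otimes>\<^bsub>?K\<^esub> \<tau> [^]\<^bsub>?K\<^esub> e s \<in> carrier ?K"
        using hom_in_carrier[OF \<alpha>, of "a s"] \<tau> by (intro K.m_closed K.int_pow_closed) auto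
    qed
    interpret \<rho>: group_hom ?F ?K \<rho>
      unfolding \<rho>_def by (rule K.group_hom_word_eval[OF \<sigma>])
    \<comment> \<open>For words short enough to stay within the window, \<open>\<rho>\<close>
      depends only on the element of G that they represent, although \<open>\<rho>\<close> need not
      factor through G.\<close>
    have local: "\<rho> w = \<alpha> x \<otimes>\<^bsub>?K\<^esub> \<tau> [^]\<^bsub>?K\<^esub> h"
      if w: "w \<in> carrier ?F" "E * length w \<le> M" "?ev w = x \<otimes> t [^] h" "x \<in> N" for w x and h :: int
    proof -
      have ws: "set w \<subseteq> S \<times> UNIV" using w by (simp add: free_group_carrier)
      have "?ev w = word_eval G (\<lambda>s. a s \<otimes> t [^] e s) w"
        using ws decomp by (induction w) (auto simp: word_eval_Cons)
      then obtain y and h' :: int where "y \<in> N" "?ev w = y \<otimes> t [^] h'" "\<rho> w = \<alpha> y \<otimes>\<^bsub>?K\<^esub> \<tau> [^]\<^bsub>?K\<^esub> h'"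
        using word_eval_local_hom[OF t F_carrier group_perm_group \<tau> \<alpha> rel, of S a e E w] E ws w(2) W_N
        unfolding \<rho>_def by (force simp: F_def)
      then show ?thesis using decomp_unique[OF w(4), of y h h'] w(3) by simp
    qed
    have \<alpha>1: "\<alpha> \<one> = \<one>\<^bsub>?K\<^esub>"
      using hom_one[OF \<alpha> subgroup_imp_group[OF sub] group_perm_group] by simp
    \<comment> \<open>The kernel is normal, so it suffices that the short relators lie in it; by
      \<open>local\<close> they go to the image of the form with trivial N-part and exponent
      0.\<close>
    have "relation_subgroup_upto G S (int n) \<subseteq> kernel ?F ?K \<rho>"
    proof (rule relation_subgroup_upto_least[OF \<rho>.normal_kernel])
      fix w assume w: "w \<in> relation_subgroup G S" "int (length w) \<le> int n"
      then have "E * length w \<le> M" unfolding M_def by (simp add: trans_le_add1)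
      then have "\<rho> w = \<alpha> \<one> \<otimes>\<^bsub>?K\<^esub> \<tau> [^]\<^bsub>?K\<^esub> (0::int)"
        using w by (intro local) (auto simp: relation_subgroup_iff subgroup.one_closed[OF N_subgroup])
      then show "w \<in> kernel ?F ?K \<rho>"
        using w \<alpha>1 by (auto simp: kernel_def relation_subgroup_iff)
    qed
    have EL: "E * l \<le> M" if "l \<le> L" for l using that by (simp add: M_def trans_le_add2)
    have \<rho>t: "\<rho> ut = \<tau>"
      using local[of ut \<one> 1] ut EL[OF L(1)] \<alpha>1 \<tau> subgroup.one_closed[OF N_subgroup] by simp
    have \<rho>f: "\<rho> (uf f) = \<alpha> f" if "f \<in> F" for f
      using local[of "uf f" f 0] uf[OF that] EL[OF L(2)[OF that]] F_N that subsetD[OF F_carrier that] FA[OF that]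
        hom_in_carrier[OF \<alpha>, of f] by auto
    have \<alpha>c: "\<alpha> x \<in> carrier ?K" if "x \<in> ?A" for x
      using hom_in_carrier[OF \<alpha>, of x] that by simp
    \<comment> \<open>These words are in general too long for \<open>local\<close>. Their image is
      instead computed from the images of \<open>ut\<close> and \<open>uf f\<close> by the
      homomorphism property, followed by conjugation inside the window.\<close>
    have lift: "\<exists>u\<in>carrier ?F. \<rho> u = \<alpha> (conj_pow t i f) \<and> length u \<le> 2 * M * L + L"
      if f: "f \<in> F" and i: "\<bar>i\<bar> = int M" for i f
    proof (intro bexI conjI)
      let ?p = "\<lambda>i::int. ut [^]\<^bsub>?F\<^esub> i"
      let ?u = "?p i \<otimes>\<^bsub>?F\<^esub> uf f \<otimes>\<^bsub>?F\<^esub> ?p (- i)"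
      have c: "?p j \<in> carrier ?F" "uf f \<in> carrier ?F" for j using ut uf f by auto
      show "?u \<in> carrier ?F" using c by (intro F.m_closed)
      have "length (?p i) \<le> M * L" "length (?p (- i)) \<le> M * L"
        using length_int_pow_free_group[OF ut(1), of i] length_int_pow_free_group[OF ut(1), of "- i"]
          L(1) i by (auto intro: order.trans[OF _ mult_le_mono2])
      moreover note length_mult_free_group[OF c(1)[of "- i"], of "?p i \<otimes>\<^bsub>?F\<^esub> uf f"]
        length_mult_free_group[OF c(2), of "?p i"] L(2)[OF f]
      ultimately show "length ?u \<le> 2 * M * L + L" by simp
      have fW: "f \<in> W 0 0" using F_window[of 0 0] f by auto
      have cA: "conj_pow t i f \<in> ?A" using window_incl[OF t F_carrier f] i by simp
      have pc: "\<tau> [^]\<^bsub>?K\<^esub> j \<in> carrier ?K" for j :: int by (rule K.int_pow_closed[OF \<tau>])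
      have "\<rho> ?u = \<tau> [^]\<^bsub>?K\<^esub> i \<otimes>\<^bsub>?K\<^esub> \<alpha> f \<otimes>\<^bsub>?K\<^esub> \<tau> [^]\<^bsub>?K\<^esub> (- i)"
        using \<rho>.hom_mult \<rho>.hom_int_pow[OF ut(1)] c \<rho>t \<rho>f[OF f] F.m_closed by simp
      also have "\<tau> [^]\<^bsub>?K\<^esub> i \<otimes>\<^bsub>?K\<^esub> \<alpha> f = \<alpha> (conj_pow t i f) \<otimes>\<^bsub>?K\<^esub> \<tau> [^]\<^bsub>?K\<^esub> i"
        using i by (intro window_conj_local_hom[OF t F_carrier group_perm_group \<tau> \<alpha> rel fW]) auto
      also have "\<dots> \<otimes>\<^bsub>?K\<^esub> \<tau> [^]\<^bsub>?K\<^esub> (- i) = \<alpha> (conj_pow t i f) \<otimes>\<^bsub>?K\<^esub> (\<tau> [^]\<^bsub>?K\<^esub> i \<otimes>\<^bsub>?K\<^esub> \<tau> [^]\<^bsub>?K\<^esub> (- i))"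
        using pc \<alpha>c[OF cA] by (intro K.m_assoc)
      also have "\<tau> [^]\<^bsub>?K\<^esub> i \<otimes>\<^bsub>?K\<^esub> \<tau> [^]\<^bsub>?K\<^esub> (- i) = \<one>\<^bsub>?K\<^esub>"
        using K.int_pow_mult[OF \<tau>, of i "- i"] by simp
      also have "\<alpha> (conj_pow t i f) \<otimes>\<^bsub>?K\<^esub> \<one>\<^bsub>?K\<^esub> = \<alpha> (conj_pow t i f)"
        using \<alpha>c[OF cA] by (intro K.r_one)
      finally show "\<rho> ?u = \<alpha> (conj_pow t i f)" .
    qed
    obtain u1 where u1: "u1 \<in> carrier ?F" "\<rho> u1 = \<alpha> (conj_pow t (int M) f)" "length u1 \<le> 2 * M * L + L"
      using lift[OF b(1), of "int M"] by auto
    obtain u2 where u2: "u2 \<in> carrier ?F" "\<rho> u2 = \<alpha> (conj_pow t (- int M) f')" "length u2 \<le> 2 * M * L + L"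
      using lift[OF b(2), of "- int M"] by auto
    have "\<exists>vb\<in>carrier ?F. \<rho> vb = \<alpha> b \<and> length vb \<le> 4 * M * L + 2 * L"
    proof -
      have cA: "conj_pow t (int M) f \<in> ?A" "conj_pow t (- int M) f' \<in> ?A"
        using window_incl[OF t F_carrier] b by auto
      have "\<rho> (u1 \<otimes>\<^bsub>?F\<^esub> u2) = \<alpha> (conj_pow t (int M) f \<otimes> conj_pow t (- int M) f')"
        using \<rho>.hom_mult[OF u1(1) u2(1)] hom_mult[OF \<alpha>, of "conj_pow t (int M) f" "conj_pow t (- int M) f'"]
          u1 u2 cA by simp
      moreover have "length (u1 \<otimes>\<^bsub>?F\<^esub> u2) \<le> 4 * M * L + 2 * L"
        using length_mult_free_group[OF u2(1), of u1] u1 u2 by simp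
      ultimately show ?thesis
        using b(3) u1 u2 F.m_closed[OF u1(1) u2(1)]
        by (auto intro: bexI[of _ u1] bexI[of _ u2] bexI[of _ "u1 \<otimes>\<^bsub>?F\<^esub> u2"])
    qed
    then obtain vb where vb: "vb \<in> carrier ?F" "\<rho> vb = \<alpha> b" "length vb \<le> 4 * M * L + 2 * L"
      by blast
    define x where "x i = ut [^]\<^bsub>?F\<^esub> Suc i \<otimes>\<^bsub>?F\<^esub> vb \<otimes>\<^bsub>?F\<^esub> ut [^]\<^bsub>?F\<^esub> Suc i" for i
    have x: "x \<in> {..<k} \<rightarrow> carrier ?F" using ut vb by (auto simp: x_def simp del: nat_pow_Suc)
    have lx: "length (x i) \<le> 2 * k * L + 4 * M * L + 2 * L" if "i \<in> {..<k}" for i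
    proof -
      let ?p = "ut [^]\<^bsub>?F\<^esub> Suc i"
      have p: "?p \<in> carrier ?F" using ut by (intro F.nat_pow_closed)
      have "length ?p \<le> k * L"
        using length_pow_free_group[OF ut(1), of "Suc i"] L(1) that
        by (meson Suc_leI lessThan_iff mult_le_mono order.trans)
      then show ?thesis
        using length_mult_free_group[OF p, of "?p \<otimes>\<^bsub>?F\<^esub> vb"] length_mult_free_group[OF vb(1), of ?p] vb(3)
        unfolding x_def by (simp del: nat_pow_Suc)
    qed
    \<comment> \<open>This is the law evaluated in the free group: trivial in G under any
      substitution, but mapped by \<open>\<rho>\<close> to a nontrivial ping-pong word.\<close>
    define y where "y = word_eval ?F x v"
    have y: "y \<in> carrier ?F" unfolding y_def by (rule F.word_eval_closed[OF x v'(1)])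
    have "?ev (x i) \<in> carrier G" if "i < k" for i
      using x that by (intro ev.hom_closed) auto
    then have "?ev y = \<one>"
      unfolding y_def ev.hom_word_eval[OF x v'(1)] by (intro law) auto
    then have "y \<in> relation_subgroup G S" using y by (simp add: relation_subgroup_iff)
    moreover have "\<rho> y = word_eval perm_group (\<lambda>i. \<tau> [^]\<^bsub>?K\<^esub> Suc i \<otimes>\<^bsub>?K\<^esub> \<alpha> b \<otimes>\<^bsub>?K\<^esub> \<tau> [^]\<^bsub>?K\<^esub> Suc i) v"
    proof -
      have "\<rho> \<circ> x = (\<lambda>i. \<tau> [^]\<^bsub>?K\<^esub> Suc i \<otimes>\<^bsub>?K\<^esub> \<alpha> b \<otimes>\<^bsub>?K\<^esub> \<tau> [^]\<^bsub>?K\<^esub> Suc i)"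
      proof
        fix i
        have p: "ut [^]\<^bsub>?F\<^esub> Suc i \<in> carrier ?F" using ut by (intro F.nat_pow_closed)
        have "\<rho> (ut [^]\<^bsub>?F\<^esub> Suc i) = \<tau> [^]\<^bsub>?K\<^esub> Suc i"
          using \<rho>.hom_nat_pow[OF ut(1)] \<rho>t by metis
        then show "(\<rho> \<circ> x) i = \<tau> [^]\<^bsub>?K\<^esub> Suc i \<otimes>\<^bsub>?K\<^esub> \<alpha> b \<otimes>\<^bsub>?K\<^esub> \<tau> [^]\<^bsub>?K\<^esub> Suc i"
          unfolding comp_def x_def using p vb(1,2)
          by (simp only: \<rho>.hom_mult F.m_closed)
      qed
      then show ?thesis unfolding y_def \<rho>.hom_word_eval[OF x v'(1)] by simp
    qed
    then have "y \<notin> kernel ?F ?K \<rho>" using ping[OF v'(2) v(2)] by (simp add: kernel_def)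
    moreover have "length y \<le> (length v * (2 * k * L + 4 * (E + E * L) * L + 2 * L)) * n"
    proof -
      have "length y \<le> length v * (2 * k * L + 4 * M * L + 2 * L)"
        unfolding y_def by (rule length_word_eval_free_group[OF x v'(1) lx])
      also have "\<dots> \<le> length v * ((2 * k * L + 4 * (E + E * L) * L + 2 * L) * n)"
      proof (intro mult_le_mono2)
        \<comment> \<open>Here n at least 1 absorbs the constant summand E L; the other constants
          are absorbed in the same way.\<close>
        have "M \<le> (E + E * L) * n" using n by (simp add: M_def algebra_simps)
        then have "4 * M * L \<le> 4 * ((E + E * L) * n) * L" by simp
        moreover have "2 * k * L \<le> 2 * k * L * n" "2 * L \<le> 2 * L * n" using n by simp_all
        ultimately have "2 * k * L + 4 * M * L + 2 * L \<le> 2 * k * L * n + 4 * ((E + E * L) * n) * L + 2 * L * n"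
          by (intro add_mono)
        then show "2 * k * L + 4 * M * L + 2 * L \<le> (2 * k * L + 4 * (E + E * L) * L + 2 * L) * n"
          by (simp only: algebra_simps)
      qed
      finally show ?thesis by (simp add: mult.assoc)
    qed
    ultimately show ?thesis using \<open>relation_subgroup_upto G S (int n) \<subseteq> _\<close> by blast
  qed
  then show ?thesis by blast
qed

end

section \<open>Density from linear gaps, and the choice of the stable letter\<close>

context group
begin

text \<open>If no index above n and up to (C + 1) n were in the relation range, the subgroups would
  be constant from n to n + C n. The last one contains the relator of length at most C n, while the
  first one does not.\<close>

lemma linear_gaps_imp_densely_related:
  assumes S: "finite_generating_set G S"
    and gaps: "\<exists>C. \<forall>n\<ge>1. \<exists>w\<in>relation_subgroup G S.
      length w \<le> C * n \<and> w \<notin> relation_subgroup_upto G S (int n)"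
  shows "densely_related G"
proof -
  obtain C where C: "\<And>n. 1 \<le> n \<Longrightarrow> \<exists>w\<in>relation_subgroup G S.
      length w \<le> C * n \<and> w \<notin> relation_subgroup_upto G S (int n)"
    using gaps by blast
  have "\<exists>r\<in>relation_range G S. n \<le> r \<and> real_of_int r \<le> real (C + 1) * real_of_int n" if n: "1 \<le> n" for n
  proof (rule ccontr)
    assume none: "\<not> ?thesis"
    obtain w where w: "w \<in> relation_subgroup G S" "length w \<le> C * nat n"
      "w \<notin> relation_subgroup_upto G S n"
    proof -
      have "int (nat n) = n" "1 \<le> nat n" using n by auto
      then show ?thesis using C[of "nat n"] that by auto
    qed
    have "relation_subgroup_upto G S (n + int j) = relation_subgroup_upto G S n"
      if "int j \<le> int C * n" for j
      using that
    proof (induction j)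
      case (Suc j)
      have "real_of_int (n + int (Suc j)) \<le> real_of_int ((int C + 1) * n)"
        using Suc.prems by (simp only: of_int_le_iff) (simp add: algebra_simps)
      then have "n + int (Suc j) \<notin> relation_range G S"
        using none n by (auto simp: algebra_simps)
      then have "\<not> relation_subgroup_upto G S (n + int j) \<subset> relation_subgroup_upto G S (n + int (Suc j))"
        using n by (simp add: relation_range_def)
      then have "relation_subgroup_upto G S (n + int (Suc j)) = relation_subgroup_upto G S (n + int j)"
        using relation_subgroup_upto_mono[of "n + int j" "n + int (Suc j)" S] by auto
      then show ?case using Suc by simp
    qed simp
    from this[of "C * nat n"] have "relation_subgroup_upto G S (n + int C * n) = relation_subgroup_upto G S n"
      using n by simp
    moreover have "int (length w) \<le> int (C * nat n)" using w(2) by (simp only: of_nat_le_iff)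
    then have "w \<in> relation_subgroup_upto G S (n + int C * n)"
      using w(1) n by (intro relation_subgroup_uptoI) auto
    ultimately show False using w(3) by simp
  qed
  then show ?thesis
    unfolding densely_related_def using S by (intro exI[of _ S] conjI exI[of _ "real (C + 1)"]) auto
qed

text \<open>The preimage of 1 under the isomorphism generates Q, since the isomorphism sends its
  h-th power to h.\<close>

lemma semidirect_product_integer_stable_letter:
  assumes sd: "semidirect_product G N Q" and Z: "G\<lparr>carrier := Q\<rparr> \<cong> integer_group"
  obtains t where "t \<in> carrier G" "\<And>h::int. t [^] h \<in> N \<Longrightarrow> h = 0"
    "\<And>g. g \<in> carrier G \<Longrightarrow> \<exists>x\<in>N. \<exists>h::int. g = x \<otimes> t [^] h"
proof -
  have Q: "subgroup Q G" and NQ: "N \<inter> Q = {\<one>}" "N <#> Q = carrier G"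
    using sd by (auto simp: semidirect_product_def)
  obtain \<phi> where \<phi>: "\<phi> \<in> iso (G\<lparr>carrier := Q\<rparr>) integer_group"
    using Z by (auto simp: is_iso_def)
  then have b: "bij_betw \<phi> Q UNIV" by (simp add: iso_def)
  interpret \<phi>: group_hom "G\<lparr>carrier := Q\<rparr>" integer_group \<phi>
    using \<phi> subgroup_imp_group[OF Q]
    by (intro group_hom.intro group_hom_axioms.intro) (auto simp: iso_def)
  obtain t where t: "t \<in> Q" "\<phi> t = 1" using b by (auto simp: bij_betw_def image_iff) (metis UNIV_I imageE)
  have tG: "t \<in> carrier G" using t(1) by (rule subgroup.mem_carrier[OF Q])
  have tQ: "t [^] (h::int) \<in> Q" for h by (rule subgroup_int_pow_closed[OF Q t(1)])
  have \<phi>t: "\<phi> (t [^] (h::int)) = h" for h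
    using \<phi>.hom_int_pow[of t h] t int_pow_consistent[OF Q t(1)] by simp
  have "h = 0" if "t [^] (h::int) \<in> N" for h
  proof -
    have "t [^] h = \<one>" using that tQ[of h] NQ(1) by blast
    then show ?thesis using \<phi>t[of h] \<phi>.hom_one by simp
  qed
  moreover have "\<exists>x\<in>N. \<exists>h::int. g = x \<otimes> t [^] h" if g: "g \<in> carrier G" for g
  proof -
    obtain x q where "x \<in> N" "q \<in> Q" "g = x \<otimes> q"
      using g unfolding NQ(2)[symmetric] by (auto simp: set_mult_def)
    moreover have "q = t [^] (\<phi> q)"
      using \<open>q \<in> Q\<close> tQ \<phi>t b by (metis bij_betw_imp_inj_on inj_onD)
    ultimately show ?thesis by metis
  qed
  ultimately show ?thesis using that tG by blast
qed

lemma locally_finite_by_integer_linear_gaps: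
  assumes "semidirect_product G N Q" "G\<lparr>carrier := Q\<rparr> \<cong> integer_group"
    and "infinite N" "locally_finite_subgroup G N" and law: "satisfies_law G"
    and S: "finite_generating_set G S"
  shows "\<exists>C. \<forall>n\<ge>1. \<exists>w\<in>relation_subgroup G S.
    length w \<le> C * n \<and> w \<notin> relation_subgroup_upto G S (int n)"
proof -
  obtain t where t: "t \<in> carrier G" "\<And>h::int. t [^] h \<in> N \<Longrightarrow> h = 0"
    "\<And>g. g \<in> carrier G \<Longrightarrow> \<exists>x\<in>N. \<exists>h::int. g = x \<otimes> t [^] h"
    using semidirect_product_integer_stable_letter[OF assms(1,2)] by metis
  have "\<forall>s\<in>S. \<exists>x. \<exists>h::int. x \<in> N \<and> s = x \<otimes> t [^] h"
    using t(3) S by (auto simp: finite_generating_set_def) (metis subsetD)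
  then obtain a e where ae: "\<And>s. s \<in> S \<Longrightarrow> a s \<in> N" "\<And>s. s \<in> S \<Longrightarrow> s = a s \<otimes> t [^] (e s :: int)"
    by metis
  have N: "N \<lhd> G" using assms(1) by (simp add: semidirect_product_def)
  interpret locally_finite_by_cyclic G N t S "a ` S" a e
    by (intro locally_finite_by_cyclic.intro locally_finite_by_cyclic_axioms.intro)
      (fact group_axioms N t S ae assms refl)+
  show ?thesis by (rule linear_gaps[OF law])
qed

end

section \<open>Discrete fillings and ultralimits\<close>

text \<open>The factors are multiplied in the order of their indices, as the groups here are not
  commutative.\<close>

primrec iter_mult :: "('a, 'b) monoid_scheme \<Rightarrow> (nat \<Rightarrow> 'a) \<Rightarrow> nat \<Rightarrow> 'a" where
  "iter_mult G f 0 = \<one>\<^bsub>G\<^esub>"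
| "iter_mult G f (Suc n) = iter_mult G f n \<otimes>\<^bsub>G\<^esub> f n"

lemma (in monoid) iter_mult_closed:
  "(\<And>j. j < n \<Longrightarrow> f j \<in> carrier G) \<Longrightarrow> iter_mult G f n \<in> carrier G"
  by (induction n) auto

lemma (in group_hom) hom_iter_mult:
  "(\<And>j. j < n \<Longrightarrow> f j \<in> carrier G) \<Longrightarrow> h (iter_mult G f n) = iter_mult H (h \<circ> f) n"
  by (induction n) (auto simp: G.iter_mult_closed)

text \<open>A grid of commuting squares of labelled edges whose two vertical sides carry the same labels
  and whose last row is trivial.\<close>

lemma (in group) iter_mult_grid:
  assumes e: "\<And>i j. i \<le> k \<Longrightarrow> j < m \<Longrightarrow> e i j \<in> carrier G"
    and v: "\<And>i j. i < k \<Longrightarrow> j \<le> m \<Longrightarrow> v i j \<in> carrier G"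
    and square: "\<And>i j. i < k \<Longrightarrow> j < m \<Longrightarrow> e i j \<otimes> v i (Suc j) = v i j \<otimes> e (Suc i) j"
    and sides: "\<And>i. i < k \<Longrightarrow> v i m = v i 0"
    and last: "\<And>j. j < m \<Longrightarrow> e k j = \<one>"
  shows "iter_mult G (e 0) m = \<one>"
proof -
  have closed: "iter_mult G (e i) n \<in> carrier G" if "i \<le> k" "n \<le> m" for i n
    using that e by (intro iter_mult_closed) auto
  \<comment> \<open>Sweeping across a row of squares carries the vertical edge along. For n = m both
    vertical edges agree, so the product of row i is a conjugate of the product of row i + 1, and
    triviality passes upwards from the last row.\<close>
  have row: "iter_mult G (e i) n \<otimes> v i n = v i 0 \<otimes> iter_mult G (e (Suc i)) n"
    if "i < k" "n \<le> m" for i n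
    using that(2)
  proof (induction n)
    case 0
    then show ?case using v that by simp
  next
    case (Suc n)
    have c: "iter_mult G (e i) n \<in> carrier G" "iter_mult G (e (Suc i)) n \<in> carrier G"
      "e i n \<in> carrier G" "e (Suc i) n \<in> carrier G" "v i n \<in> carrier G" "v i (Suc n) \<in> carrier G"
      "v i 0 \<in> carrier G"
      using that Suc.prems closed e v by auto
    have "iter_mult G (e i) (Suc n) \<otimes> v i (Suc n) = iter_mult G (e i) n \<otimes> (e i n \<otimes> v i (Suc n))"
      using c by (simp add: m_assoc)
    also have "\<dots> = (iter_mult G (e i) n \<otimes> v i n) \<otimes> e (Suc i) n"
      using square[of i n] that Suc.prems c by (simp add: m_assoc)
    also have "\<dots> = v i 0 \<otimes> iter_mult G (e (Suc i)) (Suc n)"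
      using Suc c by (simp add: m_assoc)
    finally show ?case .
  qed
  have "iter_mult G (e (k - i)) m = \<one>" if "i \<le> k" for i
    using that
  proof (induction i)
    case 0
    have "iter_mult G (e k) n = \<one>" if "n \<le> m" for n
      using that by (induction n) (auto simp: last)
    then show ?case by simp
  next
    case (Suc i)
    let ?j = "k - Suc i"
    have j: "?j < k" "Suc ?j = k - i" using Suc.prems by auto
    have "iter_mult G (e ?j) m \<otimes> v ?j 0 = v ?j 0"
      using row[of ?j m] j sides[of ?j] Suc v[of ?j 0] by simp
    then show ?case using v[of ?j 0] j closed[of ?j m] by simp
  qed
  from this[of k] show ?thesis by simp
qed

lemma reduced_append: "reduced (u @ v) \<Longrightarrow> reduced u \<and> reduced v"
proof (induction u)
  case (Cons x u)
  then show ?case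
    by (cases u; cases v) (auto dest: reduced_tl)
qed simp

lemma free_group_take_drop:
  assumes "w \<in> carrier (free_group S)"
  shows "take n w \<in> carrier (free_group S)" "drop n w \<in> carrier (free_group S)"
  using assms reduced_append[of "take n w" "drop n w"] set_take_subset[of n w] set_drop_subset[of n w]
  by (auto simp: free_group_carrier)

text \<open>Prefixes of a reduced word are reduced, so consecutive pieces multiply back without
  cancellation.\<close>

lemma iter_mult_cut_word:
  assumes w: "w \<in> carrier (free_group S)" and c: "c 0 = 0" "\<And>j. c j \<le> c (Suc j)"
  shows "iter_mult (free_group S) (\<lambda>j. take (c (Suc j) - c j) (drop (c j) w)) n = take (c n) w"
proof (induction n)
  case (Suc n)
  have "take (c n) w @ take (c (Suc n) - c n) (drop (c n) w) = take (c (Suc n)) w"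
    using c(2)[of n] by (metis le_add_diff_inverse take_add)
  moreover have "reduced (take (c (Suc n)) w)"
    using free_group_take_drop[OF w] by (simp add: free_group_carrier)
  ultimately show ?case
    using Suc by (simp add: free_group_def reduce_reduced)
qed (simp add: c)

context group
begin

text \<open>Labelling the edges of a grid in G by words of length at most l makes the boundary of
  each small square a relator of length at most 4 l, which h kills. The images under h thus form a
  grid of commuting squares, and the product of the labels on the top row dies. It is applied with h
  the quotient map by the normal closure of short relators.\<close>

lemma relator_grid:
  assumes S: "S \<subseteq> carrier G" "generate G S = carrier G"
    and H: "group_hom (free_group S) H h"
    and short: "\<And>w. w \<in> relation_subgroup G S \<Longrightarrow> length w \<le> 4 * l \<Longrightarrow> h w = \<one>\<^bsub>H\<^esub>"
    and y: "\<And>i j. i \<le> k \<Longrightarrow> j \<le> m \<Longrightarrow> y i j \<in> carrier G"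
    and row: "\<And>i j. i \<le> k \<Longrightarrow> j < m \<Longrightarrow> word_norm G S (inv (y i j) \<otimes> y i (Suc j)) \<le> l"
    and col: "\<And>i j. i < k \<Longrightarrow> j \<le> m \<Longrightarrow> word_norm G S (inv (y i j) \<otimes> y (Suc i) j) \<le> l"
    and loop: "\<And>i. i \<le> k \<Longrightarrow> y i m = y i 0" and last: "\<And>j. j < m \<Longrightarrow> y k (Suc j) = y k j"
    and u: "\<And>j. j < m \<Longrightarrow> u j \<in> carrier (free_group S)" "\<And>j. j < m \<Longrightarrow> length (u j) \<le> l"
      "\<And>j. j < m \<Longrightarrow> word_eval G (\<lambda>s. s) (u j) = inv (y 0 j) \<otimes> y 0 (Suc j)"
  shows "h (iter_mult (free_group S) u m) = \<one>\<^bsub>H\<^esub>"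
proof -
  let ?F = "free_group S" and ?ev = "word_eval G (\<lambda>s. s)"
  interpret h: group_hom ?F H h by fact
  have idS: "(\<lambda>s. s) \<in> S \<rightarrow> carrier G" using S by auto
  interpret ev: group_hom ?F G ?ev by (rule group_hom_word_eval[OF idS])
  have "\<forall>g\<in>carrier G. \<exists>w\<in>carrier ?F. ?ev w = g \<and> length w = word_norm G S g"
    using word_norm_attained[OF S] by metis
  then obtain W where W: "\<And>g. g \<in> carrier G \<Longrightarrow> W g \<in> carrier ?F"
    "\<And>g. g \<in> carrier G \<Longrightarrow> ?ev (W g) = g" "\<And>g. g \<in> carrier G \<Longrightarrow> length (W g) = word_norm G S g"
    by metis
  \<comment> \<open>The top row carries the prescribed words and not the chosen shortest ones, so
    that its product is the given relator. All other labels depend only on the group element, which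
    makes the two vertical sides agree.\<close>
  define E where "E i j = (if i = 0 then u j else W (inv (y i j) \<otimes> y i (Suc j)))" for i j
  define V where "V i j = W (inv (y i j) \<otimes> y (Suc i) j)" for i j
  have E: "E i j \<in> carrier ?F" "?ev (E i j) = inv (y i j) \<otimes> y i (Suc j)" "length (E i j) \<le> l"
    if "i \<le> k" "j < m" for i j
    using that u W row y by (auto simp: E_def)
  have V: "V i j \<in> carrier ?F" "?ev (V i j) = inv (y i j) \<otimes> y (Suc i) j" "length (V i j) \<le> l"
    if "i < k" "j \<le> m" for i j
    using that W col y by (auto simp: V_def)
  have "iter_mult H ((\<lambda>i j. h (E i j)) 0) m = \<one>\<^bsub>H\<^esub>"
  proof (rule h.H.iter_mult_grid[where k = k and v = "\<lambda>i j. h (V i j)"])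
    fix i j assume ij: "i < k" "j < m"
    let ?p = "E i j \<otimes>\<^bsub>?F\<^esub> V i (Suc j)" and ?q = "V i j \<otimes>\<^bsub>?F\<^esub> E (Suc i) j"
    have c: "E i j \<in> carrier ?F" "V i (Suc j) \<in> carrier ?F" "V i j \<in> carrier ?F" "E (Suc i) j \<in> carrier ?F"
      using ij E V by auto
    have yc: "y i j \<in> carrier G" "y i (Suc j) \<in> carrier G" "y (Suc i) j \<in> carrier G" "y (Suc i) (Suc j) \<in> carrier G"
      using ij y by auto
    have tel: "(inv a \<otimes> b) \<otimes> (inv b \<otimes> d) = inv a \<otimes> d"
      if "a \<in> carrier G" "b \<in> carrier G" "d \<in> carrier G" for a b d
      using that by (metis inv_closed inv_solve_left m_assoc m_closed)
    have "?ev ?p = inv (y i j) \<otimes> y (Suc i) (Suc j)" "?ev ?q = inv (y i j) \<otimes> y (Suc i) (Suc j)"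
      using c yc E[of i j] V[of i "Suc j"] V[of i j] E[of "Suc i" j] ij by (simp_all add: tel)
    then have "?ev (?p \<otimes>\<^bsub>?F\<^esub> inv\<^bsub>?F\<^esub> ?q) = \<one>"
      using c yc by (simp del: ev.hom_mult add: ev.hom_mult[of ?p])
    moreover have "length (?p \<otimes>\<^bsub>?F\<^esub> inv\<^bsub>?F\<^esub> ?q) \<le> 4 * l"
      using length_mult_free_group[of "inv\<^bsub>?F\<^esub> ?q" S ?p] length_inv_free_group[of ?q S]
        length_mult_free_group[OF c(2), of "E i j"] length_mult_free_group[OF c(4), of "V i j"]
        c E(3)[of i j] V(3)[of i "Suc j"] V(3)[of i j] E(3)[of "Suc i" j] ij by simp
    ultimately have "h (?p \<otimes>\<^bsub>?F\<^esub> inv\<^bsub>?F\<^esub> ?q) = \<one>\<^bsub>H\<^esub>"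
      using c by (intro short) (simp_all add: relation_subgroup_iff)
    then have "h ?p \<otimes>\<^bsub>H\<^esub> inv\<^bsub>H\<^esub> (h ?q) = \<one>\<^bsub>H\<^esub>"
      using c by (simp del: h.hom_mult add: h.hom_mult[of ?p])
    then have "h ?p = h ?q"
      using c by (metis h.H.inv_equality h.H.inv_inv h.hom_closed h.H.inv_closed h.G.m_closed)
    then show "h (E i j) \<otimes>\<^bsub>H\<^esub> h (V i (Suc j)) = h (V i j) \<otimes>\<^bsub>H\<^esub> h (E (Suc i) j)"
      using c by simp
  next
    fix i assume "i < k"
    then show "h (V i m) = h (V i 0)" using loop by (simp add: V_def)
  next
    fix j assume j: "j < m"
    show "h (E k j) = \<one>\<^bsub>H\<^esub>"
    proof (rule short)
      \<comment> \<open>The last row is constant, so each of its labels represents the identity and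
        is itself a short relator.\<close>
      show "E k j \<in> relation_subgroup G S" "length (E k j) \<le> 4 * l"
        using E[of k j] j last[of j] y[of k j] by (auto simp: relation_subgroup_iff)
    qed
  qed (use E V in auto)
  moreover have "h (iter_mult ?F u m) = iter_mult H (h \<circ> u) m"
    using u by (intro h.hom_iter_mult)
  ultimately show ?thesis by (simp add: E_def comp_def)
qed

end

section \<open>Representatives of points of an ultralimit, and a Lebesgue number\<close>

text \<open>Members of one point are at limit distance zero, so by the triangle inequality the
  distance of two points can be computed from arbitrary members. Distances in the cone thereby
  become inequalities in G for almost all n along the ultrafilter.\<close>

lemma
  assumes \<omega>: "nonprincipal_ultrafilter \<omega>"
    and nonneg: "\<And>n y z. y \<in> M n \<Longrightarrow> z \<in> M n \<Longrightarrow> 0 \<le> d n y z"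
    and refl: "\<And>n y. y \<in> M n \<Longrightarrow> d n y y = 0"
    and sym: "\<And>n y z. y \<in> M n \<Longrightarrow> z \<in> M n \<Longrightarrow> d n y z = d n z y"
    and tri: "\<And>n y z w. y \<in> M n \<Longrightarrow> z \<in> M n \<Longrightarrow> w \<in> M n \<Longrightarrow> d n y w \<le> d n y z + d n z w"
    and p: "\<And>n. p n \<in> M n"
  shows ultralimit_predist_tendsto: "y \<in> ultralimit_seqs \<omega> M d p \<Longrightarrow> z \<in> ultralimit_seqs \<omega> M d p \<Longrightarrow>
      ((\<lambda>n. d n (y n) (z n)) \<longlongrightarrow> ultralimit_predist \<omega> d y z) \<omega>"
    and ultralimit_point_nonempty: "A \<in> ultralimit_points \<omega> M d p \<Longrightarrow> \<exists>y. y \<in> A"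
    and ultralimit_point_subset: "A \<in> ultralimit_points \<omega> M d p \<Longrightarrow> A \<subseteq> ultralimit_seqs \<omega> M d p"
    and ultralimit_point_exists: "y \<in> ultralimit_seqs \<omega> M d p \<Longrightarrow>
      \<exists>A\<in>ultralimit_points \<omega> M d p. y \<in> A"
    and ultralimit_dist_eq: "A \<in> ultralimit_points \<omega> M d p \<Longrightarrow> B \<in> ultralimit_points \<omega> M d p \<Longrightarrow>
      y \<in> A \<Longrightarrow> z \<in> B \<Longrightarrow> ultralimit_dist \<omega> M d p A B = ultralimit_predist \<omega> d y z"
proof -
  let ?X = "ultralimit_seqs \<omega> M d p"
  let ?D = "ultralimit_predist \<omega> d"
  let ?r = "{(y, z). y \<in> ?X \<and> z \<in> ?X \<and> ?D y z = 0}"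
  have nb: "\<omega> \<noteq> bot"
    using \<omega> by (simp add: nonprincipal_ultrafilter_def)
  have inM: "y n \<in> M n" if "y \<in> ?X" for y n
    using that by (simp add: ultralimit_seqs_def)
  show lim: "((\<lambda>n. d n (y n) (z n)) \<longlongrightarrow> ?D y z) \<omega>" if y: "y \<in> ?X" and z: "z \<in> ?X" for y z
  proof -
    obtain C C' where "\<forall>\<^sub>F n in \<omega>. d n (p n) (y n) \<le> C" "\<forall>\<^sub>F n in \<omega>. d n (p n) (z n) \<le> C'"
      using y z by (auto simp: ultralimit_seqs_def)
    then have "\<forall>\<^sub>F n in \<omega>. \<bar>d n (y n) (z n)\<bar> \<le> C + C'"
    proof eventually_elim
      case (elim n)
      then show ?case
        using nonneg[of "y n" n "z n"] tri[of "y n" n "p n" "z n"] sym[of "y n" n "p n"]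
          inM[OF y] inM[OF z] p by fastforce
    qed
    then show ?thesis
      unfolding ultralimit_predist_def by (rule ultrafilter_bounded_convergent[OF \<omega>])
  qed
  have D_nonneg: "0 \<le> ?D y z" if "y \<in> ?X" "z \<in> ?X" for y z
    by (rule tendsto_lowerbound[OF lim[OF that]]) (use that inM nonneg nb in auto)
  have D_refl: "?D y y = 0" if "y \<in> ?X" for y
    using that inM refl tendsto_Lim[OF nb tendsto_const[of 0]] by (simp add: ultralimit_predist_def)
  have D_sym: "?D y z = ?D z y" if "y \<in> ?X" "z \<in> ?X" for y z
    using that inM sym by (simp add: ultralimit_predist_def)
  have D_tri: "?D y w \<le> ?D y z + ?D z w" if "y \<in> ?X" "z \<in> ?X" "w \<in> ?X" for y z w
    by (rule tendsto_le[OF nb tendsto_add[OF lim lim] lim]) (use that inM tri in auto)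
  have point: "\<exists>y0\<in>?X. A = {y \<in> ?X. ?D y0 y = 0}" if "A \<in> ultralimit_points \<omega> M d p" for A
    using that unfolding ultralimit_points_def by (auto elim!: quotientE)
  show "\<exists>y. y \<in> A" "A \<subseteq> ?X" if "A \<in> ultralimit_points \<omega> M d p" for A
    using point[OF that] D_refl by auto
  show "\<exists>A\<in>ultralimit_points \<omega> M d p. y \<in> A" if "y \<in> ?X" for y
    using that D_refl[OF that] unfolding ultralimit_points_def
    by (intro bexI[of _ "?r `` {y}"] quotientI) auto
  have cls: "y \<in> ?X \<and> y' \<in> ?X \<and> ?D y y' = 0"
    if A: "A \<in> ultralimit_points \<omega> M d p" and y: "y \<in> A" "y' \<in> A" for A y y'
  proof -
    obtain y0 where y0: "y0 \<in> ?X" "A = {y \<in> ?X. ?D y0 y = 0}" using point[OF A] by blast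
    then show ?thesis
      using y D_tri[of y y0 y'] D_sym[of y y0] D_nonneg[of y y'] by auto
  qed
  show "ultralimit_dist \<omega> M d p A B = ?D y z"
    if A: "A \<in> ultralimit_points \<omega> M d p" and B: "B \<in> ultralimit_points \<omega> M d p"
      and y: "y \<in> A" and z: "z \<in> B" for A B y z
  proof -
    have eq: "?D y' z' = ?D y z" if "y' \<in> A" "z' \<in> B" for y' z'
    proof -
      have "y \<in> ?X" "y' \<in> ?X" "?D y y' = 0" "z \<in> ?X" "z' \<in> ?X" "?D z z' = 0"
        using cls[OF A y that(1)] cls[OF B z that(2)] by simp_all
      then show ?thesis
        using D_tri[of y y' z] D_tri[of y' z' z] D_tri[of y' y z'] D_tri[of y z z'] D_sym[of y y'] D_sym[of z z']
        by linarith
    qed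
    have "(THE r. \<exists>y\<in>A. \<exists>z\<in>B. r = ?D y z) = ?D y z"
    proof (rule the_equality)
      show "\<exists>y'\<in>A. \<exists>z'\<in>B. ?D y z = ?D y' z'" using y z by blast
      show "r = ?D y z" if "\<exists>y'\<in>A. \<exists>z'\<in>B. r = ?D y' z'" for r
        using that eq by (elim bexE) simp
    qed
    then show ?thesis using A B by (simp add: ultralimit_dist_def)
  qed
qed

text \<open>A Lebesgue number of the cover of the square by preimages of balls of radius
  \<open>\<delta> / 2\<close>: two points closer than it have images in a common ball.\<close>

lemma (in Metric_space) continuous_square_uniform:
  fixes h :: "real \<times> real \<Rightarrow> 'a"
  assumes h: "continuous_map (prod_topology (top_of_set {0..1}) (top_of_set {0..1})) mtopology h"
    and "0 < \<delta>"
  obtains \<epsilon> where "0 < \<epsilon>"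
    "\<And>a b. a \<in> {0..1} \<times> {0..1} \<Longrightarrow> b \<in> {0..1} \<times> {0..1} \<Longrightarrow> dist a b < \<epsilon> \<Longrightarrow> d (h a) (h b) < \<delta>"
proof -
  let ?I = "{0..1::real} \<times> {0..1::real}"
  have top: "prod_topology (top_of_set {0..1::real}) (top_of_set {0..1::real}) = top_of_set ?I"
    by (simp flip: subtopology_Times)
  have hM: "h a \<in> M" if "a \<in> ?I" for a
    using continuous_map_image_subset_topspace[OF h] that unfolding top by auto
  have "\<exists>V. open V \<and> {a \<in> ?I. h a \<in> mball (h c) (\<delta> / 2)} = V \<inter> ?I" for c
    using openin_continuous_map_preimage[OF h openin_mball, of "h c" "\<delta> / 2"] unfolding top
    by (auto simp: openin_open Int_commute)
  then obtain V where V: "\<And>c. open (V c)" "\<And>c. {a \<in> ?I. h a \<in> mball (h c) (\<delta> / 2)} = V c \<inter> ?I"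
    by metis
  have cover: "?I \<subseteq> \<Union> (V ` ?I)"
  proof
    fix c assume c: "c \<in> ?I"
    then have "c \<in> {a \<in> ?I. h a \<in> mball (h c) (\<delta> / 2)}" using hM \<open>0 < \<delta>\<close> by simp
    then show "c \<in> \<Union> (V ` ?I)" unfolding V using c by blast
  qed
  have "compact ?I" by (intro compact_Times compact_Icc)
  then obtain \<epsilon> where \<epsilon>: "0 < \<epsilon>" "\<And>a. a \<in> ?I \<Longrightarrow> \<exists>G\<in>V ` ?I. ball a \<epsilon> \<subseteq> G"
    using Heine_Borel_lemma[OF _ cover] V(1) by blast
  have "d (h a) (h b) < \<delta>" if ab: "a \<in> ?I" "b \<in> ?I" "dist a b < \<epsilon>" for a b
  proof -
    obtain c where c: "c \<in> ?I" "ball a \<epsilon> \<subseteq> V c" using \<epsilon>(2)[OF ab(1)] by blast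
    then have "a \<in> V c \<inter> ?I" "b \<in> V c \<inter> ?I" using ab \<epsilon>(1) by auto
    then have "h a \<in> mball (h c) (\<delta> / 2)" "h b \<in> mball (h c) (\<delta> / 2)" unfolding V(2)[symmetric] by auto
    then show ?thesis using triangle[of "h a" "h c" "h b"] commute[of "h a" "h c"] by auto
  qed
  then show ?thesis using that \<epsilon>(1) by blast
qed

section \<open>Asymptotic cones\<close>

context group
begin

text \<open>This concerns plain concatenation of lists, without the free reduction built into the
  product of the free group.\<close>

lemma word_eval_append:
  assumes f: "f \<in> S \<rightarrow> carrier G" and u: "set u \<subseteq> S \<times> UNIV" and v: "set v \<subseteq> S \<times> UNIV"
  shows "word_eval G f (u @ v) = word_eval G f u \<otimes> word_eval G f v"
  using u
proof (induction u)
  case Nil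
  then show ?case using word_eval_closed[OF f v] by simp
next
  case (Cons x u)
  then have "f (fst x) \<in> carrier G" "word_eval G f u \<in> carrier G"
    using f by (auto intro: word_eval_closed)
  then show ?case
    using Cons word_eval_closed[OF f v] by (auto simp: word_eval_Cons m_assoc)
qed

lemma
  assumes S: "S \<subseteq> carrier G" "generate G S = carrier G" and s: "\<And>n. 0 < s n"
  shows rescaled_word_metric_nonneg: "0 \<le> rescaled_word_metric G S s n y z"
    and rescaled_word_metric_refl: "y \<in> carrier G \<Longrightarrow> rescaled_word_metric G S s n y y = 0"
    and rescaled_word_metric_sym: "y \<in> carrier G \<Longrightarrow> z \<in> carrier G \<Longrightarrow>
      rescaled_word_metric G S s n y z = rescaled_word_metric G S s n z y"
    and rescaled_word_metric_triangle: "y \<in> carrier G \<Longrightarrow> z \<in> carrier G \<Longrightarrow> x \<in> carrier G \<Longrightarrow>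
      rescaled_word_metric G S s n y x \<le>
        rescaled_word_metric G S s n y z + rescaled_word_metric G S s n z x"
proof -
  note defs = rescaled_word_metric_def word_metric_def
  show "0 \<le> rescaled_word_metric G S s n y z"
    using s[of n] by (simp add: defs)
  show "rescaled_word_metric G S s n y y = 0" if "y \<in> carrier G"
    using that by (simp add: defs word_norm_one)
  show "rescaled_word_metric G S s n y z = rescaled_word_metric G S s n z y"
    if "y \<in> carrier G" "z \<in> carrier G"
    using word_norm_inv_le[OF S, of "inv y \<otimes> z"] word_norm_inv_le[OF S, of "inv z \<otimes> y"] that
    by (simp add: inv_mult_group defs)
  assume x: "y \<in> carrier G" "z \<in> carrier G" "x \<in> carrier G"
  then have "inv y \<otimes> z \<otimes> (inv z \<otimes> x) = inv y \<otimes> x"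
    by (metis inv_closed inv_solve_left m_assoc m_closed)
  then have "word_norm G S (inv y \<otimes> x) \<le> word_norm G S (inv y \<otimes> z) + word_norm G S (inv z \<otimes> x)"
    using word_norm_mult[OF S, of "inv y \<otimes> z" "inv z \<otimes> x"] x by simp
  then show "rescaled_word_metric G S s n y x \<le>
        rescaled_word_metric G S s n y z + rescaled_word_metric G S s n z x"
    using s[of n] by (simp add: defs field_simps)
qed

text \<open>The prefixes of w trace a path in the Cayley graph starting at g, and the step from
  position i to position j is the subword read between them.\<close>

lemma word_path_increment:
  assumes S: "S \<subseteq> carrier G" and g: "g \<in> carrier G" and w: "w \<in> carrier (free_group S)"
    and ij: "i \<le> j"
  shows "inv (g \<otimes> word_eval G (\<lambda>s. s) (take i w)) \<otimes> (g \<otimes> word_eval G (\<lambda>s. s) (take j w))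
    = word_eval G (\<lambda>s. s) (take (j - i) (drop i w))"
proof -
  let ?ev = "word_eval G (\<lambda>s. s)"
  have f: "(\<lambda>s. s) \<in> S \<rightarrow> carrier G" using S by auto
  have sets: "set (take i w) \<subseteq> S \<times> UNIV" "set (take (j - i) (drop i w)) \<subseteq> S \<times> UNIV"
    using w free_group_take_drop[OF w, of i] free_group_take_drop[OF free_group_take_drop(2)[OF w], of "j - i" i]
    by (auto simp: free_group_carrier)
  note c = sets[THEN word_eval_closed[OF f]]
  have "take j w = take i w @ take (j - i) (drop i w)"
    using ij by (metis le_add_diff_inverse take_add)
  then have "?ev (take j w) = ?ev (take i w) \<otimes> ?ev (take (j - i) (drop i w))"
    using word_eval_append[OF f sets] by simp
  then show ?thesis
    using c g by (simp add: inv_mult_group m_assoc) (simp add: m_assoc[symmetric])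
qed

lemma word_path_metric:
  assumes S: "S \<subseteq> carrier G" "generate G S = carrier G"
    and g: "g \<in> carrier G" and w: "w \<in> carrier (free_group S)"
  shows "word_metric G S (g \<otimes> word_eval G (\<lambda>s. s) (take i w)) (g \<otimes> word_eval G (\<lambda>s. s) (take j w))
    \<le> \<bar>real i - real j\<bar>"
proof -
  let ?g = "\<lambda>i. g \<otimes> word_eval G (\<lambda>s. s) (take i w)"
  have f: "(\<lambda>s. s) \<in> S \<rightarrow> carrier G" using S by auto
  have c: "?g i \<in> carrier G" for i
    using g free_group_take_drop[OF w, of i] by (auto simp: free_group_carrier intro!: word_eval_closed[OF f])
  have le: "word_metric G S (?g i) (?g j) \<le> real j - real i" if "i \<le> j" for i j
  proof -
    have "take (j - i) (drop i w) \<in> carrier (free_group S)"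
      by (intro free_group_take_drop w)
    from word_norm_le[OF this] have "word_norm G S (inv (?g i) \<otimes> ?g j) \<le> j - i"
      unfolding word_path_increment[OF S(1) g w that] by simp
    then show ?thesis using that by (simp add: word_metric_def of_nat_diff flip: of_nat_le_iff)
  qed
  have "word_metric G S (?g i) (?g j) = word_metric G S (?g j) (?g i)"
    \<comment> \<open>Scaling by 1 gives back the word metric.\<close>
    using rescaled_word_metric_sym[OF S, of "\<lambda>_. 1", OF _ c c]
    by (simp add: rescaled_word_metric_def)
  then show ?thesis using le[of i j] le[of j i] by (cases "i \<le> j") auto
qed

text \<open>The numerical core: grid edges of rescaled length below 1/4 bound squares of perimeter
  at most s n in G. Such perimeters are relators of length at most m n, where m n rounds s n up,
  whereas the relator w n was chosen outside their normal closure.\<close>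

theorem linear_gaps_imp_not_simply_connected_cone:
  assumes fgS: "finite_generating_set G S" and \<omega>: "nonprincipal_ultrafilter \<omega>"
    and x: "range x \<subseteq> carrier G" and s: "\<And>n. 0 < s n" "filterlim s at_top \<omega>"
    and gaps: "\<exists>C. \<forall>n\<ge>1. \<exists>w\<in>relation_subgroup G S.
      length w \<le> C * n \<and> w \<notin> relation_subgroup_upto G S (int n)"
  shows "\<not> simply_connected_space (asymptotic_cone G S \<omega> x s)"
proof
  assume sc: "simply_connected_space (asymptotic_cone G S \<omega> x s)"
  let ?F = "free_group S" and ?ev = "word_eval G (\<lambda>s. s)" and ?d = "rescaled_word_metric G S s"
  let ?X = "ultralimit_seqs \<omega> (\<lambda>n. carrier G) ?d x" and ?D = "ultralimit_predist \<omega> ?d"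
  let ?M = "ultralimit_points \<omega> (\<lambda>n. carrier G) ?d x"
  let ?dist = "ultralimit_dist \<omega> (\<lambda>n. carrier G) ?d x"
  have S: "S \<subseteq> carrier G" "generate G S = carrier G"
    using fgS by (auto simp: finite_generating_set_def)
  have xG: "x n \<in> carrier G" for n using x by auto
  have nb: "\<omega> \<noteq> bot" using \<omega> by (simp add: nonprincipal_ultrafilter_def)
  have idS: "(\<lambda>s. s) \<in> S \<rightarrow> carrier G" using S by auto
  interpret F: group ?F by (rule group_free_group)
  note ul = \<omega> rescaled_word_metric_nonneg[OF S s(1)] rescaled_word_metric_refl[OF S s(1)]
    rescaled_word_metric_sym[OF S s(1)] rescaled_word_metric_triangle[OF S s(1)] xG
  have lim: "((\<lambda>n. ?d n (y n) (z n)) \<longlongrightarrow> ?D y z) \<omega>" if "y \<in> ?X" "z \<in> ?X" for y z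
    by (rule ultralimit_predist_tendsto[where M = "\<lambda>n. carrier G"]) (use ul that in auto)
  have pt_ne: "\<exists>y. y \<in> A" and pt_sub: "A \<subseteq> ?X" if "A \<in> ?M" for A
    by (rule ultralimit_point_nonempty ultralimit_point_subset; use ul that in auto)+
  have pt_ex: "\<exists>A\<in>?M. y \<in> A" if "y \<in> ?X" for y
    by (rule ultralimit_point_exists) (use ul that in auto)
  have dist: "?dist A B = ?D y z" if "A \<in> ?M" "B \<in> ?M" "y \<in> A" "z \<in> B" for A B y z
    by (rule ultralimit_dist_eq[where M = "\<lambda>n. carrier G"]) (use ul that in auto)
  interpret cone: Metric_space ?M ?dist
    by (rule Metric_space_asymptotic_cone[OF fgS \<omega> x s(1)])

  define m where "m n = nat \<lceil>s n\<rceil>" for n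
  have m: "1 \<le> m n" "s n \<le> real (m n)" "real (m n) \<le> s n + 1" for n
    using s(1)[of n] by (auto simp: m_def) linarith+
  obtain C where C: "\<And>n. 1 \<le> n \<Longrightarrow> \<exists>w\<in>relation_subgroup G S.
      length w \<le> C * n \<and> w \<notin> relation_subgroup_upto G S (int n)"
    using gaps by blast
  obtain w where w: "\<And>n. w n \<in> relation_subgroup G S" "\<And>n. length (w n) \<le> C * m n"
    "\<And>n. w n \<notin> relation_subgroup_upto G S (int (m n))"
    using C[OF m(1)] by metis
  have wF: "w n \<in> carrier ?F" and w1: "?ev (w n) = \<one>" for n
    using w(1)[of n] by (auto simp: relation_subgroup_iff)
  define L where "L n = length (w n)" for n
  have L: "real (L n) \<le> real C * (s n + 1)" for n
  proof -
    have "real (L n) \<le> real (C * m n)" using w(2)[of n] unfolding L_def by (simp only: of_nat_le_iff)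
    also have "\<dots> \<le> real C * (s n + 1)" using m(3)[of n] by (simp add: mult_left_mono)
    finally show ?thesis .
  qed

  \<comment> \<open>The loop of w n based at x n, run through proportionally in unit time. Values at
    0 and 1 agree exactly, since w n is a relator.\<close>
  define \<gamma> where "\<gamma> u n = x n \<otimes> ?ev (take (nat \<lfloor>u * real (L n)\<rfloor>) (w n))" for u n
  have \<gamma>G: "\<gamma> u n \<in> carrier G" for u n
    using free_group_take_drop(1)[OF wF] unfolding \<gamma>_def
    by (intro m_closed xG word_eval_closed[OF idS]) (simp add: free_group_carrier)
  have \<gamma>0: "\<gamma> 0 = x" using xG by (auto simp: \<gamma>_def fun_eq_iff)
  have \<gamma>1: "\<gamma> 1 = x" using xG w1 by (auto simp: \<gamma>_def L_def fun_eq_iff)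
  \<comment> \<open>The correction in the factor 1 + 1 / s n comes from rounding s n up to m n, the
    last summand from rounding the position in the word. Both vanish in the limit, leaving the
    Lipschitz constant C.\<close>
  define bd where "bd u n = u * real C * (1 + 1 / s n) + 1 / s n" for u n
  have \<gamma>d: "?d n (\<gamma> u n) (\<gamma> u' n) \<le> bd \<bar>u - u'\<bar> n" if "u \<in> {0..1}" "u' \<in> {0..1}" for u u' n
  proof -
    let ?i = "nat \<lfloor>u * real (L n)\<rfloor>" and ?j = "nat \<lfloor>u' * real (L n)\<rfloor>"
    have "0 \<le> u * real (L n)" "0 \<le> u' * real (L n)" using that by auto
    then have "\<bar>real ?i - real ?j\<bar> \<le> \<bar>u * real (L n) - u' * real (L n)\<bar> + 1"
      by (simp add: of_nat_nat) linarith
    also have "\<bar>u * real (L n) - u' * real (L n)\<bar> = \<bar>u - u'\<bar> * real (L n)"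
      by (simp add: abs_mult flip: left_diff_distrib)
    also have "\<dots> \<le> \<bar>u - u'\<bar> * (real C * (s n + 1))"
      using L by (intro mult_left_mono) auto
    finally have "word_metric G S (\<gamma> u n) (\<gamma> u' n) \<le> \<bar>u - u'\<bar> * (real C * (s n + 1)) + 1"
      using word_path_metric[OF S xG wF, of n ?i n ?j] unfolding \<gamma>_def by linarith
    then have "?d n (\<gamma> u n) (\<gamma> u' n) \<le> (\<bar>u - u'\<bar> * (real C * (s n + 1)) + 1) / s n"
      using s(1)[of n] by (simp add: rescaled_word_metric_def divide_right_mono)
    also have "\<dots> = bd \<bar>u - u'\<bar> n" using s(1)[of n] by (simp add: bd_def field_simps)
    finally show ?thesis .
  qed
  have s_inv: "((\<lambda>n. 1 / s n) \<longlongrightarrow> 0) \<omega>"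
    using tendsto_inverse_0_at_top[OF s(2)] by (simp add: inverse_eq_divide)
  have bd: "(bd u \<longlongrightarrow> u * real C) \<omega>" for u
  proof -
    have "((\<lambda>n. u * real C * (1 + 1 / s n) + 1 / s n) \<longlongrightarrow> u * real C * (1 + 0) + 0) \<omega>"
      by (intro tendsto_intros s_inv)
    then show ?thesis by (simp add: bd_def[abs_def])
  qed
  have \<gamma>X: "\<gamma> u \<in> ?X" if u: "u \<in> {0..1}" for u
  proof -
    have "\<forall>\<^sub>F n in \<omega>. bd \<bar>0 - u\<bar> n < \<bar>0 - u\<bar> * real C + 1"
      using order_tendstoD(2)[OF bd] by simp
    then have "\<forall>\<^sub>F n in \<omega>. ?d n (x n) (\<gamma> u n) \<le> \<bar>0 - u\<bar> * real C + 1"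
    proof eventually_elim
      case (elim n)
      then show ?case using \<gamma>d[of 0 u n] u unfolding \<gamma>0 by simp
    qed
    then show ?thesis using \<gamma>G unfolding ultralimit_seqs_def by blast
  qed
  have \<gamma>D: "?D (\<gamma> u) (\<gamma> u') \<le> \<bar>u - u'\<bar> * real C" if "u \<in> {0..1}" "u' \<in> {0..1}" for u u'
    by (rule tendsto_le[OF nb bd lim[OF \<gamma>X \<gamma>X]]) (use that \<gamma>d in auto)

  define p where "p u = (SOME A. A \<in> ?M \<and> \<gamma> u \<in> A)" for u
  have p: "p u \<in> ?M" "\<gamma> u \<in> p u" if "u \<in> {0..1}" for u
    using someI_ex[of "\<lambda>A. A \<in> ?M \<and> \<gamma> u \<in> A"] pt_ex[OF \<gamma>X[OF that]] by (auto simp: p_def)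
  have p01: "p 1 = p 0" by (simp add: p_def \<gamma>0 \<gamma>1)
  have pd: "?dist (p u) (p u') \<le> \<bar>u - u'\<bar> * real C" if "u \<in> {0..1}" "u' \<in> {0..1}" for u u'
    using \<gamma>D[OF that] dist[OF p(1)[OF that(1)] p(1)[OF that(2)] p(2)[OF that(1)] p(2)[OF that(2)]] by simp
  have cone_def: "asymptotic_cone G S \<omega> x s = cone.mtopology"
    by (simp add: asymptotic_cone_def)
  have path_p: "pathin cone.mtopology p"
    unfolding pathin_def cone.continuous_map_to_metric
  proof (intro ballI allI impI)
    fix u :: real and \<epsilon> :: real assume u: "u \<in> topspace (top_of_set {0..1})" and \<epsilon>: "0 < \<epsilon>"
    let ?U = "{0..1} \<inter> ball u (\<epsilon> / (real C + 1))"
    have "p u' \<in> cone.mball (p u) \<epsilon>" if "u' \<in> ?U" for u'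
    proof -
      have "\<bar>u - u'\<bar> * (real C + 1) < \<epsilon>" using that by (simp add: dist_real_def field_simps)
      moreover have "\<bar>u - u'\<bar> * real C \<le> \<bar>u - u'\<bar> * (real C + 1)" by (intro mult_left_mono) auto
      ultimately show ?thesis using pd[of u u'] p[of u] p[of u'] u that by simp
    qed
    moreover have "openin (top_of_set {0..1}) ?U" by (simp add: openin_open_Int)
    moreover have "u \<in> ?U" using u \<epsilon> by simp
    ultimately show "\<exists>U. openin (top_of_set {0..1}) U \<and> u \<in> U \<and> (\<forall>y\<in>U. p y \<in> cone.mball (p u) \<epsilon>)"
      by blast
  qed
  \<comment> \<open>The comparison loop is constant. A free homotopy through loops is enough,
    because the grid argument only needs its two vertical sides to coincide.\<close>
  have path_q: "pathin cone.mtopology (\<lambda>_. p 0)"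
    using p[of 0] by (simp add: pathin_def)
  have "homotopic_with (\<lambda>r. r 1 = r 0) (top_of_set {0..1}) cone.mtopology p (\<lambda>_. p 0)"
    using sc path_p path_q p01 unfolding simply_connected_space_def cone_def by blast
  then obtain h :: "real \<times> real \<Rightarrow> (nat \<Rightarrow> 'a) set" where
    h: "continuous_map (prod_topology (top_of_set {0..1}) (top_of_set {0..1})) cone.mtopology h"
    and h0: "\<And>u. h (0, u) = p u" and h1: "\<And>u. h (1, u) = p 0"
    and hloop: "\<And>t. t \<in> {0..1} \<Longrightarrow> h (t, 1) = h (t, 0)"
    unfolding homotopic_with_def by blast
  have hM: "h (t, u) \<in> ?M" if "t \<in> {0..1}" "u \<in> {0..1}" for t u
    using continuous_map_image_subset_topspace[OF h] that by auto
  obtain \<epsilon> where \<epsilon>: "0 < \<epsilon>" "\<And>a b. a \<in> {0..1} \<times> {0..1} \<Longrightarrow> b \<in> {0..1} \<times> {0..1} \<Longrightarrow>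
      dist a b < \<epsilon> \<Longrightarrow> ?dist (h a) (h b) < 1 / 4"
    using cone.continuous_square_uniform[OF h, of "1 / 4"] by (metis zero_less_divide_1_iff zero_less_numeral)

  \<comment> \<open>The summand 16 C makes the pieces of w n have length about s n / 16 at most,
    which leaves room for rounding below s n / 4. The other summand makes the mesh finer than the
    modulus \<open>\<epsilon>\<close>, and \<open>Suc\<close> makes k positive.\<close>
  define k where "k = Suc (16 * C + nat \<lceil>1 / \<epsilon>\<rceil>)"
  have k: "0 < k" "16 * C \<le> k" "1 / real k < \<epsilon>"
  proof -
    have "1 / \<epsilon> < real k"
      using real_nat_ceiling_ge[of "1 / \<epsilon>"] by (simp add: k_def)
    moreover have "0 < real k" by (simp add: k_def)
    ultimately show "1 / real k < \<epsilon>"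
      using \<epsilon>(1) by (simp add: pos_divide_less_eq mult.commute)
  qed (simp_all add: k_def)
  define r where "r i = real i / real k" for i
  have r: "r i \<in> {0..1}" if "i \<le> k" for i
    using that k(1) by (simp add: r_def divide_le_eq)
  have r0k: "r 0 = 0" "r k = 1" using k by (simp_all add: r_def)
  have rS: "\<bar>r i - r (Suc i)\<bar> < \<epsilon>" for i
    using k by (simp add: r_def flip: diff_divide_distrib)
  \<comment> \<open>Row 0 follows the given paths, so that its edges spell pieces of w n. Elsewhere
    the choice depends only on the point of the cone, so equal points get identical representatives;
    this makes the vertical sides coincide and the last row constant for every n, not just in the
    limit.\<close>
  define Y where "Y i j = (if i = 0 then \<gamma> (r j) else (SOME y. y \<in> h (r i, r j)))" for i j
  have Y: "Y i j \<in> h (r i, r j)" if "i \<le> k" "j \<le> k" for i j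
    using that p(2)[OF r] pt_ne[OF hM[OF r r]] by (auto simp: Y_def r0k h0 some_in_eq intro: someI_ex)
  have YX: "Y i j \<in> ?X" if "i \<le> k" "j \<le> k" for i j
    using Y[OF that] pt_sub[OF hM[OF r[OF that(1)] r[OF that(2)]]] by auto
  have edge: "\<forall>\<^sub>F n in \<omega>. ?d n (Y i j n) (Y i' j' n) < 1 / 4"
    if "i \<le> k" "j \<le> k" "i' \<le> k" "j' \<le> k" "dist (r i, r j) (r i', r j') < \<epsilon>" for i j i' j'
  proof -
    have "?D (Y i j) (Y i' j') < 1 / 4"
      using \<epsilon>(2)[OF _ _ that(5)] r that dist[OF hM[OF r r] hM[OF r r] Y Y, of i j i' j'] by simp
    then show ?thesis using order_tendstoD(2)[OF lim[OF YX YX]] that by blast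
  qed
  \<comment> \<open>The grid has finitely many edges, so a single n serves all of them.\<close>
  have "\<forall>\<^sub>F n in \<omega>. \<forall>i\<in>{..k}. \<forall>j\<in>{..<k}. ?d n (Y i j n) (Y i (Suc j) n) < 1 / 4"
    using rS by (intro eventually_ball_finite ballI edge) (auto simp: dist_Pair_Pair dist_real_def)
  moreover have "\<forall>\<^sub>F n in \<omega>. \<forall>i\<in>{..<k}. \<forall>j\<in>{..k}. ?d n (Y i j n) (Y (Suc i) j n) < 1 / 4"
    using rS by (intro eventually_ball_finite ballI edge) (auto simp: dist_Pair_Pair dist_real_def)
  \<comment> \<open>The bound 8 ensures (s n + 1) / 16 + 1 \<le> s n / 4, used for the lengths of
    the pieces of w n.\<close>
  moreover have "\<forall>\<^sub>F n in \<omega>. 8 \<le> s n"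
    using s(2) by (simp add: filterlim_at_top)
  ultimately have "\<forall>\<^sub>F n in \<omega>. (\<forall>i\<in>{..k}. \<forall>j\<in>{..<k}. ?d n (Y i j n) (Y i (Suc j) n) < 1 / 4) \<and>
      (\<forall>i\<in>{..<k}. \<forall>j\<in>{..k}. ?d n (Y i j n) (Y (Suc i) j n) < 1 / 4) \<and> 8 \<le> s n"
    by eventually_elim auto
  then obtain n where row: "\<And>i j. i \<le> k \<Longrightarrow> j < k \<Longrightarrow> ?d n (Y i j n) (Y i (Suc j) n) < 1 / 4"
    and col: "\<And>i j. i < k \<Longrightarrow> j \<le> k \<Longrightarrow> ?d n (Y i j n) (Y (Suc i) j n) < 1 / 4"
    and s8: "8 \<le> s n"
    using eventually_happens'[OF nb] by fastforce

  define l where "l = nat \<lfloor>s n / 4\<rfloor>"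
  have l_ge: "i \<le> l" if "real i \<le> s n / 4" for i
    using that by (simp add: l_def le_nat_floor)
  have norm_le: "word_norm G S (inv y \<otimes> z) \<le> l" if "?d n y z < 1 / 4" for y z
    using that s(1)[of n] by (intro l_ge) (simp add: rescaled_word_metric_def word_metric_def field_simps)
  let ?K = "relation_subgroup_upto G S (int (m n))"
  interpret K: normal ?K ?F by (rule relation_subgroup_upto_normal)
  have H: "group_hom ?F (?F Mod ?K) (\<lambda>a. ?K #>\<^bsub>?F\<^esub> a)"
    using K.factorgroup_is_group K.r_coset_hom_Mod
    by (intro group_hom.intro group_hom_axioms.intro F.group_axioms)
  define c where "c j = nat \<lfloor>r j * real (L n)\<rfloor>" for j
  \<comment> \<open>The cuts are the positions that \<open>\<gamma>\<close> reaches at the times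
    \<open>r j\<close>, so the pieces represent exactly the increments of row 0.\<close>
  define u where "u j = take (c (Suc j) - c j) (drop (c j) (w n))" for j
  have c_mono: "c j \<le> c (Suc j)" for j
    unfolding c_def by (intro nat_mono floor_mono mult_right_mono) (auto simp: r_def divide_right_mono)
  have c0: "c 0 = 0" and ck: "c k = L n" by (simp_all add: c_def r0k)
  have lu: "length (u j) \<le> l" for j
  proof (rule l_ge)
    have "real (length (u j)) \<le> real (c (Suc j)) - real (c j)"
      using c_mono[of j] by (simp add: u_def of_nat_diff flip: of_nat_le_iff)
    also have "\<dots> \<le> real (L n) / real k + 1"
    proof -
      have "r (Suc j) * real (L n) = r j * real (L n) + real (L n) / real k"
        by (simp add: r_def add_divide_distrib algebra_simps)
      moreover have "0 \<le> r j * real (L n)" "0 \<le> real (L n) / real k" by (simp_all add: r_def)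
      ultimately show ?thesis unfolding c_def by (simp add: of_nat_nat) linarith
    qed
    also have "\<dots> \<le> (s n + 1) / 16 + 1"
    proof -
      have "real (16 * C) \<le> real k" using k(2) by (simp only: of_nat_le_iff)
      then have "16 * real C * (s n + 1) \<le> real k * (s n + 1)"
        using s8 by (intro mult_right_mono) auto
      then have "16 * real (L n) \<le> real k * (s n + 1)" using L[of n] by linarith
      then show ?thesis using k(1) by (simp add: field_simps)
    qed
    also have "\<dots> \<le> s n / 4" using s8 by (simp add: field_simps)
    finally show "real (length (u j)) \<le> s n / 4" .
  qed
  have "?K #>\<^bsub>?F\<^esub> iter_mult ?F u k = \<one>\<^bsub>?F Mod ?K\<^esub>"
  proof (rule relator_grid[OF S H, where y = "\<lambda>i j. Y i j n" and l = l and k = k])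
    fix v assume v: "v \<in> relation_subgroup G S" "length v \<le> 4 * l"
    \<comment> \<open>Relators of length at most 4 l have length at most m n, so they lie in the
      subgroup by which the free group is divided.\<close>
    have "4 * real l \<le> s n" using s(1)[of n] by (simp add: l_def) linarith
    then have "real (length v) \<le> real (m n)" using v(2) m(2)[of n] by linarith
    then have "v \<in> ?K" using v by (intro relation_subgroup_uptoI) auto
    then show "?K #>\<^bsub>?F\<^esub> v = \<one>\<^bsub>?F Mod ?K\<^esub>"
      using K.rcos_const[OF F.group_axioms] by (simp add: FactGroup_def)
  next
    fix i j assume "i \<le> k" "j \<le> k"
    then show "Y i j n \<in> carrier G" using YX by (simp add: ultralimit_seqs_def)
  next
    fix i assume "i \<le> k"
    then show "Y i k n = Y i 0 n" using hloop[OF r] by (simp add: Y_def r0k \<gamma>0 \<gamma>1)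
  next
    fix j assume "j < k"
    show "Y k (Suc j) n = Y k j n" using k by (simp add: Y_def r0k h1)
  next
    fix j assume "j < k"
    show "u j \<in> carrier ?F" unfolding u_def by (intro free_group_take_drop wF)
    show "?ev (u j) = inv (Y 0 j n) \<otimes> Y 0 (Suc j) n"
      using word_path_increment[OF S(1) xG[of n] wF[of n] c_mono[of j]]
      by (simp add: u_def Y_def \<gamma>_def c_def)
  qed (use norm_le row col lu in auto)
  moreover have "iter_mult ?F u k = w n"
    unfolding u_def using iter_mult_cut_word[OF wF c0 c_mono, of n k] by (simp add: ck L_def)
  ultimately have "?K #>\<^bsub>?F\<^esub> w n = ?K" by (simp add: FactGroup_def)
  then have "w n \<in> ?K" using F.coset_join1 wF K.is_subgroup by blast
  then show False using w(3) by blast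
qed

end

text \<open>Density asks for one finite generating set only, whereas the claim about cones concerns
  all of them. The gap statement is therefore proved for each S and feeds both parts
  directly.\<close>

theorem theorem1p10:
  fixes G :: "('a, 'b) monoid_scheme" and N Q :: "'a set"
  assumes "group G"
    and "finitely_generated G"
    and "semidirect_product G N Q"
    and "G\<lparr>carrier := Q\<rparr> \<cong> integer_group"
    and "infinite N"
    and "locally_finite_subgroup G N"
    and "satisfies_law G"
  shows "densely_related G \<and>
    (\<forall>S \<omega> x s. finite_generating_set G S \<longrightarrow> nonprincipal_ultrafilter \<omega> \<longrightarrow>
       range x \<subseteq> carrier G \<longrightarrow> (\<forall>n. 0 < s n) \<longrightarrow> filterlim s at_top \<omega> \<longrightarrow>
       \<not> simply_connected_space (asymptotic_cone G S \<omega> x s))"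
proof -
  interpret group G by fact
  have gaps: "\<exists>C. \<forall>n\<ge>1. \<exists>w\<in>relation_subgroup G S.
      length w \<le> C * n \<and> w \<notin> relation_subgroup_upto G S (int n)"
    if "finite_generating_set G S" for S
    using locally_finite_by_integer_linear_gaps[OF assms(3-7) that] .
  obtain S where S: "finite_generating_set G S"
    using assms(2) by (auto simp: finitely_generated_def)
  have "densely_related G"
    by (rule linear_gaps_imp_densely_related[OF S gaps[OF S]])
  moreover have "\<not> simply_connected_space (asymptotic_cone G S \<omega> x s)"
    if "finite_generating_set G S" "nonprincipal_ultrafilter \<omega>" "range x \<subseteq> carrier G"
      "\<forall>n. 0 < s n" "filterlim s at_top \<omega>" for S \<omega> x s
    using that(4) by (intro linear_gaps_imp_not_simply_connected_cone that gaps) simp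
  ultimately show ?thesis by simp
qed

end
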